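(* Assume $p>0$ a.e. on $(a,b)$. Suppose there exist $\lambda_a,\lambda_b\in\mathbb R$ such that $\tau-\lambda_a$ is non-oscillatory at $a$ and $\tau-\lambda_b$ is non-oscillatory at $b$. Then $T_0$, and hence any self-adjoint extension $S$ of the minimal operator $T_{\min}$, is bounded from below. That is, there exists $\gamma_S\in\mathbb R$ such that $$\langle u,Su\rangle\ge\gamma_S\langle u,u\rangle,\quad u\in\operatorname{dom}(S),$$ where $\langle\cdot,\cdot\rangle$ is the inner product of $L^2((a,b);r(x)dx)$.
   Context: Setting. $(a,b)\subseteq\mathbb R$ is an open interval (possibly unbounded); $p,q,r,s$ are Lebesgue measurable and real-valued a.e. on $(a,b)$, with $p^{-1},q,r,s\in L^1_{\mathrm{loc}}((a,b);dx)$, $r>0$ and $p\neq0$ a.e. For $f\in AC_{\mathrm{loc}}((a,b))$ put $f^{[1]}=p(f'+sf)$, $\mathfrak D_\tau=\{f\in AC_{\mathrm{loc}}((a,b)) : f^{[1]}\in AC_{\mathrm{loc}}((a,b))\}$, and $\tau f=\frac1r\big(-(f^{[1]})'+sf^{[1]}+qf\big)$ for $f\in\mathfrak D_\tau$. In $L^2((a,b);r(x)dx)$ the maximal operator is $T_{\max}f=\tau f$, $\operatorname{dom}(T_{\max})=\{g\in L^2((a,b);r\,dx): g\in\mathfrak D_\tau,\ \tau g\in L^2((a,b);r\,dx)\}$; $T_0$ is the restriction of $T_{\max}$ to functions with compact support in $(a,b)$ (densely defined, symmetric), and $T_{\min}=\overline{T_0}$. For $\lambda\in\mathbb R$, $\tau-\lambda$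 is called oscillatory at an endpoint if some nontrivial real-valued solution of $(\tau-\lambda)u=0$ has infinitely many zeros accumulating at that endpoint; otherwise non-oscillatory there. *)

theory Defs
  imports "HOL-Analysis.Analysis"
begin

section \<open>Local integrability and local absolute continuity\<close>

definition locally_integrable_on :: "(real \<Rightarrow> real) \<Rightarrow> real set \<Rightarrow> bool"
  (infixr "locally'_integrable'_on" 46)
  where "f locally_integrable_on I \<longleftrightarrow>
    (\<forall>K. compact K \<and> K \<subseteq> I \<longrightarrow> set_integrable lebesgue K f)"

text \<open>The usual epsilon-delta definition; the finite families of non-overlapping compact
  subintervals of \<open>{c..d}\<close> are the library's divisions \<open>D\<close> (of their own union).\<close>

definition abs_continuous_between :: "(real \<Rightarrow> 'a::real_normed_vector) \<Rightarrow> real \<Rightarrow> real \<Rightarrow> bool"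
  where "abs_continuous_between f c d \<longleftrightarrow>
    (\<forall>\<epsilon>>0. \<exists>\<delta>>0. \<forall>D. D division_of \<Union>D \<and> \<Union>D \<subseteq> {c..d} \<and> (\<Sum>k\<in>D. Sup k - Inf k) < \<delta>
        \<longrightarrow> (\<Sum>k\<in>D. norm (f (Sup k) - f (Inf k))) < \<epsilon>)"

definition AC_loc :: "real set \<Rightarrow> (real \<Rightarrow> 'a::real_normed_vector) set"
  where "AC_loc I = {f. \<forall>c d. {c..d} \<subseteq> I \<longrightarrow> abs_continuous_between f c d}"


section \<open>Operators in a complex Hilbert space of square-integrable functions\<close>

text \<open>Elements of \<open>L\<^sup>2(M)\<close> are handled through representatives. An operator is given by its
  graph, a set of pairs of representatives that is invariant under changing either component
  almost everywhere. The inner product is conjugate-linear in the first argument.\<close>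

definition L2 :: "'x measure \<Rightarrow> ('x \<Rightarrow> complex) set"
  where "L2 M = {f \<in> borel_measurable M. integrable M (\<lambda>x. (cmod (f x))\<^sup>2)}"

definition L2_inner :: "'x measure \<Rightarrow> ('x \<Rightarrow> complex) \<Rightarrow> ('x \<Rightarrow> complex) \<Rightarrow> complex"
  where "L2_inner M f g = (LINT x|M. cnj (f x) * g x)"

definition L2_norm :: "'x measure \<Rightarrow> ('x \<Rightarrow> complex) \<Rightarrow> real"
  where "L2_norm M f = sqrt (LINT x|M. (cmod (f x))\<^sup>2)"

type_synonym 'x l2_graph = "(('x \<Rightarrow> complex) \<times> ('x \<Rightarrow> complex)) set"

definition L2_operator :: "'x measure \<Rightarrow> 'x l2_graph \<Rightarrow> bool"
  where "L2_operator M T \<longleftrightarrow>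
    T \<subseteq> L2 M \<times> L2 M
    \<and> (\<lambda>x. 0, \<lambda>x. 0) \<in> T
    \<and> (\<forall>f g f' g'. (f, g) \<in> T \<and> (f', g') \<in> T \<longrightarrow> (\<lambda>x. f x + f' x, \<lambda>x. g x + g' x) \<in> T)
    \<and> (\<forall>f g c. (f, g) \<in> T \<longrightarrow> (\<lambda>x. c * f x, \<lambda>x. c * g x) \<in> T)
    \<and> (\<forall>f g. \<forall>f'\<in>L2 M. \<forall>g'\<in>L2 M. (f, g) \<in> T
          \<and> (AE x in M. f x = f' x) \<and> (AE x in M. g x = g' x) \<longrightarrow> (f', g') \<in> T)
    \<and> (\<forall>f g f' g'. (f, g) \<in> T \<and> (f', g') \<in> T \<and> (AE x in M. f x = f' x)
          \<longrightarrow> (AE x in M. g x = g' x))"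

definition L2_closure :: "'x measure \<Rightarrow> 'x l2_graph \<Rightarrow> 'x l2_graph"
  where "L2_closure M T = {(f, g). f \<in> L2 M \<and> g \<in> L2 M \<and>
    (\<exists>F G. (\<forall>n::nat. (F n, G n) \<in> T)
       \<and> (\<lambda>n. L2_norm M (\<lambda>x. F n x - f x)) \<longlonglongrightarrow> 0
       \<and> (\<lambda>n. L2_norm M (\<lambda>x. G n x - g x)) \<longlonglongrightarrow> 0)}"

definition L2_densely_defined :: "'x measure \<Rightarrow> 'x l2_graph \<Rightarrow> bool"
  where "L2_densely_defined M T \<longleftrightarrow>
    (\<forall>f\<in>L2 M. \<forall>\<epsilon>>0. \<exists>(u, v)\<in>T. L2_norm M (\<lambda>x. u x - f x) < \<epsilon>)"

definition L2_adjoint :: "'x measure \<Rightarrow> 'x l2_graph \<Rightarrow> 'x l2_graph"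
  where "L2_adjoint M T = {(f, g). f \<in> L2 M \<and> g \<in> L2 M \<and>
    (\<forall>(u, v)\<in>T. L2_inner M f v = L2_inner M g u)}"

definition L2_self_adjoint :: "'x measure \<Rightarrow> 'x l2_graph \<Rightarrow> bool"
  where "L2_self_adjoint M S \<longleftrightarrow>
    L2_operator M S \<and> L2_densely_defined M S \<and> L2_adjoint M S = S"

text \<open>The inequality \<open>\<langle>u, T u\<rangle> \<ge> \<gamma> \<langle>u, u\<rangle>\<close> includes that \<open>\<langle>u, T u\<rangle>\<close> is real.\<close>

definition L2_bounded_below :: "'x measure \<Rightarrow> 'x l2_graph \<Rightarrow> bool"
  where "L2_bounded_below M T \<longleftrightarrow>
    (\<exists>\<gamma>::real. \<forall>(u, v)\<in>T. L2_inner M u v \<in> \<real>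
       \<and> Re (L2_inner M u v) \<ge> \<gamma> * Re (L2_inner M u u))"


section \<open>Sturm--Liouville expressions with distributional potentials\<close>

locale sturm_liouville =
  fixes a b :: ereal and p q r s :: "real \<Rightarrow> real"
  assumes interval: "a < b"
    and measurable:
      "p \<in> borel_measurable (lebesgue_on (einterval a b))"
      "q \<in> borel_measurable (lebesgue_on (einterval a b))"
      "r \<in> borel_measurable (lebesgue_on (einterval a b))"
      "s \<in> borel_measurable (lebesgue_on (einterval a b))"
    and locally_integrable:
      "(\<lambda>x. inverse (p x)) locally_integrable_on einterval a b"
      "q locally_integrable_on einterval a b"
      "r locally_integrable_on einterval a b"
      "s locally_integrable_on einterval a b"
    and r_pos: "AE x in lebesgue_on (einterval a b). r x > 0"
    and p_nonzero: "AE x in lebesgue_on (einterval a b). p x \<noteq> 0"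

text \<open>The measure \<open>r(x) dx\<close> on \<open>(a, b)\<close>.\<close>

definition SL_measure :: "ereal \<Rightarrow> ereal \<Rightarrow> (real \<Rightarrow> real) \<Rightarrow> real measure"
  where "SL_measure a b r = density (lebesgue_on (einterval a b)) (\<lambda>x. ennreal (r x))"

text \<open>The quasi-derivative \<open>p (f' + s f)\<close> is only determined almost everywhere, so its being
  locally absolutely continuous means that it has a representative \<open>g\<close> in \<open>AC_loc\<close>, which is
  then unique on \<open>(a, b)\<close>; \<open>SL_quasi_deriv\<close> picks it. Values outside \<open>(a, b)\<close> are irrelevant.\<close>

definition SL_is_quasi_deriv ::
    "ereal \<Rightarrow> ereal \<Rightarrow> (real \<Rightarrow> real) \<Rightarrow> (real \<Rightarrow> real) \<Rightarrow> (real \<Rightarrow> complex) \<Rightarrow> (real \<Rightarrow> complex) \<Rightarrow> bool"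
  where "SL_is_quasi_deriv a b p s f g \<longleftrightarrow> g \<in> AC_loc (einterval a b) \<and>
    (AE x in lebesgue_on (einterval a b).
       g x = of_real (p x) * (vector_derivative f (at x) + of_real (s x) * f x))"

definition SL_quasi_deriv ::
    "ereal \<Rightarrow> ereal \<Rightarrow> (real \<Rightarrow> real) \<Rightarrow> (real \<Rightarrow> real) \<Rightarrow> (real \<Rightarrow> complex) \<Rightarrow> real \<Rightarrow> complex"
  where "SL_quasi_deriv a b p s f = (SOME g. SL_is_quasi_deriv a b p s f g)"

definition SL_domain ::
    "ereal \<Rightarrow> ereal \<Rightarrow> (real \<Rightarrow> real) \<Rightarrow> (real \<Rightarrow> real) \<Rightarrow> (real \<Rightarrow> complex) set"
  where "SL_domain a b p s =
    {f \<in> AC_loc (einterval a b). \<exists>g. SL_is_quasi_deriv a b p s f g}"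

text \<open>The expression \<open>\<tau> f\<close>, meaningful almost everywhere on \<open>(a, b)\<close> for \<open>f\<close> in \<open>SL_domain\<close>.\<close>

definition SL_tau ::
    "ereal \<Rightarrow> ereal \<Rightarrow> (real \<Rightarrow> real) \<Rightarrow> (real \<Rightarrow> real) \<Rightarrow> (real \<Rightarrow> real) \<Rightarrow> (real \<Rightarrow> real)
      \<Rightarrow> (real \<Rightarrow> complex) \<Rightarrow> real \<Rightarrow> complex"
  where "SL_tau a b p q r s f x =
    (- vector_derivative (SL_quasi_deriv a b p s f) (at x)
      + of_real (s x) * SL_quasi_deriv a b p s f x + of_real (q x) * f x) / of_real (r x)"

definition T_max ::
    "ereal \<Rightarrow> ereal \<Rightarrow> (real \<Rightarrow> real) \<Rightarrow> (real \<Rightarrow> real) \<Rightarrow> (real \<Rightarrow> real) \<Rightarrow> (real \<Rightarrow> real) \<Rightarrow> real l2_graph"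
  where "T_max a b p q r s =
    {(f, g). f \<in> L2 (SL_measure a b r) \<and> g \<in> L2 (SL_measure a b r) \<and>
      (\<exists>h\<in>SL_domain a b p s. (AE x in SL_measure a b r. f x = h x)
         \<and> (AE x in SL_measure a b r. g x = SL_tau a b p q r s h x))}"

definition T_0 ::
    "ereal \<Rightarrow> ereal \<Rightarrow> (real \<Rightarrow> real) \<Rightarrow> (real \<Rightarrow> real) \<Rightarrow> (real \<Rightarrow> real) \<Rightarrow> (real \<Rightarrow> real) \<Rightarrow> real l2_graph"
  where "T_0 a b p q r s =
    {(f, g) \<in> T_max a b p q r s.
      \<exists>K. compact K \<and> K \<subseteq> einterval a b \<and> (AE x in SL_measure a b r. x \<notin> K \<longrightarrow> f x = 0)}"

definition T_min ::
    "ereal \<Rightarrow> ereal \<Rightarrow> (real \<Rightarrow> real) \<Rightarrow> (real \<Rightarrow> real) \<Rightarrow> (real \<Rightarrow> real) \<Rightarrow> (real \<Rightarrow> real) \<Rightarrow> real l2_graph"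
  where "T_min a b p q r s = L2_closure (SL_measure a b r) (T_0 a b p q r s)"


section \<open>Oscillation at an endpoint\<close>

definition SL_nontrivial_real_solution ::
    "ereal \<Rightarrow> ereal \<Rightarrow> (real \<Rightarrow> real) \<Rightarrow> (real \<Rightarrow> real) \<Rightarrow> (real \<Rightarrow> real) \<Rightarrow> (real \<Rightarrow> real)
      \<Rightarrow> real \<Rightarrow> (real \<Rightarrow> complex) \<Rightarrow> bool"
  where "SL_nontrivial_real_solution a b p q r s l u \<longleftrightarrow>
    u \<in> SL_domain a b p s
    \<and> (AE x in lebesgue_on (einterval a b). SL_tau a b p q r s u x - of_real l * u x = 0)
    \<and> (\<forall>x\<in>einterval a b. u x \<in> \<real>)
    \<and> (\<exists>x\<in>einterval a b. u x \<noteq> 0)"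

definition SL_oscillatory_left ::
    "ereal \<Rightarrow> ereal \<Rightarrow> (real \<Rightarrow> real) \<Rightarrow> (real \<Rightarrow> real) \<Rightarrow> (real \<Rightarrow> real) \<Rightarrow> (real \<Rightarrow> real) \<Rightarrow> real \<Rightarrow> bool"
  where "SL_oscillatory_left a b p q r s l \<longleftrightarrow>
    (\<exists>u. SL_nontrivial_real_solution a b p q r s l u
       \<and> (\<forall>c\<in>einterval a b. infinite {x \<in> einterval a b. x < c \<and> u x = 0}))"

definition SL_oscillatory_right ::
    "ereal \<Rightarrow> ereal \<Rightarrow> (real \<Rightarrow> real) \<Rightarrow> (real \<Rightarrow> real) \<Rightarrow> (real \<Rightarrow> real) \<Rightarrow> (real \<Rightarrow> real) \<Rightarrow> real \<Rightarrow> bool"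
  where "SL_oscillatory_right a b p q r s l \<longleftrightarrow>
    (\<exists>u. SL_nontrivial_real_solution a b p q r s l u
       \<and> (\<forall>c\<in>einterval a b. infinite {x \<in> einterval a b. c < x \<and> u x = 0}))"

end

theory Submission
  imports Defs "HOL-Library.Function_Algebras"
begin

text \<open>
  On compactly supported functions, \<open>\<langle>f, \<tau> f\<rangle>\<close> is the quadratic form
  \<open>\<integral> |f\<^sup>[\<^sup>1\<^sup>]|\<^sup>2 / p + q |f|\<^sup>2\<close>. Wherever a solution \<open>u\<close> of \<open>\<tau> u = \<lambda> u\<close> has no zeros, completing the square with
  \<open>v = u\<^sup>[\<^sup>1\<^sup>] / u\<close> (Jacobi) bounds the form below by \<open>\<lambda> \<integral> r |f|\<^sup>2\<close> plus boundary terms. Non-oscillation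
  provides such \<open>v\<close> near \<open>a\<close> and near \<open>b\<close>; on the compact interval in between, a
  solution of the Riccati inequality with sufficiently negative \<open>\<lambda>\<close> connects the two with jumps of the
  favourable sign. Hence \<open>T\<^sub>0 \<ge> \<gamma>\<close>.

  For a self-adjoint extension \<open>S\<close> take a real \<open>l < \<gamma>\<close>. By variation of constants the range of
  \<open>T\<^sub>0 - l\<close> contains every compactly supported function orthogonal to the two solutions of
  \<open>\<tau> u = l u\<close>, so its closure has finite codimension. On the subspace of the domain of \<open>S\<close> that
  \<open>S - l\<close> maps into this closure, \<open>S - l \<ge> 0\<close> by approximation and symmetry. Finally, a symmetric
  operator that is bounded below on a subspace of finite codimension of its domain is bounded below; no spectral
  theory and no description of the adjoint of \<open>T\<^sub>0\<close> is needed.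
\<close>

section \<open>Absolutely continuous functions on the line\<close>

text \<open>Absolute continuity is given by an epsilon-delta condition and derivatives by
  \<open>vector_derivative\<close>; all later arguments rest on one working relation instead:
  \<open>f\<close> is an indefinite integral of \<open>\<phi>\<close> on every compact subinterval.
  Two obstacles shape the rest. A solution without zeros near \<open>a\<close> may vanish further
  right, and the parameters at the two end points are unrelated, so no single positive solution is
  at hand. Hence only the Riccati variable is continued across the middle, where a very negative
  parameter costs nothing but the size of \<open>\<gamma>\<close>. Secondly, solutions
  \<open>u\<close>, \<open>w\<close> of the equation with parameter \<open>l\<close> need not be
  square-integrable, so orthogonality to them is a condition on compactly supported functions only,
  and the functionals may be unbounded there. An unbounded functional has a dense kernel and nothing
  is lost; for a bounded one the closure of the kernel drops by one dimension. Either way the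
  codimension grows by at most one. Everything is done over the reals with the real part of the
  inner product, so each complex condition counts twice.\<close>

lemma division_ofI_Icc:
  assumes "finite D" "\<And>k. k \<in> D \<Longrightarrow> \<exists>l u. k = {l..u::real} \<and> l \<le> u"
    "\<And>k k'. \<lbrakk>k \<in> D; k' \<in> D; k \<noteq> k'\<rbrakk> \<Longrightarrow> interior k \<inter> interior k' = {}"
  shows "D division_of \<Union>D"
proof (rule division_ofI)
  fix k assume "k \<in> D"
  then obtain l u where "k = {l..u}" "l \<le> u" using assms(2) by blast
  then show "k \<noteq> {}" "\<exists>a b. k = cbox a b" by auto
qed (use assms in auto)

lemma division_of_Icc:
  assumes "D division_of S" "k \<in> D"
  obtains l u :: real where "k = {l..u}" "l \<le> u" "Inf k = l" "Sup k = u"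
proof -
  obtain l u where k: "k = cbox l u" using assms by (meson division_ofD(4))
  moreover have "k \<noteq> {}" using assms by (meson division_ofD(3))
  ultimately show thesis by (intro that[of l u]) auto
qed

text \<open>An absolutely continuous function is a difference of two monotone ones, and a monotone one is
  the distribution function of a measure with a density. This makes \<open>vector_derivative\<close>, which is an
  arbitrary value at points of non-differentiability, meaningful almost everywhere.\<close>

definition total_increment :: "(real \<Rightarrow> real) \<Rightarrow> real set set \<Rightarrow> real"
  where "total_increment f D = (\<Sum>k\<in>D. f (Sup k) - f (Inf k))"

text \<open>Inserting \<open>f y\<close> telescopes: the increment of an interval cut at
  \<open>y\<close> is the sum of the increments of its parts. The unions are only claimed to be
  included because one-point intervals are dropped.\<close>

lemma total_increment_split:
  assumes D: "D division_of \<Union>D"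
  obtains D1 D2 where "D1 division_of \<Union>D1" "D2 division_of \<Union>D2"
    "\<Union>D1 \<subseteq> \<Union>D \<inter> {..y}" "\<Union>D2 \<subseteq> \<Union>D \<inter> {y..}"
    "total_increment f D = total_increment f D1 + total_increment f D2"
proof -
  have fin: "finite D" using D by (rule division_of_finite)
  \<comment> \<open>Only nondegenerate intervals are cut. Their pieces have nonempty interior, so
    different intervals have different pieces and sums over the images can be reindexed. An interval
    straddling \<open>y\<close> lies in both \<open>A\<close> and \<open>B\<close>.\<close>
  define A where "A = {k \<in> D. Inf k < y \<and> Inf k < Sup k}"
  define B where "B = {k \<in> D. y < Sup k \<and> Inf k < Sup k}"
  define l where "l = (\<lambda>k. k \<inter> {..y})"
  define r where "r = (\<lambda>k. k \<inter> {y..})"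
  have finAB: "finite A" "finite B" using fin by (auto simp: A_def B_def)
  have l: "l k = {Inf k..min (Sup k) y}" "Inf k < min (Sup k) y" "interior (l k) \<noteq> {}"
      "Inf (l k) = Inf k" "Sup (l k) = min (Sup k) y" if "k \<in> A" for k
  proof -
    have "k \<in> D" and *: "Inf k < y" "Inf k < Sup k" using that by (auto simp: A_def)
    then obtain a b where "k = {a..b}" "Inf k = a" "Sup k = b" using division_of_Icc[OF D] by metis
    then show "l k = {Inf k..min (Sup k) y}" and 2: "Inf k < min (Sup k) y"
      using * by (auto simp: l_def)
    then show "interior (l k) \<noteq> {}" "Inf (l k) = Inf k" "Sup (l k) = min (Sup k) y"
      by (auto simp: interior_atLeastAtMost_real dest: less_imp_le)
  qed
  have r: "r k = {max (Inf k) y..Sup k}" "max (Inf k) y < Sup k" "interior (r k) \<noteq> {}"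
      "Inf (r k) = max (Inf k) y" "Sup (r k) = Sup k" if "k \<in> B" for k
  proof -
    have "k \<in> D" and *: "y < Sup k" "Inf k < Sup k" using that by (auto simp: B_def)
    then obtain a b where "k = {a..b}" "Inf k = a" "Sup k = b" using division_of_Icc[OF D] by metis
    then show "r k = {max (Inf k) y..Sup k}" and 2: "max (Inf k) y < Sup k"
      using * by (auto simp: r_def)
    then show "interior (r k) \<noteq> {}" "Inf (r k) = max (Inf k) y" "Sup (r k) = Sup k"
      by (auto simp: interior_atLeastAtMost_real dest: less_imp_le)
  qed
  have disj: "interior k \<inter> interior k' = {}" if "k \<in> D" "k' \<in> D" "k \<noteq> k'" for k k'
    using division_ofD(5)[OF D] that by blast
  have subl: "interior (l k) \<subseteq> interior k" and subr: "interior (r k) \<subseteq> interior k" for k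
    by (auto simp: l_def r_def intro!: interior_mono)
  have injl: "inj_on l A"
  proof (rule inj_onI, rule ccontr)
    fix k k' assume k: "k \<in> A" "k' \<in> A" "l k = l k'" "k \<noteq> k'"
    then have "interior (l k) \<subseteq> interior k \<inter> interior k'" using subl[of k] subl[of k'] by simp
    with k l(3) disj[of k k'] show False by (auto simp: A_def)
  qed
  have injr: "inj_on r B"
  proof (rule inj_onI, rule ccontr)
    fix k k' assume k: "k \<in> B" "k' \<in> B" "r k = r k'" "k \<noteq> k'"
    then have "interior (r k) \<subseteq> interior k \<inter> interior k'" using subr[of k] subr[of k'] by simp
    with k r(3) disj[of k k'] show False by (auto simp: B_def)
  qed
  show thesis
  proof (rule that[of "l ` A" "r ` B"])
    show "l ` A division_of \<Union>(l ` A)"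
    proof (rule division_ofI_Icc)
      fix k assume "k \<in> l ` A"
      then obtain k' where "k' \<in> A" "k = l k'" by auto
      with l(1,2)[of k'] show "\<exists>l u. k = {l..u} \<and> l \<le> u" using less_imp_le by blast
    next
      fix k k' assume "k \<in> l ` A" "k' \<in> l ` A" "k \<noteq> k'"
      then obtain j j' where "j \<in> D" "j' \<in> D" "k = l j" "k' = l j'" "j \<noteq> j'" by (auto simp: A_def)
      with disj[of j j'] subl show "interior k \<inter> interior k' = {}" by blast
    qed (use finAB in auto)
    show "r ` B division_of \<Union>(r ` B)"
    proof (rule division_ofI_Icc)
      fix k assume "k \<in> r ` B"
      then obtain k' where "k' \<in> B" "k = r k'" by auto
      with r(1,2)[of k'] show "\<exists>l u. k = {l..u} \<and> l \<le> u" using less_imp_le by blast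
    next
      fix k k' assume "k \<in> r ` B" "k' \<in> r ` B" "k \<noteq> k'"
      then obtain j j' where "j \<in> D" "j' \<in> D" "k = r j" "k' = r j'" "j \<noteq> j'" by (auto simp: B_def)
      with disj[of j j'] subr show "interior k \<inter> interior k' = {}" by blast
    qed (use finAB in auto)
    show "\<Union>(l ` A) \<subseteq> \<Union>D \<inter> {..y}" "\<Union>(r ` B) \<subseteq> \<Union>D \<inter> {y..}"
      by (auto simp: A_def B_def l_def r_def)
    have "total_increment f (l ` A) = (\<Sum>k\<in>A. f (min (Sup k) y) - f (Inf k))"
      unfolding total_increment_def by (subst sum.reindex[OF injl]) (auto simp: l(4,5) intro!: sum.cong)
    also have "\<dots> = (\<Sum>k\<in>D. if Inf k < y \<and> Inf k < Sup k then f (min (Sup k) y) - f (Inf k) else 0)"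
      unfolding A_def by (rule sum.inter_filter[OF fin])
    finally have 1: "total_increment f (l ` A) = \<dots>" .
    have "total_increment f (r ` B) = (\<Sum>k\<in>B. f (Sup k) - f (max (Inf k) y))"
      unfolding total_increment_def by (subst sum.reindex[OF injr]) (auto simp: r(4,5) intro!: sum.cong)
    also have "\<dots> = (\<Sum>k\<in>D. if y < Sup k \<and> Inf k < Sup k then f (Sup k) - f (max (Inf k) y) else 0)"
      unfolding B_def by (rule sum.inter_filter[OF fin])
    finally have 2: "total_increment f (r ` B) = \<dots>" .
    show "total_increment f D = total_increment f (l ` A) + total_increment f (r ` B)"
      unfolding 1 2 sum.distrib[symmetric] unfolding total_increment_def
    proof (rule sum.cong[OF refl])
      fix k assume "k \<in> D"
      then obtain a b where "k = {a..b}" "a \<le> b" "Inf k = a" "Sup k = b"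
        using division_of_Icc[OF D] by metis
      then show "f (Sup k) - f (Inf k) = (if Inf k < y \<and> Inf k < Sup k then f (min (Sup k) y) - f (Inf k) else 0)
           + (if y < Sup k \<and> Inf k < Sup k then f (Sup k) - f (max (Inf k) y) else 0)"
        by (cases "a = b") (auto simp: min_def max_def)
    qed
  qed
qed

lemma division_of_union:
  assumes D1: "D1 division_of \<Union>D1" and D2: "D2 division_of \<Union>D2"
    and disj: "\<And>k k'. \<lbrakk>k \<in> D1; k' \<in> D2\<rbrakk> \<Longrightarrow> interior k \<inter> interior k' = {}"
  shows "(D1 \<union> D2) division_of \<Union>(D1 \<union> D2)"
proof (rule division_ofI)
  show "finite (D1 \<union> D2)" using D1 D2 by (auto dest: division_of_finite)
  fix k assume "k \<in> D1 \<union> D2"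
  then show "k \<noteq> {}" "\<exists>a b. k = cbox a b" using D1 D2 by (metis UnE division_ofD(3,4))+
  fix k' assume "k' \<in> D1 \<union> D2" "k \<noteq> k'"
  with \<open>k \<in> D1 \<union> D2\<close> consider "k \<in> D1" "k' \<in> D1" | "k \<in> D1" "k' \<in> D2"
    | "k \<in> D2" "k' \<in> D1" | "k \<in> D2" "k' \<in> D2" by auto
  then show "interior k \<inter> interior k' = {}"
  proof cases
    case 1 then show ?thesis using division_ofD(5)[OF D1] \<open>k \<noteq> k'\<close> by simp
  next
    case 2 then show ?thesis by (rule disj)
  next
    case 3 then show ?thesis using disj[of k' k] by (simp add: Int_commute)
  next
    case 4 then show ?thesis using division_ofD(5)[OF D2] \<open>k \<noteq> k'\<close> by simp
  qed
qed auto

text \<open>One-point intervals carry no increment. Without them, families inside non-overlapping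
  intervals cannot share a member, which \<open>pos_variation_AC\<close> needs in order to sum over
  their union.\<close>

lemma total_increment_degenerate:
  assumes "D division_of \<Union>D"
  obtains D' where "D' division_of \<Union>D'" "\<Union>D' \<subseteq> \<Union>D" "\<And>k. k \<in> D' \<Longrightarrow> interior k \<noteq> {}"
    "\<And>f. total_increment f D' = total_increment f D"
proof
  let ?D = "{k \<in> D. interior k \<noteq> {}}"
  show "?D division_of \<Union>?D" by (rule division_of_subset[OF assms]) auto
  fix f
  have "total_increment f ?D = (\<Sum>k\<in>D. if interior k \<noteq> {} then f (Sup k) - f (Inf k) else 0)"
    unfolding total_increment_def by (rule sum.inter_filter) (rule division_of_finite[OF assms])
  also have "\<dots> = total_increment f D"
    unfolding total_increment_def
  proof (rule sum.cong[OF refl])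
    fix k assume "k \<in> D"
    then obtain a b where "k = {a..b}" "a \<le> b" "Inf k = a" "Sup k = b"
      using division_of_Icc[OF assms] by metis
    then show "(if interior k \<noteq> {} then f (Sup k) - f (Inf k) else 0) = f (Sup k) - f (Inf k)"
      by (cases "a = b") auto
  qed
  finally show "total_increment f ?D = total_increment f D" .
qed auto

lemma interior_disjoint_if_separated:
  assumes "k \<subseteq> {..y::real}" "k' \<subseteq> {y..}" shows "interior k \<inter> interior k' = {}"
proof -
  have "interior k \<subseteq> {..<y}" "interior k' \<subseteq> {y<..}"
    using interior_mono[OF assms(1)] interior_mono[OF assms(2)] by simp_all
  then show ?thesis by force
qed

lemma sum_length_division:
  fixes x y :: real
  assumes "D division_of S" "S \<subseteq> {x..y}" "x \<le> y"
  shows "(\<Sum>k\<in>D. Sup k - Inf k) \<le> y - x"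
proof -
  have "(\<Sum>k\<in>D. Sup k - Inf k) = sum (measure lborel) D"
  proof (rule sum.cong[OF refl])
    fix k assume "k \<in> D"
    then obtain a b where "k = {a..b}" "a \<le> b" "Inf k = a" "Sup k = b"
      using division_of_Icc[OF assms(1)] by metis
    then show "Sup k - Inf k = measure lborel k" by simp
  qed
  also have "\<dots> \<le> measure lborel (cbox x y)"
    using assms by (intro subadditive_content_division) auto
  finally show ?thesis using assms(3) by simp
qed

section \<open>The positive variation of an absolutely continuous function\<close>

definition increments :: "(real \<Rightarrow> real) \<Rightarrow> real \<Rightarrow> real \<Rightarrow> real set"
  where "increments f x y = {total_increment f D |D. D division_of \<Union>D \<and> \<Union>D \<subseteq> {x..y}}"

text \<open>A division in \<open>increments\<close> need not fill \<open>{x..y}\<close>, so the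
  supremum may select just the intervals on which \<open>f\<close> grows. This yields the positive
  variation without taking positive parts.\<close>

definition pos_variation :: "(real \<Rightarrow> real) \<Rightarrow> real \<Rightarrow> real \<Rightarrow> real"
  where "pos_variation f x y = Sup (increments f x y)"

lemma increments_nonempty: "0 \<in> increments f x y"
proof -
  have "{} division_of \<Union>{}" by auto
  moreover have "total_increment f {} = 0" by (simp add: total_increment_def)
  ultimately show ?thesis unfolding increments_def by force
qed

lemma AC_total_increment_less:
  assumes "abs_continuous_between f c d" "\<epsilon> > 0"
  obtains \<delta> where "\<delta> > 0" "\<And>D. \<lbrakk>D division_of \<Union>D; \<Union>D \<subseteq> {c..d}; (\<Sum>k\<in>D. Sup k - Inf k) < \<delta>\<rbrakk>
     \<Longrightarrow> total_increment f D < \<epsilon>"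
proof -
  obtain \<delta> where \<delta>: "\<delta> > 0" "\<And>D. \<lbrakk>D division_of \<Union>D; \<Union>D \<subseteq> {c..d}; (\<Sum>k\<in>D. Sup k - Inf k) < \<delta>\<rbrakk>
     \<Longrightarrow> (\<Sum>k\<in>D. norm (f (Sup k) - f (Inf k))) < \<epsilon>"
    using assms unfolding abs_continuous_between_def by meson
  show thesis
  proof (rule that[OF \<delta>(1)])
    fix D assume "D division_of \<Union>D" "\<Union>D \<subseteq> {c..d}" "(\<Sum>k\<in>D. Sup k - Inf k) < \<delta>"
    then have "(\<Sum>k\<in>D. norm (f (Sup k) - f (Inf k))) < \<epsilon>" by (rule \<delta>(2))
    moreover have "total_increment f D \<le> (\<Sum>k\<in>D. norm (f (Sup k) - f (Inf k)))"
      unfolding total_increment_def by (intro sum_mono) simp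
    ultimately show "total_increment f D < \<epsilon>" by linarith
  qed
qed

text \<open>Absolute continuity with epsilon 1 bounds the increments over a stretch shorter than
  \<open>\<delta>\<close> by 1, and the interval consists of finitely many such stretches.\<close>

lemma increments_bdd_above:
  assumes "abs_continuous_between f c d" "c \<le> d"
  shows "bdd_above (increments f c d)"
proof -
  obtain \<delta> where \<delta>: "\<delta> > 0" "\<And>D. \<lbrakk>D division_of \<Union>D; \<Union>D \<subseteq> {c..d}; (\<Sum>k\<in>D. Sup k - Inf k) < \<delta>\<rbrakk>
     \<Longrightarrow> total_increment f D < 1"
    using AC_total_increment_less[OF assms(1) zero_less_one] by blast
  \<comment> \<open>Cut points at spacing \<open>\<delta>/2\<close>, clamped at \<open>d\<close>;
    half of \<open>\<delta>\<close> because lengths must be strictly below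
    \<open>\<delta>\<close>.\<close>
  define z where "z n = min d (c + real n * (\<delta>/2))" for n
  have "t \<le> real n" if "t \<in> increments f c (z n)" for n t
    using that
  proof (induction n arbitrary: t)
    case 0
    then obtain D where D: "D division_of \<Union>D" "\<Union>D \<subseteq> {c..c}" "t = total_increment f D"
      using assms(2) by (auto simp: increments_def z_def)
    have "f (Sup k) - f (Inf k) = 0" if kD: "k \<in> D" for k
    proof -
      obtain l u where "k = {l..u}" "l \<le> u" "Inf k = l" "Sup k = u"
        by (rule division_of_Icc[OF D(1) kD])
      moreover have "k \<subseteq> {c..c}" using D(2) kD by blast
      ultimately have "l \<in> {c..c}" "u \<in> {c..c}" by (metis atLeastAtMost_iff order_refl subsetD)+
      then show ?thesis using \<open>Inf k = l\<close> \<open>Sup k = u\<close> by simp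
    qed
    then show ?case by (simp add: D(3) total_increment_def)
  next
    case (Suc n)
    then obtain D where D: "D division_of \<Union>D" "\<Union>D \<subseteq> {c..z (Suc n)}" "t = total_increment f D"
      by (auto simp: increments_def)
    obtain D1 D2 where D12: "D1 division_of \<Union>D1" "D2 division_of \<Union>D2"
      "\<Union>D1 \<subseteq> \<Union>D \<inter> {..z n}" "\<Union>D2 \<subseteq> \<Union>D \<inter> {z n..}"
      "total_increment f D = total_increment f D1 + total_increment f D2"
      using total_increment_split[OF D(1)] by metis
    have z: "z n \<le> z (Suc n)" "z (Suc n) - z n < \<delta>" "c \<le> z n" "z (Suc n) \<le> d"
      using \<delta>(1) assms(2) by (auto simp: z_def min_def field_simps)
    have "{c..z (Suc n)} \<inter> {..z n} \<subseteq> {c..z n}"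
      "{c..z (Suc n)} \<inter> {z n..} \<subseteq> {z n..z (Suc n)}" by auto
    then have D1: "\<Union>D1 \<subseteq> {c..z n}" and D2: "\<Union>D2 \<subseteq> {z n..z (Suc n)}"
      using D12(3,4) D(2) by blast+
    then have "total_increment f D1 \<in> increments f c (z n)"
      using D12(1) D1 by (auto simp: increments_def)
    then have "total_increment f D1 \<le> real n" by (rule Suc.IH)
    moreover have "(\<Sum>k\<in>D2. Sup k - Inf k) < \<delta>"
      using sum_length_division[OF D12(2) D2] z by linarith
    then have "total_increment f D2 < 1"
      using D12(2) order_trans[OF D2, of "{c..d}"] z by (intro \<delta>(2)) auto
    ultimately show ?case using D12(5) D(3) by simp
  qed
  moreover obtain n where "(d - c) / (\<delta>/2) < real n" using reals_Archimedean2 by blast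
  then have "z n = d" using \<delta>(1) by (auto simp: z_def min_def field_simps)
  ultimately show ?thesis unfolding bdd_above_def by metis
qed

lemma abs_continuous_between_subset:
  "abs_continuous_between f c d \<Longrightarrow> c \<le> c' \<Longrightarrow> d' \<le> d \<Longrightarrow> abs_continuous_between f c' d'"
  unfolding abs_continuous_between_def
  by (meson atLeastatMost_subset_iff dual_order.trans)

context
  fixes f :: "real \<Rightarrow> real" and c d :: real
  assumes AC: "abs_continuous_between f c d"
begin

lemma pos_variation_upper:
  assumes "c \<le> x" "x \<le> y" "y \<le> d" "D division_of \<Union>D" "\<Union>D \<subseteq> {x..y}"
  shows "total_increment f D \<le> pos_variation f x y"
  unfolding pos_variation_def
proof (rule cSup_upper)
  show "bdd_above (increments f x y)"
    by (rule increments_bdd_above[OF abs_continuous_between_subset[OF AC]]) (use assms in auto)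
qed (use assms in \<open>auto simp: increments_def\<close>)

lemma pos_variation_least:
  assumes "\<And>D. D division_of \<Union>D \<Longrightarrow> \<Union>D \<subseteq> {x..y} \<Longrightarrow> total_increment f D \<le> B"
  shows "pos_variation f x y \<le> B"
  unfolding pos_variation_def
proof (rule cSup_least)
  show "increments f x y \<noteq> {}" using increments_nonempty by blast
qed (use assms in \<open>auto simp: increments_def\<close>)

lemma pos_variation_mono:
  assumes "c \<le> x" "x \<le> y" "y \<le> d"
  shows "pos_variation f c x \<le> pos_variation f c y"
proof (rule pos_variation_least)
  fix D assume "D division_of \<Union>D" "\<Union>D \<subseteq> {c..x}"
  then show "total_increment f D \<le> pos_variation f c y"
    using assms by (intro pos_variation_upper) auto
qed

text \<open>Appending \<open>{x..y}\<close> to a division of \<open>{c..x}\<close> adds exactly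
  \<open>f y - f x\<close>. Thus the positive variation minus \<open>f\<close> is nondecreasing, the
  second half of the Jordan decomposition.\<close>

lemma pos_variation_increase:
  assumes "c \<le> x" "x \<le> y" "y \<le> d"
  shows "f y - f x \<le> pos_variation f c y - pos_variation f c x"
proof (cases "x = y")
  case False
  then have "x < y" using assms by simp
  have "pos_variation f c x \<le> pos_variation f c y - (f y - f x)"
  proof (rule pos_variation_least)
    fix D assume D: "D division_of \<Union>D" "\<Union>D \<subseteq> {c..x}"
    have 1: "{{x..y}} division_of \<Union>{{x..y}}"
      using assms by (intro division_ofI_Icc) auto
    \<comment> \<open>The appended interval must be new; otherwise the set would not grow and the
      increment would not be counted.\<close>
    have new: "{x..y} \<notin> D"
    proof
      assume "{x..y} \<in> D"
      moreover have "y \<in> {x..y}" using \<open>x < y\<close> by simp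
      ultimately have "y \<in> {c..x}" using D(2) by blast
      then show False using \<open>x < y\<close> by simp
    qed
    have "(D \<union> {{x..y}}) division_of \<Union>(D \<union> {{x..y}})"
    proof (rule division_of_union[OF D(1) 1])
      fix k k' assume "k \<in> D" "k' \<in> {{x..y}}"
      then show "interior k \<inter> interior k' = {}"
        using D(2) by (intro interior_disjoint_if_separated[of _ x]) auto
    qed
    moreover have "\<Union>(D \<union> {{x..y}}) \<subseteq> {c..y}"
    proof -
      have "{c..x} \<subseteq> {c..y}" "{x..y} \<subseteq> {c..y}" using assms by auto
      then show ?thesis using D(2) by blast
    qed
    moreover have "c \<le> y" using assms by simp
    ultimately have "total_increment f (D \<union> {{x..y}}) \<le> pos_variation f c y"
      using assms(3) by (intro pos_variation_upper) simp_all
    moreover have "total_increment f (D \<union> {{x..y}}) = total_increment f D + (f y - f x)"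
      using new division_of_finite[OF D(1)] assms by (simp add: total_increment_def)
    ultimately show "total_increment f D \<le> pos_variation f c y - (f y - f x)" by simp
  qed
  then show ?thesis by simp
qed simp

lemma pos_variation_subadditive:
  assumes "c \<le> x" "x \<le> y" "y \<le> d"
  shows "pos_variation f c y \<le> pos_variation f c x + pos_variation f x y"
proof (rule pos_variation_least)
  fix D assume D: "D division_of \<Union>D" "\<Union>D \<subseteq> {c..y}"
  obtain D1 D2 where D12: "D1 division_of \<Union>D1" "D2 division_of \<Union>D2"
    "\<Union>D1 \<subseteq> \<Union>D \<inter> {..x}" "\<Union>D2 \<subseteq> \<Union>D \<inter> {x..}"
    "total_increment f D = total_increment f D1 + total_increment f D2"
    using total_increment_split[OF D(1)] by metis
  have "{c..y} \<inter> {..x} \<subseteq> {c..x}" "{c..y} \<inter> {x..} \<subseteq> {x..y}" by auto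
  then have "\<Union>D1 \<subseteq> {c..x}" "\<Union>D2 \<subseteq> {x..y}" using D12(3,4) D(2) by blast+
  then have "total_increment f D1 \<le> pos_variation f c x" "total_increment f D2 \<le> pos_variation f x y"
    using D12(1,2) assms by (auto intro!: pos_variation_upper)
  then show "total_increment f D \<le> pos_variation f c x + pos_variation f x y"
    using D12(5) by simp
qed

text \<open>Inside each interval of a short family a nearly optimal division is chosen; together
  these form one family of no larger total length, to which the absolute continuity of
  \<open>f\<close> applies.\<close>

lemma pos_variation_AC: "abs_continuous_between (pos_variation f c) c d"
  unfolding abs_continuous_between_def
proof (intro allI impI)
  fix \<epsilon> :: real assume "\<epsilon> > 0"
  then obtain \<delta> where \<delta>: "\<delta> > 0" "\<And>D. \<lbrakk>D division_of \<Union>D; \<Union>D \<subseteq> {c..d}; (\<Sum>k\<in>D. Sup k - Inf k) < \<delta>\<rbrakk>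
     \<Longrightarrow> total_increment f D < \<epsilon>/2"
    using AC_total_increment_less[OF AC half_gt_zero] by blast
  have "(\<Sum>k\<in>E. norm (pos_variation f c (Sup k) - pos_variation f c (Inf k))) < \<epsilon>"
    if E: "E division_of \<Union>E" "\<Union>E \<subseteq> {c..d}" "(\<Sum>k\<in>E. Sup k - Inf k) < \<delta>" for E
  proof -
    have fin: "finite E" using E(1) by (rule division_of_finite)
    \<comment> \<open>The loss per interval: over all of \<open>E\<close> it adds up to at most
      \<open>\<epsilon>/2\<close>, and the added 1 covers an empty \<open>E\<close>.\<close>
    define \<eta> where "\<eta> = \<epsilon> / (2 * (card E + 1))"
    have \<eta>: "\<eta> > 0" using \<open>\<epsilon> > 0\<close> by (simp add: \<eta>_def)
    have "\<exists>D. D division_of \<Union>D \<and> \<Union>D \<subseteq> k \<and> (\<forall>j\<in>D. interior j \<noteq> {}) \<and>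
      norm (pos_variation f c (Sup k) - pos_variation f c (Inf k)) < total_increment f D + \<eta>" if kE: "k \<in> E" for k
    proof -
      obtain l u where k: "k = {l..u}" "l \<le> u" "Inf k = l" "Sup k = u"
        by (rule division_of_Icc[OF E(1) kE])
      moreover have "k \<subseteq> {c..d}" using E(2) kE by blast
      ultimately have lu: "c \<le> l" "u \<le> d" by auto
      have "pos_variation f l u - \<eta> < Sup (increments f l u)" using \<eta> by (simp add: pos_variation_def)
      then obtain t where "t \<in> increments f l u" "pos_variation f l u - \<eta> < t"
        using less_cSupD[of "increments f l u"] increments_nonempty by (metis emptyE)
      then obtain D where D: "D division_of \<Union>D" "\<Union>D \<subseteq> {l..u}" "pos_variation f l u - \<eta> < total_increment f D"
        by (auto simp: increments_def)
      obtain D' where D': "D' division_of \<Union>D'" "\<Union>D' \<subseteq> \<Union>D" "\<And>k. k \<in> D' \<Longrightarrow> interior k \<noteq> {}"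
        "\<And>f. total_increment f D' = total_increment f D"
        using total_increment_degenerate[OF D(1)] by blast
      have "pos_variation f c u - pos_variation f c l < total_increment f D' + \<eta>"
        using pos_variation_subadditive[OF lu(1) k(2) lu(2)] D(3) D'(4)[of f] by simp
      moreover have "pos_variation f c l \<le> pos_variation f c u"
        using pos_variation_mono lu k by simp
      ultimately show ?thesis using D' D(2) k by (intro exI[of _ D']) auto
    qed
    then obtain F where F: "\<And>k. k \<in> E \<Longrightarrow> F k division_of \<Union>(F k)" "\<And>k. k \<in> E \<Longrightarrow> \<Union>(F k) \<subseteq> k"
      "\<And>k j. k \<in> E \<Longrightarrow> j \<in> F k \<Longrightarrow> interior j \<noteq> {}"
      "\<And>k. k \<in> E \<Longrightarrow> norm (pos_variation f c (Sup k) - pos_variation f c (Inf k)) < total_increment f (F k) + \<eta>"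
      by metis
    have disjE: "interior j \<inter> interior j' = {}" if "k \<in> E" "k' \<in> E" "k \<noteq> k'" "j \<in> F k" "j' \<in> F k'" for j j' k k'
    proof -
      have "interior j \<subseteq> interior k" "interior j' \<subseteq> interior k'"
        using that F(2) by (auto intro!: interior_mono)
      moreover have "interior k \<inter> interior k' = {}" using division_ofD(5)[OF E(1)] that by blast
      ultimately show ?thesis by blast
    qed
    \<comment> \<open>A common member would have empty interior, which was excluded. So the sum over
      the union is the sum of the sums.\<close>
    have disjF: "F k \<inter> F k' = {}" if "k \<in> E" "k' \<in> E" "k \<noteq> k'" for k k'
      using disjE[OF that] F(3)[OF that(1)] by blast
    let ?D = "\<Union>(F ` E)"
    have finF: "finite (F k)" if "k \<in> E" for k using F(1)[OF that] by (rule division_of_finite)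
    have sumD: "sum g ?D = (\<Sum>k\<in>E. sum g (F k))" for g :: "real set \<Rightarrow> real"
      by (rule sum.UNION_disjoint) (use fin finF disjF in auto)
    have D: "?D division_of \<Union>?D"
    proof (rule division_of_Union)
      fix k1 k2 assume "k1 \<in> \<Union>(F ` E)" "k2 \<in> \<Union>(F ` E)" "k1 \<noteq> k2"
      then obtain k k' where kk: "k \<in> E" "k' \<in> E" "k1 \<in> F k" "k2 \<in> F k'" by blast
      show "interior k1 \<inter> interior k2 = {}"
      proof (cases "k = k'")
        case True
        then show ?thesis using division_ofD(5)[OF F(1)[OF kk(1)]] kk \<open>k1 \<noteq> k2\<close> by blast
      next
        case False
        then show ?thesis using disjE kk by blast
      qed
    qed (use fin F(1) in auto)
    have "(\<Sum>j\<in>F k. Sup j - Inf j) \<le> Sup k - Inf k" if kE: "k \<in> E" for k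
    proof -
      obtain l u where k: "k = {l..u}" "l \<le> u" "Inf k = l" "Sup k = u"
        by (rule division_of_Icc[OF E(1) kE])
      then show ?thesis using sum_length_division[OF F(1)[OF kE], of l u] F(2)[OF kE] by simp
    qed
    then have "(\<Sum>j\<in>?D. Sup j - Inf j) \<le> (\<Sum>k\<in>E. Sup k - Inf k)"
      unfolding sumD by (rule sum_mono)
    then have "(\<Sum>j\<in>?D. Sup j - Inf j) < \<delta>" using E(3) by linarith
    moreover have "\<Union>?D \<subseteq> {c..d}" using F(2) E(2) by blast
    ultimately have "total_increment f ?D < \<epsilon>/2" using D by (intro \<delta>(2))
    then have "(\<Sum>k\<in>E. total_increment f (F k)) < \<epsilon>/2"
      unfolding total_increment_def sumD .
    moreover have "(\<Sum>k\<in>E. norm (pos_variation f c (Sup k) - pos_variation f c (Inf k)))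
        \<le> (\<Sum>k\<in>E. total_increment f (F k) + \<eta>)"
      by (rule sum_mono) (use F(4) less_imp_le in blast)
    moreover have "real (card E) * \<eta> \<le> \<epsilon>/2"
      using \<open>\<epsilon> > 0\<close> by (simp add: \<eta>_def field_simps)
    ultimately show ?thesis by (simp add: sum.distrib)
  qed
  with \<delta>(1) show "\<exists>\<delta>>0. \<forall>D. D division_of \<Union>D \<and> \<Union>D \<subseteq> {c..d} \<and> (\<Sum>k\<in>D. Sup k - Inf k) < \<delta> \<longrightarrow>
      (\<Sum>k\<in>D. norm (pos_variation f c (Sup k) - pos_variation f c (Inf k))) < \<epsilon>" by blast
qed

end

lemma AC_imp_continuous_on:
  assumes "abs_continuous_between f c d"
  shows "continuous_on {c..d} f"
proof (rule continuous_onI)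
  fix x \<epsilon> :: real assume x: "x \<in> {c..d}" and "\<epsilon> > 0"
  then obtain \<delta> where \<delta>: "\<delta> > 0" "\<And>D. \<lbrakk>D division_of \<Union>D; \<Union>D \<subseteq> {c..d}; (\<Sum>k\<in>D. Sup k - Inf k) < \<delta>\<rbrakk>
     \<Longrightarrow> (\<Sum>k\<in>D. norm (f (Sup k) - f (Inf k))) < \<epsilon>"
    using assms unfolding abs_continuous_between_def by meson
  have "dist (f y) (f x) < \<epsilon>" if y: "y \<in> {c..d}" "dist y x < \<delta>" for y
  proof -
    let ?D = "{{min x y..max x y}}"
    have "min x y \<le> max x y" by simp
    then have 1: "?D division_of \<Union>?D" by (intro division_ofI_Icc) blast+
    have "norm (f (max x y) - f (min x y)) < \<epsilon>"
      using \<delta>(2)[OF 1] x y by (auto simp: dist_real_def)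
    then show ?thesis
      by (cases "x \<le> y") (simp_all add: dist_norm norm_minus_commute min_def max_def)
  qed
  then show "\<exists>\<delta>>0. \<forall>y\<in>{c..d}. dist y x < \<delta> \<longrightarrow> dist (f y) (f x) \<le> \<epsilon>"
    using \<delta>(1) less_imp_le by blast
qed

section \<open>Indefinite integrals and the density of a monotone function\<close>

text \<open>The clamped function is constant outside \<open>{c..d}\<close>, so after cutting at
  \<open>c\<close> and at \<open>d\<close> only the middle part contributes.\<close>

lemma total_increment_Int_Icc:
  assumes D: "D division_of \<Union>D" and "c \<le> d"
  obtains E where "E division_of \<Union>E" "\<Union>E \<subseteq> \<Union>D \<inter> {c..d}"
    "total_increment (\<lambda>x. F (max c (min d x))) D = total_increment F E"
proof -
  let ?G = "\<lambda>x. F (max c (min d x))"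
  have const: "total_increment ?G E = 0" if E: "E division_of \<Union>E" "\<Union>E \<subseteq> {..c} \<or> \<Union>E \<subseteq> {d..}" for E
    unfolding total_increment_def
  proof (intro sum.neutral ballI)
    fix k assume k: "k \<in> E"
    obtain l u where lu: "k = {l..u}" "l \<le> u" "Inf k = l" "Sup k = u"
      by (rule division_of_Icc[OF E(1) k])
    have "k \<subseteq> {..c} \<or> k \<subseteq> {d..}" using E(2) k by blast
    moreover have "l \<in> k" "u \<in> k" using lu by auto
    ultimately have "u \<le> c \<or> d \<le> l" by auto
    then show "?G (Sup k) - ?G (Inf k) = 0" using lu \<open>c \<le> d\<close> by auto
  qed
  obtain D1 D2 where D12: "D1 division_of \<Union>D1" "D2 division_of \<Union>D2"
    "\<Union>D1 \<subseteq> \<Union>D \<inter> {..c}" "\<Union>D2 \<subseteq> \<Union>D \<inter> {c..}"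
    "total_increment ?G D = total_increment ?G D1 + total_increment ?G D2"
    using total_increment_split[OF D] by metis
  obtain D3 D4 where D34: "D3 division_of \<Union>D3" "D4 division_of \<Union>D4"
    "\<Union>D3 \<subseteq> \<Union>D2 \<inter> {..d}" "\<Union>D4 \<subseteq> \<Union>D2 \<inter> {d..}"
    "total_increment ?G D2 = total_increment ?G D3 + total_increment ?G D4"
    using total_increment_split[OF D12(2)] by metis
  have 3: "\<Union>D3 \<subseteq> \<Union>D \<inter> {c..d}"
  proof -
    have "{c..} \<inter> {..d} = {c..d}" by auto
    then show ?thesis using D12(4) D34(3) by blast
  qed
  have "total_increment ?G D3 = total_increment F D3"
    unfolding total_increment_def
  proof (rule sum.cong[OF refl])
    fix k assume k: "k \<in> D3"
    obtain l u where lu: "k = {l..u}" "l \<le> u" "Inf k = l" "Sup k = u"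
      by (rule division_of_Icc[OF D34(1) k])
    then have "l \<in> k" "u \<in> k" by auto
    then have "l \<in> {c..d}" "u \<in> {c..d}" using 3 k by blast+
    then show "?G (Sup k) - ?G (Inf k) = F (Sup k) - F (Inf k)" using lu by simp
  qed
  moreover have "total_increment ?G D1 = 0" "total_increment ?G D4 = 0"
    using const[OF D12(1)] const[OF D34(2)] D12(3) D34(4) by blast+
  ultimately show thesis using that[OF D34(1) 3] D12(5) D34(5) by simp
qed

text \<open>The derivative \<open>\<phi>\<close> is carried explicitly, as any one representative;
  it is fixed only up to a null set. The condition is local, so nothing is asked of
  \<open>\<phi>\<close> near the ends of a non-compact \<open>I\<close>.\<close>

definition has_AC_deriv_on ::
    "(real \<Rightarrow> 'a::euclidean_space) \<Rightarrow> (real \<Rightarrow> 'a) \<Rightarrow> real set \<Rightarrow> bool"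
  where "has_AC_deriv_on f \<phi> I \<longleftrightarrow> (\<forall>x y. x \<le> y \<and> {x..y} \<subseteq> I \<longrightarrow>
    \<phi> absolutely_integrable_on {x..y} \<and> f y - f x = integral {x..y} \<phi>)"

text \<open>The Lebesgue-Stieltjes measure of \<open>F\<close> vanishes on Lebesgue null sets by
  absolute continuity, and its Radon-Nikodym density is the derivative.\<close>

lemma mono_AC_has_deriv:
  fixes F :: "real \<Rightarrow> real"
  assumes AC: "abs_continuous_between F c d" and "c \<le> d" and mono: "mono_on {c..d} F"
  obtains \<phi> where "has_AC_deriv_on F \<phi> {c..d}"
proof -
  \<comment> \<open>Constant continuation makes the function monotone and continuous on the whole
    line, as \<open>interval_measure\<close> requires, without adding mass outside
    \<open>{c..d}\<close>.\<close>
  define G where "G = (\<lambda>x. F (max c (min d x)))"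
  have G_eq: "G x = F x" if "x \<in> {c..d}" for x using that by (simp add: G_def)
  have mono_G: "G x \<le> G y" if "x \<le> y" for x y
    unfolding G_def by (rule mono_onD[OF mono]) (use that \<open>c \<le> d\<close> in auto)
  have cont_G: "continuous_on UNIV G"
    unfolding G_def
    by (rule continuous_on_compose2[OF AC_imp_continuous_on[OF AC]])
      (use \<open>c \<le> d\<close> in \<open>auto intro!: continuous_intros\<close>)
  then have rc: "continuous (at_right x) G" for x
    by (simp add: continuous_on_eq_continuous_at continuous_at_imp_continuous_at_within)
  define M where "M = interval_measure G"
  have sets_M: "sets M = sets borel" by (simp add: M_def)
  have Icc: "emeasure M {x..y} = ennreal (G y - G x)" if "x \<le> y" for x y
    unfolding M_def using that mono_G cont_G by (rule emeasure_interval_measure_Icc)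
  have "absolutely_continuous lborel M"
    unfolding absolutely_continuous_def
  proof
    fix N assume N: "N \<in> null_sets (lborel :: real measure)"
    have "emeasure M N \<le> 0 + ennreal \<epsilon>" if "\<epsilon> > 0" for \<epsilon>
    proof -
      obtain \<delta> where \<delta>: "\<delta> > 0" "\<And>D. \<lbrakk>D division_of \<Union>D; \<Union>D \<subseteq> {c..d}; (\<Sum>k\<in>D. Sup k - Inf k) < \<delta>\<rbrakk>
         \<Longrightarrow> total_increment F D < \<epsilon>"
        using AC_total_increment_less[OF AC \<open>\<epsilon> > 0\<close>] by blast
      \<comment> \<open>\<open>N\<close> is covered by an open set of measure below the
        \<open>\<delta>\<close> of absolute continuity; the Stieltjes measure of that set is then
        controlled by increments of \<open>F\<close>.\<close>
      obtain U where U: "open U" "N \<subseteq> U" "emeasure lborel (U - N) < \<delta>"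
        using outer_regular_lborel[OF _ \<delta>(1), of N] null_setsD2[OF N] by (metis sets_lborel)
      have "emeasure lborel (U - N) = emeasure lborel U"
        by (rule emeasure_Diff_null_set) (use N U in auto)
      with U(3) have lessU: "emeasure lborel U < \<delta>" by simp
      \<comment> \<open>The boxes of the countable cover may overlap. Their finite unions
        \<open>A n\<close> are divided anew into non-overlapping intervals, and continuity from
        below carries the bound over to \<open>U\<close>.\<close>
      obtain \<D> where \<D>: "countable \<D>" "\<D> \<subseteq> Pow U" "\<And>X. X \<in> \<D> \<Longrightarrow> \<exists>a b. X = cbox a b" "\<Union>\<D> = U"
        using open_countable_Union_open_cbox[OF U(1)] by metis
      define A where "A = (\<lambda>n::nat. \<Union>(to_nat_on \<D> -` {..n} \<inter> \<D>))"
      have finA: "finite (to_nat_on \<D> -` {..n} \<inter> \<D>)" for n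
        by (rule finite_vimage_IntI) (use \<D>(1) in auto)
      have U_A: "U = (\<Union>n. A n)" using \<D>(4) by (auto simp: A_def)
      have inc: "incseq A"
        unfolding A_def incseq_def by (intro allI impI Union_mono Int_mono vimage_mono) auto
      have A: "emeasure M (A n) \<le> \<epsilon>" "A n \<in> sets M" for n
      proof -
        obtain D where "D division_of A n"
          unfolding A_def using elementary_unions_intervals[OF finA] \<D>(3) by blast
        moreover from this have An: "\<Union>D = A n" by (rule division_ofD(6))
        ultimately have D: "D division_of \<Union>D" by simp
        have fin: "finite D" using D by (rule division_of_finite)
        obtain E where E: "E division_of \<Union>E" "\<Union>E \<subseteq> \<Union>D \<inter> {c..d}"
            "total_increment G D = total_increment F E"
          unfolding G_def using total_increment_Int_Icc[OF D \<open>c \<le> d\<close>] by metis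
        have D_sets: "k \<in> sets borel" if "k \<in> D" for k
          using division_ofD(4)[OF D that] by auto
        show "A n \<in> sets M" unfolding An[symmetric] sets_M using fin D_sets by blast
        have "(\<Sum>k\<in>E. Sup k - Inf k) = (\<Sum>k\<in>E. measure lebesgue k)"
        proof (rule sum.cong[OF refl])
          fix k assume k: "k \<in> E"
          obtain l u where "k = {l..u}" "l \<le> u" "Inf k = l" "Sup k = u"
            by (rule division_of_Icc[OF E(1) k])
          then show "Sup k - Inf k = measure lebesgue k" by simp
        qed
        also have "\<dots> = measure lebesgue (\<Union>E)" using E(1) by (rule content_division)
        finally have len: "(\<Sum>k\<in>E. Sup k - Inf k) = measure lebesgue (\<Union>E)" .
        have "\<Union>E \<in> lmeasurable" using E(1) by (rule lmeasurable_division)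
        then have "ennreal (measure lebesgue (\<Union>E)) = emeasure lebesgue (\<Union>E)"
          by (simp add: emeasure_eq_measure2)
        also have "\<dots> \<le> emeasure lebesgue U"
        proof (rule emeasure_mono)
          show "\<Union>E \<subseteq> U" using E(2) An U_A by blast
        qed (use U(1) in \<open>simp add: borel_open\<close>)
        also have "\<dots> < \<delta>" using lessU U(1) by (simp add: borel_open)
        finally have "measure lebesgue (\<Union>E) < \<delta>" by (simp add: ennreal_less_iff)
        then have "total_increment F E < \<epsilon>" using E len by (intro \<delta>(2)) auto
        then have "total_increment G D < \<epsilon>" using E(3) by simp
        have "emeasure M (A n) \<le> (\<Sum>k\<in>D. emeasure M k)"
          unfolding An[symmetric] using emeasure_subadditive_finite[OF fin, of "\<lambda>k. k" M] D_sets sets_M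
          by auto
        also have "\<dots> = (\<Sum>k\<in>D. ennreal (G (Sup k) - G (Inf k)))"
        proof (rule sum.cong[OF refl])
          fix k assume k: "k \<in> D"
          obtain l u where "k = {l..u}" "l \<le> u" "Inf k = l" "Sup k = u"
            by (rule division_of_Icc[OF D k])
          then show "emeasure M k = ennreal (G (Sup k) - G (Inf k))" using Icc by simp
        qed
        also have "\<dots> = ennreal (total_increment G D)"
          unfolding total_increment_def
        proof (rule sum_ennreal)
          fix k assume k: "k \<in> D"
          obtain l u where "k = {l..u}" "l \<le> u" "Inf k = l" "Sup k = u"
            by (rule division_of_Icc[OF D k])
          then show "0 \<le> G (Sup k) - G (Inf k)" using mono_G by simp
        qed
        also have "\<dots> \<le> \<epsilon>" using \<open>total_increment G D < \<epsilon>\<close> by (intro ennreal_leI) simp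
        finally show "emeasure M (A n) \<le> \<epsilon>" .
      qed
      have "emeasure M N \<le> emeasure M U"
        by (rule emeasure_mono[OF U(2)]) (use U(1) sets_M in auto)
      also have "\<dots> = (SUP n. emeasure M (A n))"
        unfolding U_A by (rule SUP_emeasure_incseq[symmetric]) (use A inc in auto)
      also have "\<dots> \<le> \<epsilon>" by (rule SUP_least) (rule A)
      finally show ?thesis by simp
    qed
    then have "emeasure M N \<le> 0" by (rule ennreal_le_epsilon) simp
    then show "N \<in> null_sets M" using N sets_M by (auto simp: null_sets_def)
  qed
  then obtain g where g: "g \<in> borel_measurable lborel" "density lborel g = M"
    using sigma_finite_measure.Radon_Nikodym[OF sigma_finite_lborel, of M] sets_M by auto
  have gI: "(\<integral>\<^sup>+t. g t * indicator {x..y} t \<partial>lborel) = ennreal (F y - F x)"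
    if "x \<le> y" "{x..y} \<subseteq> {c..d}" for x y
  proof -
    have "(\<integral>\<^sup>+t. g t * indicator {x..y} t \<partial>lborel) = emeasure (density lborel g) {x..y}"
      using g(1) by (simp add: emeasure_density)
    also have "\<dots> = ennreal (F y - F x)"
      using Icc[OF that(1)] G_eq[of x] G_eq[of y] that by (simp add: g(2) subset_iff)
    finally show ?thesis .
  qed
  \<comment> \<open>\<open>enn2real\<close> sends infinity to 0. On \<open>{c..d}\<close> this
    alters \<open>g\<close> only on a null set, because the integral of \<open>g\<close> there is
    finite.\<close>
  define \<phi> where "\<phi> = (\<lambda>x. enn2real (g x))"
  have m\<phi>[measurable]: "\<phi> \<in> borel_measurable lborel" unfolding \<phi>_def using g(1) by measurable
  have "AE x in lborel. g x * indicator {c..d} x \<noteq> \<infinity>"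
    by (rule nn_integral_PInf_AE) (use g(1) gI[of c d] \<open>c \<le> d\<close> in auto)
  then have AEg: "AE x in lborel. x \<in> {c..d} \<longrightarrow> ennreal (\<phi> x) = g x"
    by eventually_elim (auto simp: \<phi>_def less_top split: split_indicator)
  have "has_AC_deriv_on F \<phi> {c..d}"
    unfolding has_AC_deriv_on_def
  proof (intro allI impI)
    fix x y assume xy: "x \<le> y \<and> {x..y} \<subseteq> {c..d}"
    have "(\<integral>\<^sup>+t. ennreal (indicat_real {x..y} t *\<^sub>R \<phi> t) \<partial>lborel) = (\<integral>\<^sup>+t. g t * indicator {x..y} t \<partial>lborel)"
      by (rule nn_integral_cong_AE) (use AEg xy in \<open>auto elim!: eventually_mono split: split_indicator\<close>)
    then have nn: "(\<integral>\<^sup>+t. ennreal (indicat_real {x..y} t *\<^sub>R \<phi> t) \<partial>lborel) = ennreal (F y - F x)"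
      using gI xy by simp
    have nonneg: "0 \<le> indicat_real {x..y} t *\<^sub>R \<phi> t" for t by (simp add: \<phi>_def)
    have int: "set_integrable lborel {x..y} \<phi>"
      unfolding set_integrable_def
      by (rule integrableI_nn_integral_finite[OF _ _ nn]) (use nonneg in auto)
    have "F x \<le> F y" by (rule mono_onD[OF mono]) (use xy in auto)
    then have "(LINT t:{x..y}|lborel. \<phi> t) = F y - F x"
      unfolding set_lebesgue_integral_def
      using nn nonneg integral_eq_nn_integral[of "\<lambda>t. indicat_real {x..y} t *\<^sub>R \<phi> t" lborel] by simp
    moreover have "\<phi> absolutely_integrable_on {x..y}"
      using int by (auto simp: set_integrable_def integrable_completion)
    ultimately show "\<phi> absolutely_integrable_on {x..y} \<and> F y - F x = integral {x..y} \<phi>"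
      using set_borel_integral_eq_integral(2)[OF int] by simp
  qed
  then show thesis by (rule that)
qed

text \<open>The common source of absolute continuity for differences, components, products and
  reciprocals: it suffices to estimate one increment.\<close>

lemma AC_dominated:
  assumes f: "abs_continuous_between f c d" and g: "abs_continuous_between g c d"
    and dom: "\<And>x y. \<lbrakk>x \<in> {c..d}; y \<in> {c..d}\<rbrakk> \<Longrightarrow>
      norm (h y - h x) \<le> K * (norm (f y - f x) + norm (g y - g x))"
  shows "abs_continuous_between h c d"
  unfolding abs_continuous_between_def
proof (intro allI impI)
  fix \<epsilon> :: real assume "\<epsilon> > 0"
  \<comment> \<open>\<open>K\<close> may be negative, hence \<open>\<bar>K\<bar>\<close>; the added
    1 avoids a zero denominator and makes the last estimate strict.\<close>
  define \<eta> where "\<eta> = \<epsilon> / (2 * (\<bar>K\<bar> + 1))"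
  have "\<eta> > 0" using \<open>\<epsilon> > 0\<close> by (simp add: \<eta>_def)
  obtain \<delta>1 where \<delta>1: "\<delta>1 > 0" "\<And>D. \<lbrakk>D division_of \<Union>D; \<Union>D \<subseteq> {c..d}; (\<Sum>k\<in>D. Sup k - Inf k) < \<delta>1\<rbrakk>
     \<Longrightarrow> (\<Sum>k\<in>D. norm (f (Sup k) - f (Inf k))) < \<eta>"
    using f \<open>\<eta> > 0\<close> unfolding abs_continuous_between_def by meson
  obtain \<delta>2 where \<delta>2: "\<delta>2 > 0" "\<And>D. \<lbrakk>D division_of \<Union>D; \<Union>D \<subseteq> {c..d}; (\<Sum>k\<in>D. Sup k - Inf k) < \<delta>2\<rbrakk>
     \<Longrightarrow> (\<Sum>k\<in>D. norm (g (Sup k) - g (Inf k))) < \<eta>"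
    using g \<open>\<eta> > 0\<close> unfolding abs_continuous_between_def by meson
  have "(\<Sum>k\<in>D. norm (h (Sup k) - h (Inf k))) < \<epsilon>"
    if D: "D division_of \<Union>D" "\<Union>D \<subseteq> {c..d}" "(\<Sum>k\<in>D. Sup k - Inf k) < min \<delta>1 \<delta>2" for D
  proof -
    have "(\<Sum>k\<in>D. norm (h (Sup k) - h (Inf k)))
      \<le> (\<Sum>k\<in>D. \<bar>K\<bar> * (norm (f (Sup k) - f (Inf k)) + norm (g (Sup k) - g (Inf k))))"
    proof (rule sum_mono)
      fix k assume k: "k \<in> D"
      obtain l u where lu: "k = {l..u}" "l \<le> u" "Inf k = l" "Sup k = u"
        by (rule division_of_Icc[OF D(1) k])
      then have "l \<in> k" "u \<in> k" by auto
      then have "l \<in> {c..d}" "u \<in> {c..d}" using D(2) k by blast+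
      then have "norm (h u - h l) \<le> K * (norm (f u - f l) + norm (g u - g l))" by (rule dom)
      also have "\<dots> \<le> \<bar>K\<bar> * (norm (f u - f l) + norm (g u - g l))"
        by (intro mult_right_mono) auto
      finally show "norm (h (Sup k) - h (Inf k))
          \<le> \<bar>K\<bar> * (norm (f (Sup k) - f (Inf k)) + norm (g (Sup k) - g (Inf k)))"
        using lu by simp
    qed
    also have "\<dots> = \<bar>K\<bar> * ((\<Sum>k\<in>D. norm (f (Sup k) - f (Inf k))) + (\<Sum>k\<in>D. norm (g (Sup k) - g (Inf k))))"
      by (simp only: sum_distrib_left[symmetric] sum.distrib)
    also have "\<dots> \<le> \<bar>K\<bar> * (\<eta> + \<eta>)"
    proof (intro mult_left_mono add_mono)
      show "(\<Sum>k\<in>D. norm (f (Sup k) - f (Inf k))) \<le> \<eta>" using \<delta>1(2)[of D] D by simp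
      show "(\<Sum>k\<in>D. norm (g (Sup k) - g (Inf k))) \<le> \<eta>" using \<delta>2(2)[of D] D by simp
    qed simp
    also have "\<dots> < (\<bar>K\<bar> + 1) * (\<eta> + \<eta>)" using \<open>\<eta> > 0\<close> by (intro mult_strict_right_mono) auto
    also have "\<dots> = \<epsilon>"
    proof -
      have "\<bar>K\<bar> + 1 \<noteq> 0" by linarith
      then show ?thesis unfolding \<eta>_def by (simp add: divide_simps)
    qed
    finally show ?thesis .
  qed
  then show "\<exists>\<delta>>0. \<forall>D. D division_of \<Union>D \<and> \<Union>D \<subseteq> {c..d} \<and> (\<Sum>k\<in>D. Sup k - Inf k) < \<delta> \<longrightarrow>
      (\<Sum>k\<in>D. norm (h (Sup k) - h (Inf k))) < \<epsilon>"
    using \<delta>1(1) \<delta>2(1) by (intro exI[of _ "min \<delta>1 \<delta>2"]) auto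
qed

section \<open>Linear rules for indefinite integrals, and existence of the derivative\<close>

lemma has_AC_deriv_onI:
  assumes "\<And>x y. x \<le> y \<Longrightarrow> {x..y} \<subseteq> I \<Longrightarrow> \<phi> absolutely_integrable_on {x..y}"
    "\<And>x y. x \<le> y \<Longrightarrow> {x..y} \<subseteq> I \<Longrightarrow> f y - f x = integral {x..y} \<phi>"
  shows "has_AC_deriv_on f \<phi> I"
  using assms by (auto simp: has_AC_deriv_on_def)

lemma has_AC_deriv_onD:
  assumes "has_AC_deriv_on f \<phi> I" "x \<le> y" "{x..y} \<subseteq> I"
  shows "\<phi> absolutely_integrable_on {x..y}" "\<phi> integrable_on {x..y}" "integral {x..y} \<phi> = f y - f x"
  using assms set_lebesgue_integral_eq_integral(1)[of "{x..y}" \<phi>] by (auto simp: has_AC_deriv_on_def)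

lemma has_AC_deriv_on_subset: "has_AC_deriv_on f \<phi> I \<Longrightarrow> J \<subseteq> I \<Longrightarrow> has_AC_deriv_on f \<phi> J"
  unfolding has_AC_deriv_on_def by (meson order_trans)

lemma has_AC_deriv_on_local:
  assumes "\<And>c d. c \<le> d \<Longrightarrow> {c..d} \<subseteq> I \<Longrightarrow> has_AC_deriv_on f \<phi> {c..d}"
  shows "has_AC_deriv_on f \<phi> I"
  using assms unfolding has_AC_deriv_on_def by blast

lemma has_AC_deriv_on_const: "has_AC_deriv_on (\<lambda>x. k) (\<lambda>x. 0) I"
  by (rule has_AC_deriv_onI) auto

lemma has_AC_deriv_on_add:
  assumes "has_AC_deriv_on f \<phi> I" "has_AC_deriv_on g \<psi> I"
  shows "has_AC_deriv_on (\<lambda>x. f x + g x) (\<lambda>x. \<phi> x + \<psi> x) I"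
proof (rule has_AC_deriv_onI)
  fix x y :: real assume xy: "x \<le> y" "{x..y} \<subseteq> I"
  note f = has_AC_deriv_onD[OF assms(1) xy] and g = has_AC_deriv_onD[OF assms(2) xy]
  show "(\<lambda>x. \<phi> x + \<psi> x) absolutely_integrable_on {x..y}"
    using f(1) g(1) by (rule set_integral_add(1))
  show "f y + g y - (f x + g x) = integral {x..y} (\<lambda>x. \<phi> x + \<psi> x)"
    using f g by (simp add: Henstock_Kurzweil_Integration.integral_add)
qed

lemma has_AC_deriv_on_linear:
  fixes L :: "'a::euclidean_space \<Rightarrow> 'b::euclidean_space"
  assumes "bounded_linear L" "has_AC_deriv_on f \<phi> I"
  shows "has_AC_deriv_on (\<lambda>x. L (f x)) (\<lambda>x. L (\<phi> x)) I"
proof (rule has_AC_deriv_onI)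
  fix x y :: real assume xy: "x \<le> y" "{x..y} \<subseteq> I"
  note f = has_AC_deriv_onD[OF assms(2) xy]
  show "(\<lambda>x. L (\<phi> x)) absolutely_integrable_on {x..y}"
    using absolutely_integrable_linear[OF f(1) assms(1)] by (simp add: o_def)
  show "L (f y) - L (f x) = integral {x..y} (\<lambda>x. L (\<phi> x))"
    using integral_linear[OF f(2) assms(1)] f(3) linear_diff[of L] assms(1)
    by (simp add: o_def bounded_linear.linear)
qed

lemma has_AC_deriv_on_sum:
  assumes "finite B" "\<And>b. b \<in> B \<Longrightarrow> has_AC_deriv_on (f b) (\<phi> b) I"
  shows "has_AC_deriv_on (\<lambda>x. \<Sum>b\<in>B. f b x) (\<lambda>x. \<Sum>b\<in>B. \<phi> b x) I"
  using assms by (induction B) (auto intro: has_AC_deriv_on_const has_AC_deriv_on_add)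

lemma has_AC_deriv_on_minus: "has_AC_deriv_on f \<phi> I \<Longrightarrow> has_AC_deriv_on (\<lambda>x. - f x) (\<lambda>x. - \<phi> x) I"
  by (rule has_AC_deriv_on_linear) (simp add: bounded_linear_minus bounded_linear_ident)

lemma has_AC_deriv_on_diff:
  assumes "has_AC_deriv_on f \<phi> I" "has_AC_deriv_on g \<psi> I"
  shows "has_AC_deriv_on (\<lambda>x. f x - g x) (\<lambda>x. \<phi> x - \<psi> x) I"
  using has_AC_deriv_on_add[OF assms(1) has_AC_deriv_on_minus[OF assms(2)]] by simp

lemma has_AC_deriv_on_cong_AE:
  assumes "has_AC_deriv_on f \<phi> I" "AE x in lebesgue. x \<in> I \<longrightarrow> \<phi> x = \<psi> x"
    "\<And>x. x \<in> I \<Longrightarrow> f x = g x"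
  shows "has_AC_deriv_on g \<psi> I"
proof (rule has_AC_deriv_onI)
  obtain N where N: "negligible N" "\<And>x. x \<notin> N \<Longrightarrow> x \<in> I \<Longrightarrow> \<phi> x = \<psi> x"
    using assms(2) unfolding eventually_ae_filter_negligible by blast
  fix x y :: real assume xy: "x \<le> y" "{x..y} \<subseteq> I"
  note f = has_AC_deriv_onD[OF assms(1) xy]
  show "\<psi> absolutely_integrable_on {x..y}"
    by (rule absolutely_integrable_spike[OF f(1) N(1)]) (use N xy in auto)
  have "integral {x..y} \<phi> = integral {x..y} \<psi>"
    by (rule integral_spike[OF N(1)]) (use N xy in auto)
  moreover have "f x = g x" "f y = g y" using assms(3) xy by auto
  ultimately show "g y - g x = integral {x..y} \<psi>" using f(3) by simp
qed

text \<open>Jordan decomposition: \<open>f\<close> is its positive variation minus a nondecreasing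
  function, and both are absolutely continuous.\<close>

lemma AC_has_deriv_real:
  fixes f :: "real \<Rightarrow> real"
  assumes AC: "abs_continuous_between f c d" and "c \<le> d"
  obtains \<phi> where "has_AC_deriv_on f \<phi> {c..d}"
proof -
  let ?W = "pos_variation f c"
  have W: "abs_continuous_between ?W c d" by (rule pos_variation_AC[OF AC])
  have WmonoL: "?W x \<le> ?W y" if "c \<le> x" "x \<le> y" "y \<le> d" for x y
    using pos_variation_mono[OF AC that] .
  obtain \<phi> where \<phi>: "has_AC_deriv_on ?W \<phi> {c..d}"
    by (rule mono_AC_has_deriv[OF W \<open>c \<le> d\<close>]) (auto intro!: mono_onI WmonoL)
  have "abs_continuous_between (\<lambda>x. ?W x - f x) c d"
    by (rule AC_dominated[OF W AC, of _ 1]) auto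
  then obtain \<psi> where \<psi>: "has_AC_deriv_on (\<lambda>x. ?W x - f x) \<psi> {c..d}"
  proof (rule mono_AC_has_deriv[OF _ \<open>c \<le> d\<close>])
    show "mono_on {c..d} (\<lambda>x. ?W x - f x)"
    proof (rule mono_onI)
      fix x y assume "x \<in> {c..d}" "y \<in> {c..d}" "x \<le> y"
      then show "?W x - f x \<le> ?W y - f y" using pos_variation_increase[OF AC, of x y] by simp
    qed
  qed
  show thesis using has_AC_deriv_on_diff[OF \<phi> \<psi>] by (intro that) simp
qed

lemma AC_has_deriv:
  fixes f :: "real \<Rightarrow> 'a::euclidean_space"
  assumes AC: "abs_continuous_between f c d" and "c \<le> d"
  obtains \<phi> where "has_AC_deriv_on f \<phi> {c..d}"
proof -
  have "\<exists>\<phi>. has_AC_deriv_on (\<lambda>x. f x \<bullet> b) \<phi> {c..d}" for b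
  proof -
    have "abs_continuous_between (\<lambda>x. f x \<bullet> b) c d"
    proof (rule AC_dominated[OF AC AC, of _ "norm b"])
      fix x y
      have "norm (f y \<bullet> b - f x \<bullet> b) \<le> norm (f y - f x) * norm b"
        by (metis inner_diff_left real_norm_def Cauchy_Schwarz_ineq2)
      also have "\<dots> \<le> norm b * (norm (f y - f x) + norm (f y - f x))"
        by (simp add: mult.commute mult_left_mono)
      finally show "norm (f y \<bullet> b - f x \<bullet> b) \<le> norm b * (norm (f y - f x) + norm (f y - f x))" .
    qed
    then show ?thesis using AC_has_deriv_real \<open>c \<le> d\<close> by metis
  qed
  then obtain \<phi> where \<phi>: "\<And>b. has_AC_deriv_on (\<lambda>x. f x \<bullet> b) (\<phi> b) {c..d}" by metis
  have "has_AC_deriv_on (\<lambda>x. \<Sum>b\<in>Basis. (f x \<bullet> b) *\<^sub>R b) (\<lambda>x. \<Sum>b\<in>Basis. \<phi> b x *\<^sub>R b) {c..d}"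
    by (intro has_AC_deriv_on_sum has_AC_deriv_on_linear[OF bounded_linear_scaleR_left] \<phi>) simp
  then show thesis by (intro that) (simp add: euclidean_representation)
qed

section \<open>From the integral back to absolute continuity and pointwise derivatives\<close>

text \<open>Truncation: the part of \<open>norm (\<phi> x)\<close> above a height \<open>N\<close>
  has small integral, and the part below contributes at most \<open>N\<close> times the
  length.\<close>

lemma has_AC_deriv_imp_AC:
  assumes f: "has_AC_deriv_on f \<phi> {c..d}"
  shows "abs_continuous_between f c d"
proof (cases "c \<le> d")
  case False
  then show ?thesis
    unfolding abs_continuous_between_def
  proof (intro allI impI exI[of _ 1] conjI)
    fix \<epsilon> :: real and D :: "real set set" assume "\<epsilon> > 0"
      and D: "D division_of \<Union>D \<and> \<Union>D \<subseteq> {c..d} \<and> (\<Sum>k\<in>D. Sup k - Inf k) < 1"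
    have "D = {}" using D False division_ofD(3)[of D "\<Union>D"] by fastforce
    then show "(\<Sum>k\<in>D. norm (f (Sup k) - f (Inf k))) < \<epsilon>" using \<open>\<epsilon> > 0\<close> by simp
  qed simp
next
  case True
  define \<psi> where "\<psi> = (\<lambda>x. norm (\<phi> x))"
  have \<phi>: "\<phi> absolutely_integrable_on {c..d}" using has_AC_deriv_onD[OF f True] by simp
  then have \<psi>: "\<psi> absolutely_integrable_on {c..d}"
    unfolding \<psi>_def by (rule set_integrable_norm)
  \<comment> \<open>The excess of \<open>\<psi>\<close> over height \<open>N\<close>; it is
    dominated by \<open>\<psi>\<close> and tends to 0 pointwise, so its integral tends to 0.\<close>
  define \<rho> where "\<rho> N x = \<psi> x - min (\<psi> x) (real N)" for N x
  have \<rho>: "\<rho> N absolutely_integrable_on {c..d}" for N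
    unfolding \<rho>_def by (intro set_integral_diff(1) absolutely_integrable_min_1 \<psi> absolutely_integrable_on_const) auto
  then have \<rho>i: "\<rho> N integrable_on {c..d}" for N by (rule set_lebesgue_integral_eq_integral(1))
  have lim: "(\<lambda>N. integral {c..d} (\<rho> N)) \<longlonglongrightarrow> integral {c..d} (\<lambda>x. 0)"
  proof (rule dominated_convergence(2)[OF \<rho>i])
    show "\<psi> integrable_on {c..d}" using \<psi> by (rule set_lebesgue_integral_eq_integral(1))
    show "norm (\<rho> N x) \<le> \<psi> x" for N x by (auto simp: \<rho>_def \<psi>_def)
    fix x
    have "eventually (\<lambda>N. \<rho> N x = 0) sequentially"
      using eventually_ge_at_top[of "nat \<lceil>\<psi> x\<rceil>"]
    proof eventually_elim
      case (elim N)
      then have "\<psi> x \<le> real N" by linarith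
      then show ?case by (simp add: \<rho>_def)
    qed
    then show "(\<lambda>N. \<rho> N x) \<longlonglongrightarrow> 0" by (rule tendsto_eventually)
  qed
  show ?thesis
    unfolding abs_continuous_between_def
  proof (intro allI impI)
    fix \<epsilon> :: real assume "\<epsilon> > 0"
    have "eventually (\<lambda>N. integral {c..d} (\<rho> N) < \<epsilon>/2) sequentially"
      using order_tendstoD(2)[OF lim, of "\<epsilon>/2"] \<open>\<epsilon> > 0\<close> by simp
    then obtain N where N: "integral {c..d} (\<rho> N) < \<epsilon>/2" by (meson eventually_happens' sequentially_bot)
    define \<delta> where "\<delta> = \<epsilon> / (2 * (real N + 1))"
    have "\<delta> > 0" using \<open>\<epsilon> > 0\<close> by (simp add: \<delta>_def)
    have "(\<Sum>k\<in>D. norm (f (Sup k) - f (Inf k))) < \<epsilon>"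
      if D: "D division_of \<Union>D" "\<Union>D \<subseteq> {c..d}" "(\<Sum>k\<in>D. Sup k - Inf k) < \<delta>" for D
    proof -
      have "(\<Sum>k\<in>D. norm (f (Sup k) - f (Inf k))) \<le> (\<Sum>k\<in>D. integral k (\<rho> N) + real N * (Sup k - Inf k))"
      proof (rule sum_mono)
        fix k assume k: "k \<in> D"
        obtain l u where lu: "k = {l..u}" "l \<le> u" "Inf k = l" "Sup k = u"
          by (rule division_of_Icc[OF D(1) k])
        have sub: "{l..u} \<subseteq> {c..d}" using D(2) k lu by blast
        note fk = has_AC_deriv_onD[OF f lu(2) sub]
        have \<rho>k: "\<rho> N integrable_on {l..u}" using \<rho>i sub by (rule integrable_on_subinterval)
        have "norm (f u - f l) = norm (integral {l..u} \<phi>)" using fk by simp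
        also have "\<dots> \<le> integral {l..u} (\<lambda>x. \<rho> N x + real N)"
        proof (rule integral_norm_bound_integral[OF fk(2)])
          show "(\<lambda>x. \<rho> N x + real N) integrable_on {l..u}"
            using \<rho>k by (intro integrable_add) auto
          show "norm (\<phi> x) \<le> \<rho> N x + real N" for x by (auto simp: \<rho>_def \<psi>_def)
        qed
        also have "\<dots> = integral {l..u} (\<rho> N) + real N * (u - l)"
          using \<rho>k lu by (subst Henstock_Kurzweil_Integration.integral_add) (auto simp: integral_const_real)
        finally show "norm (f (Sup k) - f (Inf k)) \<le> integral k (\<rho> N) + real N * (Sup k - Inf k)"
          using lu by simp
      qed
      also have "\<dots> = integral (\<Union>D) (\<rho> N) + real N * (\<Sum>k\<in>D. Sup k - Inf k)"
      proof -
        have "\<rho> N integrable_on \<Union>D" using integrable_on_subdivision[OF D(1) \<rho>i D(2)] .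
        from integral_combine_division_topdown[OF this D(1)] show ?thesis
          by (simp add: sum.distrib sum_distrib_left)
      qed
      also have "integral (\<Union>D) (\<rho> N) \<le> integral {c..d} (\<rho> N)"
        using integrable_on_subdivision[OF D(1) \<rho>i D(2)] \<rho>i D(2)
        by (intro integral_subset_le) (auto simp: \<rho>_def)
      also have "real N * (\<Sum>k\<in>D. Sup k - Inf k) \<le> real N * \<delta>" using D(3) by (intro mult_left_mono) auto
      also have "real N * \<delta> \<le> \<epsilon>/2" using \<open>\<epsilon> > 0\<close> by (simp add: \<delta>_def field_simps)
      finally show ?thesis using N by simp
    qed
    then show "\<exists>\<delta>>0. \<forall>D. D division_of \<Union>D \<and> \<Union>D \<subseteq> {c..d} \<and> (\<Sum>k\<in>D. Sup k - Inf k) < \<delta> \<longrightarrow>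
      (\<Sum>k\<in>D. norm (f (Sup k) - f (Inf k))) < \<epsilon>"
      using \<open>\<delta> > 0\<close> by blast
  qed
qed

text \<open>Lebesgue differentiation: \<open>integrable_ccontinuous_explicit\<close> treats averages
  over \<open>{x..x + h}\<close> with \<open>h > 0\<close>, and a reflection supplies those on the
  left.\<close>

lemma has_AC_deriv_imp_vector_derivative:
  assumes f: "has_AC_deriv_on f \<phi> {c..d}" and "c \<le> d"
  obtains N where "negligible N" "\<And>x. \<lbrakk>c < x; x < d; x \<notin> N\<rbrakk> \<Longrightarrow> (f has_vector_derivative \<phi> x) (at x)"
proof -
  define \<psi> where "\<psi> = (\<lambda>x. if x \<in> {c..d} then \<phi> x else 0)"
  have \<phi>: "\<phi> integrable_on {c..d}" using has_AC_deriv_onD[OF f \<open>c \<le> d\<close>] by simp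
  then have "\<psi> integrable_on UNIV" unfolding \<psi>_def by (subst integrable_restrict_UNIV)
  then have \<psi>: "\<psi> integrable_on {x..y}" for x y
    by (rule integrable_on_subinterval) simp
  have \<psi>': "(\<lambda>t. \<psi> (- t)) integrable_on {x..y}" for x y
    using \<psi>[of "-y" "-x"] Henstock_Kurzweil_Integration.integrable_reflect_real[where f=\<psi> and a="-y" and b="-x"] by simp
  have int: "integral {x..y} \<psi> = f y - f x" if "x \<le> y" "c \<le> x" "y \<le> d" for x y
  proof -
    have "integral {x..y} \<psi> = integral {x..y} \<phi>"
      by (rule integral_cong) (use that in \<open>auto simp: \<psi>_def\<close>)
    then show ?thesis using has_AC_deriv_onD(3)[OF f, of x y] that by auto
  qed
  obtain N1 where N1: "negligible N1" "\<And>x e. \<lbrakk>x \<notin> N1; 0 < e\<rbrakk> \<Longrightarrow>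
      \<exists>\<delta>>0. \<forall>h. 0 < h \<and> h < \<delta> \<longrightarrow> norm (integral {x..x + h} \<psi> /\<^sub>R h - \<psi> x) < e"
    using integrable_ccontinuous_explicit[of \<psi>] \<psi> by (simp add: cbox_interval) metis
  obtain N2 where N2: "negligible N2" "\<And>x e. \<lbrakk>x \<notin> N2; 0 < e\<rbrakk> \<Longrightarrow>
      \<exists>\<delta>>0. \<forall>h. 0 < h \<and> h < \<delta> \<longrightarrow> norm (integral {x..x + h} (\<lambda>t. \<psi> (- t)) /\<^sub>R h - \<psi> (- x)) < e"
    using integrable_ccontinuous_explicit[of "\<lambda>t. \<psi> (- t)"] \<psi>' by (simp add: cbox_interval) metis
  show thesis
  proof (rule that)
    have "negligible (uminus ` N2)"
      by (rule negligible_differentiable_image_negligible[OF _ N2(1)])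
        (auto simp: differentiable_on_def intro!: derivative_intros)
    then show "negligible (N1 \<union> uminus ` N2)" using N1(1) by simp
    fix x assume x: "c < x" "x < d" "x \<notin> N1 \<union> uminus ` N2"
    then have xN: "x \<notin> N1" "- x \<notin> N2" by (auto intro: rev_image_eqI)
    have \<psi>x: "\<psi> x = \<phi> x" using x by (simp add: \<psi>_def)
    show "(f has_vector_derivative \<phi> x) (at x)"
      unfolding has_vector_derivative_def has_derivative_at_alt
    proof (intro conjI allI impI)
      fix e :: real assume "e > 0"
      obtain d1 where d1: "d1 > 0" "\<And>h. 0 < h \<Longrightarrow> h < d1 \<Longrightarrow> norm (integral {x..x + h} \<psi> /\<^sub>R h - \<psi> x) < e"
        using N1(2)[OF xN(1) \<open>e > 0\<close>] by blast
      obtain d2 where d2: "d2 > 0" "\<And>h. 0 < h \<Longrightarrow> h < d2 \<Longrightarrow>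
          norm (integral {- x..- x + h} (\<lambda>t. \<psi> (- t)) /\<^sub>R h - \<psi> x) < e"
        using N2(2)[OF xN(2) \<open>e > 0\<close>] by auto
      have scale: "norm (w - h *\<^sub>R z) \<le> e * h" if "norm (w /\<^sub>R h - z) < e" "h > 0" for w z :: 'a and h
      proof -
        have "w - h *\<^sub>R z = h *\<^sub>R (w /\<^sub>R h - z)" using that(2) by (simp add: algebra_simps)
        then have "norm (w - h *\<^sub>R z) = h * norm (w /\<^sub>R h - z)" using that(2) by simp
        then show ?thesis using that by (simp add: mult.commute)
      qed
      \<comment> \<open>The last two entries keep \<open>y\<close> inside \<open>{c..d}\<close>,
        where integrals of \<open>\<psi>\<close> are increments of \<open>f\<close>.\<close>
      define \<delta> where "\<delta> = Min {d1, d2, d - x, x - c}"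
      have "\<delta> > 0" using d1 d2 x by (simp add: \<delta>_def)
      moreover have "norm (f y - f x - (y - x) *\<^sub>R \<phi> x) \<le> e * norm (y - x)" if "norm (y - x) < \<delta>" for y
      proof -
        consider "y = x" | "y > x" | "y < x" by linarith
        then show ?thesis
        proof cases
          case 1 then show ?thesis by simp
        next
          case 2
          define h where "h = y - x"
          have h: "0 < h" "h < d1" "y = x + h" "y \<le> d" using 2 that by (auto simp: h_def \<delta>_def)
          then have "norm (integral {x..x + h} \<psi> - h *\<^sub>R \<psi> x) \<le> e * h" using d1(2) scale by blast
          moreover have "integral {x..x + h} \<psi> = f y - f x" using int[of x y] h x by simp
          ultimately show ?thesis using h \<psi>x by simp
        next
          case 3
          define h where "h = x - y"
          have h: "0 < h" "h < d2" "y = x - h" "c \<le> y" using 3 that by (auto simp: h_def \<delta>_def)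
          then have "norm (integral {- x..- x + h} (\<lambda>t. \<psi> (- t)) - h *\<^sub>R \<psi> x) \<le> e * h" using d2(2) scale by blast
          moreover have "integral {- x..- x + h} (\<lambda>t. \<psi> (- t)) = integral {y..x} \<psi>"
            using Henstock_Kurzweil_Integration.integral_reflect_real[where f=\<psi> and a=y and b=x] h by simp
          moreover have "integral {y..x} \<psi> = f x - f y" using int[of y x] h x by simp
          ultimately have "norm (f x - f y - h *\<^sub>R \<phi> x) \<le> e * h" using \<psi>x by simp
          moreover have "f y - f x - (y - x) *\<^sub>R \<phi> x = - (f x - f y - h *\<^sub>R \<phi> x)"
            using h by simp
          ultimately have "norm (f y - f x - (y - x) *\<^sub>R \<phi> x) \<le> e * h" by (metis norm_minus_cancel)
          moreover have "norm (y - x) = h" using h by simp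
          ultimately show ?thesis by (simp only:)
        qed
      qed
      ultimately show "\<exists>\<delta>>0. \<forall>y. norm (y - x) < \<delta> \<longrightarrow> norm (f y - f x - (y - x) *\<^sub>R \<phi> x) \<le> e * norm (y - x)"
        by blast
    qed (simp add: bounded_linear_scaleR_left)
  qed
qed

lemma has_AC_deriv_imp_AC_loc: "has_AC_deriv_on f \<phi> I \<Longrightarrow> f \<in> AC_loc I"
  unfolding AC_loc_def using has_AC_deriv_imp_AC has_AC_deriv_on_subset by blast

text \<open>Countably many compact intervals with rational ends have interiors covering
  \<open>I\<close>, so the exceptional null sets can be united.\<close>

lemma has_AC_deriv_AE:
  assumes "open I" and f: "has_AC_deriv_on f \<phi> I"
  shows "AE x in lebesgue. x \<in> I \<longrightarrow> (f has_vector_derivative \<phi> x) (at x)"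
proof -
  define Q where "Q = {(c, d). c \<in> \<rat> \<and> d \<in> \<rat> \<and> c < d \<and> {c..d} \<subseteq> I}"
  have "Q \<subseteq> \<rat> \<times> \<rat>" by (auto simp: Q_def)
  then have cQ: "countable Q" by (rule countable_subset) (simp add: countable_rat)
  have "\<forall>z\<in>Q. \<exists>N. negligible N \<and> (\<forall>x. fst z < x \<and> x < snd z \<and> x \<notin> N \<longrightarrow>
      (f has_vector_derivative \<phi> x) (at x))"
  proof
    fix z assume "z \<in> Q"
    then have "has_AC_deriv_on f \<phi> {fst z..snd z}" "fst z \<le> snd z"
      by (auto simp: Q_def intro!: has_AC_deriv_on_subset[OF f])
    from has_AC_deriv_imp_vector_derivative[OF this]
    show "\<exists>N. negligible N \<and> (\<forall>x. fst z < x \<and> x < snd z \<and> x \<notin> N \<longrightarrow>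
      (f has_vector_derivative \<phi> x) (at x))" by metis
  qed
  then obtain N where N: "\<And>z. z \<in> Q \<Longrightarrow> negligible (N z)"
    "\<And>z x. z \<in> Q \<Longrightarrow> fst z < x \<Longrightarrow> x < snd z \<Longrightarrow> x \<notin> N z \<Longrightarrow> (f has_vector_derivative \<phi> x) (at x)"
    by metis
  have "negligible (\<Union>(N ` Q))" using cQ N(1) by (intro negligible_countable_Union) auto
  moreover have "(f has_vector_derivative \<phi> x) (at x)" if x: "x \<in> I" "x \<notin> \<Union>(N ` Q)" for x
  proof -
    obtain e where e: "e > 0" "cball x e \<subseteq> I" using \<open>open I\<close> x(1) open_contains_cball by metis
    obtain c where c: "c \<in> \<rat>" "x - e < c" "c < x" using Rats_dense_in_real[of "x - e" x] e by auto
    obtain d where d: "d \<in> \<rat>" "x < d" "d < x + e" using Rats_dense_in_real[of x "x + e"] e by auto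
    have "{c..d} \<subseteq> cball x e" using c d by (auto simp: dist_real_def)
    then have "(c, d) \<in> Q" using c d e by (auto simp: Q_def)
    then show ?thesis using N(2)[of "(c, d)" x] c d x by auto
  qed
  ultimately show ?thesis unfolding eventually_ae_filter_negligible by blast
qed

text \<open>A derivative almost everywhere does not control increments in general (Cantor function).
  Under absolute continuity a density exists, and it must agree with \<open>\<psi>\<close> almost
  everywhere. The product and reciprocal rules reduce to the classical pointwise ones in this
  way.\<close>

lemma has_AC_deriv_on_AE_derivI:
  assumes f: "abs_continuous_between f c d" "c \<le> d"
    and N: "negligible N" "\<And>x. \<lbrakk>c < x; x < d; x \<notin> N\<rbrakk> \<Longrightarrow> (f has_vector_derivative \<psi> x) (at x)"
  shows "has_AC_deriv_on f \<psi> {c..d}"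
proof -
  obtain \<phi> where \<phi>: "has_AC_deriv_on f \<phi> {c..d}" using AC_has_deriv[OF f] by metis
  obtain N' where N': "negligible N'" "\<And>x. \<lbrakk>c < x; x < d; x \<notin> N'\<rbrakk> \<Longrightarrow> (f has_vector_derivative \<phi> x) (at x)"
    using has_AC_deriv_imp_vector_derivative[OF \<phi> f(2)] by metis
  have "negligible (N \<union> N' \<union> {c, d})" using N N' by simp
  moreover have "\<phi> x = \<psi> x" if "x \<in> {c..d}" "x \<notin> N \<union> N' \<union> {c, d}" for x
    using that N(2)[of x] N'(2)[of x] by (auto intro: vector_derivative_unique_at)
  ultimately have "AE x in lebesgue. x \<in> {c..d} \<longrightarrow> \<phi> x = \<psi> x"
    unfolding eventually_ae_filter_negligible by blast
  then show ?thesis using has_AC_deriv_on_cong_AE[OF \<phi>] by blast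
qed

lemma AC_loc_has_deriv:
  fixes f :: "real \<Rightarrow> 'a::euclidean_space"
  assumes "f \<in> AC_loc I"
  shows "has_AC_deriv_on f (\<lambda>x. vector_derivative f (at x)) I"
proof (rule has_AC_deriv_on_local)
  fix c d :: real assume cd: "c \<le> d" "{c..d} \<subseteq> I"
  then have AC: "abs_continuous_between f c d" using assms by (auto simp: AC_loc_def)
  obtain \<phi> where \<phi>: "has_AC_deriv_on f \<phi> {c..d}" using AC_has_deriv[OF AC cd(1)] by metis
  obtain N where N: "negligible N" "\<And>x. \<lbrakk>c < x; x < d; x \<notin> N\<rbrakk> \<Longrightarrow> (f has_vector_derivative \<phi> x) (at x)"
    using has_AC_deriv_imp_vector_derivative[OF \<phi> cd(1)] by metis
  show "has_AC_deriv_on f (\<lambda>x. vector_derivative f (at x)) {c..d}"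
    by (rule has_AC_deriv_on_AE_derivI[OF AC cd(1) N(1)])
      (metis N(2) vector_derivative_at)
qed

lemma has_AC_deriv_continuous_on:
  assumes "has_AC_deriv_on f \<phi> I" "{c..d} \<subseteq> I"
  shows "continuous_on {c..d} f"
  by (rule AC_imp_continuous_on[OF has_AC_deriv_imp_AC[OF has_AC_deriv_on_subset[OF assms]]])

lemma has_AC_deriv_continuous_on_open:
  assumes "has_AC_deriv_on f \<phi> I" "open I"
  shows "continuous_on I f"
proof (rule continuous_at_imp_continuous_on, rule ballI)
  fix x assume "x \<in> I"
  then obtain e where e: "e > 0" "cball x e \<subseteq> I" using \<open>open I\<close> open_contains_cball by metis
  then have "{x - e..x + e} \<subseteq> I" by (simp add: cball_eq_atLeastAtMost)
  from has_AC_deriv_continuous_on[OF assms(1) this] have "continuous_on {x - e..x + e} f" .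
  moreover have "x \<in> interior {x - e..x + e}" using e(1) by simp
  ultimately show "isCont f x" by (rule continuous_on_interior)
qed

section \<open>Product and reciprocal rules, antiderivatives\<close>

lemma has_AC_deriv_on_bilinear:
  assumes "bounded_bilinear mul" and f: "has_AC_deriv_on f \<phi> I" and g: "has_AC_deriv_on g \<psi> I"
  shows "has_AC_deriv_on (\<lambda>x. mul (f x) (g x)) (\<lambda>x. mul (f x) (\<psi> x) + mul (\<phi> x) (g x)) I"
proof (rule has_AC_deriv_on_local)
  interpret bounded_bilinear mul by fact
  fix c d :: real assume cd: "c \<le> d" "{c..d} \<subseteq> I"
  note f' = has_AC_deriv_on_subset[OF f cd(2)] and g' = has_AC_deriv_on_subset[OF g cd(2)]
  have "bounded (f ` {c..d})" "bounded (g ` {c..d})"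
    by (intro compact_imp_bounded compact_continuous_image has_AC_deriv_continuous_on[OF f']
        has_AC_deriv_continuous_on[OF g'] subset_refl compact_Icc)+
  then obtain B where B: "\<And>x. x \<in> {c..d} \<Longrightarrow> norm (f x) \<le> B" "\<And>x. x \<in> {c..d} \<Longrightarrow> norm (g x) \<le> B"
    unfolding bounded_iff by (metis (no_types, lifting) imageI max.coboundedI1 max.coboundedI2)
  obtain K where K: "K > 0" "\<And>a b. norm (mul a b) \<le> norm a * norm b * K"
    using pos_bounded by blast
  have "abs_continuous_between (\<lambda>x. mul (f x) (g x)) c d"
  proof (rule AC_dominated[OF has_AC_deriv_imp_AC[OF f'] has_AC_deriv_imp_AC[OF g']])
    fix x y assume xy: "x \<in> {c..d}" "y \<in> {c..d}"
    have "mul (f y) (g y) - mul (f x) (g x) = mul (f y - f x) (g y) + mul (f x) (g y - g x)"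
      by (simp add: diff_left diff_right)
    also have "norm \<dots> \<le> norm (mul (f y - f x) (g y)) + norm (mul (f x) (g y - g x))"
      by (rule norm_triangle_ineq)
    also have "\<dots> \<le> norm (f y - f x) * norm (g y) * K + norm (f x) * norm (g y - g x) * K"
      by (intro add_mono K)
    also have "\<dots> \<le> norm (f y - f x) * B * K + B * norm (g y - g x) * K"
      using xy K(1) B by (intro add_mono mult_right_mono mult_left_mono) auto
    also have "\<dots> = (B * K) * (norm (f y - f x) + norm (g y - g x))" by (simp add: algebra_simps)
    finally show "norm (mul (f y) (g y) - mul (f x) (g x)) \<le> (B * K) * (norm (f y - f x) + norm (g y - g x))" .
  qed
  moreover obtain N1 where N1: "negligible N1" "\<And>x. \<lbrakk>c < x; x < d; x \<notin> N1\<rbrakk> \<Longrightarrow> (f has_vector_derivative \<phi> x) (at x)"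
    using has_AC_deriv_imp_vector_derivative[OF f' cd(1)] by metis
  moreover obtain N2 where N2: "negligible N2" "\<And>x. \<lbrakk>c < x; x < d; x \<notin> N2\<rbrakk> \<Longrightarrow> (g has_vector_derivative \<psi> x) (at x)"
    using has_AC_deriv_imp_vector_derivative[OF g' cd(1)] by metis
  ultimately show "has_AC_deriv_on (\<lambda>x. mul (f x) (g x)) (\<lambda>x. mul (f x) (\<psi> x) + mul (\<phi> x) (g x)) {c..d}"
    using cd(1) by (intro has_AC_deriv_on_AE_derivI[where N = "N1 \<union> N2"] has_vector_derivative) auto
qed

lemmas has_AC_deriv_on_mult = has_AC_deriv_on_bilinear[OF bounded_bilinear_mult]

lemma has_AC_deriv_on_inverse:
  fixes f :: "real \<Rightarrow> real"
  assumes f: "has_AC_deriv_on f \<phi> I" and nz: "\<And>x. x \<in> I \<Longrightarrow> f x \<noteq> 0"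
  shows "has_AC_deriv_on (\<lambda>x. inverse (f x)) (\<lambda>x. - (\<phi> x / (f x)\<^sup>2)) I"
proof (rule has_AC_deriv_on_local)
  fix c d :: real assume cd: "c \<le> d" "{c..d} \<subseteq> I"
  note f' = has_AC_deriv_on_subset[OF f cd(2)]
  have nz': "f x \<noteq> 0" if "x \<in> {c..d}" for x using nz cd that by auto
  have "continuous_on {c..d} (\<lambda>x. inverse (f x))"
    using has_AC_deriv_continuous_on[OF f' subset_refl] nz' by (intro continuous_on_inverse) auto
  then have "bounded ((\<lambda>x. inverse (f x)) ` {c..d})"
    by (intro compact_imp_bounded compact_continuous_image compact_Icc)
  then obtain B where B: "\<And>x. x \<in> {c..d} \<Longrightarrow> \<bar>inverse (f x)\<bar> \<le> B"
    unfolding bounded_iff by (metis imageI real_norm_def)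
  have "abs_continuous_between (\<lambda>x. inverse (f x)) c d"
  proof (rule AC_dominated[OF has_AC_deriv_imp_AC[OF f'] has_AC_deriv_imp_AC[OF f']])
    fix x y assume xy: "x \<in> {c..d}" "y \<in> {c..d}"
    have B0: "0 \<le> B" using B[OF xy(1)] by linarith
    have "inverse (f y) - inverse (f x) = - (inverse (f y) * (f y - f x) * inverse (f x))"
      using nz' xy by (simp add: inverse_diff_inverse)
    then have "norm (inverse (f y) - inverse (f x)) = \<bar>inverse (f y)\<bar> * \<bar>f y - f x\<bar> * \<bar>inverse (f x)\<bar>"
      by (simp add: abs_mult)
    also have "\<dots> \<le> B * \<bar>f y - f x\<bar> * B"
      using B[OF xy(1)] B[OF xy(2)] B0 by (intro mult_mono) auto
    also have "\<dots> \<le> (B * B) * (norm (f y - f x) + norm (f y - f x))"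
      using B0 by (simp add: algebra_simps)
    finally show "norm (inverse (f y) - inverse (f x)) \<le> (B * B) * (norm (f y - f x) + norm (f y - f x))" .
  qed
  moreover obtain N where N: "negligible N" "\<And>x. \<lbrakk>c < x; x < d; x \<notin> N\<rbrakk> \<Longrightarrow> (f has_vector_derivative \<phi> x) (at x)"
    using has_AC_deriv_imp_vector_derivative[OF f' cd(1)] by metis
  moreover have "((\<lambda>x. inverse (f x)) has_vector_derivative - (\<phi> x / (f x)\<^sup>2)) (at x)"
    if x: "c < x" "x < d" "x \<notin> N" for x
  proof -
    have "(f has_real_derivative \<phi> x) (at x)"
      using N(2)[OF x] by (simp add: has_real_derivative_iff_has_vector_derivative)
    from DERIV_inverse_fun[OF this] have "((\<lambda>x. inverse (f x)) has_real_derivative - (\<phi> x / (f x)\<^sup>2)) (at x)"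
      using nz'[of x] x by (simp add: divide_inverse power2_eq_square)
    then show ?thesis by (simp only: has_real_derivative_iff_has_vector_derivative)
  qed
  ultimately show "has_AC_deriv_on (\<lambda>x. inverse (f x)) (\<lambda>x. - (\<phi> x / (f x)\<^sup>2)) {c..d}"
    using cd(1) by (intro has_AC_deriv_on_AE_derivI[where N = N])
qed

lemma is_interval_Icc_subset:
  "is_interval I \<Longrightarrow> x \<in> I \<Longrightarrow> y \<in> I \<Longrightarrow> {x..y} \<subseteq> (I :: real set)"
  by (meson atLeastAtMost_iff mem_is_interval_1_I subsetI)

lemma has_AC_deriv_on_exists:
  fixes \<phi> :: "real \<Rightarrow> 'a::euclidean_space"
  assumes I: "is_interval I" "x0 \<in> I"
    and \<phi>: "\<And>x y. x \<le> y \<Longrightarrow> {x..y} \<subseteq> I \<Longrightarrow> \<phi> absolutely_integrable_on {x..y}"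
  obtains F where "F x0 = y0" "has_AC_deriv_on F \<phi> I"
proof -
  define F where "F x = y0 + (if x0 \<le> x then integral {x0..x} \<phi> else - integral {x..x0} \<phi>)" for x
  have "F x0 = y0" by (simp add: F_def)
  moreover have "has_AC_deriv_on F \<phi> I"
  proof (rule has_AC_deriv_onI)
    fix x y assume xy: "x \<le> y" "{x..y} \<subseteq> I"
    then show "\<phi> absolutely_integrable_on {x..y}" by (rule \<phi>)
    have inI: "x \<in> I" "y \<in> I" using xy by auto
    have \<phi>': "\<phi> integrable_on {s..t}" if "s \<in> I" "t \<in> I" for s t
    proof (cases "s \<le> t")
      case True
      then show ?thesis
        using \<phi>[OF True is_interval_Icc_subset[OF I(1) that]] set_lebesgue_integral_eq_integral(1) by blast
    qed auto
    consider "x0 \<le> x" | "x < x0" "x0 \<le> y" | "y < x0" by linarith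
    then show "F y - F x = integral {x..y} \<phi>"
    proof cases
      case 1
      then have "integral {x0..x} \<phi> + integral {x..y} \<phi> = integral {x0..y} \<phi>"
        using xy \<phi>' I inI by (intro Henstock_Kurzweil_Integration.integral_combine) auto
      then show ?thesis using 1 xy by (simp add: F_def algebra_simps)
    next
      case 2
      then have "integral {x..x0} \<phi> + integral {x0..y} \<phi> = integral {x..y} \<phi>"
        using xy \<phi>' I inI by (intro Henstock_Kurzweil_Integration.integral_combine) auto
      then show ?thesis using 2 xy by (simp add: F_def algebra_simps)
    next
      case 3
      then have "integral {x..y} \<phi> + integral {y..x0} \<phi> = integral {x..x0} \<phi>"
        using xy \<phi>' I inI by (intro Henstock_Kurzweil_Integration.integral_combine) auto
      then show ?thesis using 3 xy by (simp add: F_def algebra_simps)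
    qed
  qed
  ultimately show thesis by (rule that)
qed

lemma absolutely_integrable_continuous_bilinear:
  fixes mul :: "'a::euclidean_space \<Rightarrow> 'b::euclidean_space \<Rightarrow> 'c::euclidean_space"
  assumes "bounded_bilinear mul" "continuous_on {c..d} f" "\<phi> absolutely_integrable_on {c..d::real}"
  shows "(\<lambda>x. mul (f x) (\<phi> x)) absolutely_integrable_on {c..d}"
proof (rule absolutely_integrable_bounded_measurable_product[where h = mul and f = f and g = \<phi>])
  show "bilinear mul" using assms(1) by (simp add: bilinear_conv_bounded_bilinear)
  show "f \<in> borel_measurable (lebesgue_on {c..d})"
    using assms(2) by (intro continuous_imp_measurable_on_sets_lebesgue) auto
  show "bounded (f ` {c..d})"
    by (intro compact_imp_bounded compact_continuous_image assms compact_Icc)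
qed (use assms in auto)

lemmas absolutely_integrable_continuous_mult =
  absolutely_integrable_continuous_bilinear[OF bounded_bilinear_mult]

section \<open>Linear differential equations with integrable coefficients\<close>

lemma has_AC_deriv_on_power:
  fixes K :: "real \<Rightarrow> real"
  assumes "has_AC_deriv_on K m I"
  shows "has_AC_deriv_on (\<lambda>x. K x ^ Suc n) (\<lambda>x. real (Suc n) * (m x * K x ^ n)) I"
proof (induction n)
  case 0
  then show ?case using assms by simp
next
  case (Suc n)
  have "has_AC_deriv_on (\<lambda>x. K x * K x ^ Suc n)
      (\<lambda>x. K x * (real (Suc n) * (m x * K x ^ n)) + m x * K x ^ Suc n) I"
    by (rule has_AC_deriv_on_mult[OF assms Suc.IH])
  moreover have "K x * (real (Suc n) * (m x * K x ^ n)) + m x * K x ^ Suc n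
      = real (Suc (Suc n)) * (m x * K x ^ Suc n)" for x
    by (simp add: algebra_simps)
  ultimately show ?case by simp
qed

text \<open>The majorants of the Picard iteration: each is obtained from the previous one by
  multiplying with \<open>m\<close> and integrating.\<close>

lemma has_AC_deriv_on_power_fact:
  fixes K :: "real \<Rightarrow> real"
  assumes "has_AC_deriv_on K m I"
  shows "has_AC_deriv_on (\<lambda>x. C * K x ^ Suc n / fact (Suc n)) (\<lambda>x. m x * (C * K x ^ n / fact n)) I"
proof -
  have "has_AC_deriv_on (\<lambda>x. (C / fact (Suc n)) * K x ^ Suc n)
     (\<lambda>x. (C / fact (Suc n)) * (real (Suc n) * (m x * K x ^ n))) I"
    by (rule has_AC_deriv_on_linear[OF bounded_linear_mult_right has_AC_deriv_on_power[OF assms]])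
  then show ?thesis by (rule has_AC_deriv_on_cong_AE) (auto simp: divide_simps)
qed

lemma has_AC_deriv_on_norm_le:
  assumes f: "has_AC_deriv_on f \<phi> I" and g: "has_AC_deriv_on g \<psi> I"
    and xy: "x \<le> y" "{x..y} \<subseteq> I" and le: "\<And>t. t \<in> {x..y} \<Longrightarrow> norm (\<phi> t) \<le> \<psi> t"
  shows "norm (f y - f x) \<le> (g y - g x :: real)"
proof -
  have "norm (integral {x..y} \<phi>) \<le> integral {x..y} \<psi>"
    by (rule integral_norm_bound_integral) (use has_AC_deriv_onD[OF f xy] has_AC_deriv_onD[OF g xy] le in auto)
  then show ?thesis using has_AC_deriv_onD(3)[OF f xy] has_AC_deriv_onD(3)[OF g xy] by simp
qed

text \<open>Picard iteration with time measured by the antiderivative \<open>K\<close> of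
  \<open>m\<close>: successive differences are bounded by the terms of an exponential series in
  \<open>\<bar>K x\<bar>\<close>, so the iterates converge on all of \<open>I\<close> at once and no
  gluing of local solutions is required.\<close>

theorem Caratheodory_linear_ODE:
  fixes G :: "real \<Rightarrow> 'a::euclidean_space \<Rightarrow> 'a" and m :: "real \<Rightarrow> real"
  assumes I: "is_interval I" "x0 \<in> I"
    and diff: "\<And>x y z. G x (y - z) = G x y - G x z"
    and bound: "\<And>x y. norm (G x y) \<le> m x * norm y"
    and m: "\<And>c d. {c..d} \<subseteq> I \<Longrightarrow> m absolutely_integrable_on {c..d}"
    and G: "\<And>c d y. \<lbrakk>{c..d} \<subseteq> I; continuous_on {c..d} y\<rbrakk> \<Longrightarrow> (\<lambda>x. G x (y x)) absolutely_integrable_on {c..d}"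
  obtains Y where "Y x0 = y0" "has_AC_deriv_on Y (\<lambda>x. G x (Y x)) I"
proof -
  let ?cont = "\<lambda>y. \<forall>c d. {c..d} \<subseteq> I \<longrightarrow> continuous_on {c..d} (y :: real \<Rightarrow> 'a)"
  have "\<exists>F. F x0 = y0 \<and> has_AC_deriv_on F (\<lambda>x. G x (y x)) I" if "?cont y" for y
    by (rule has_AC_deriv_on_exists[OF I, of "\<lambda>x. G x (y x)" y0]) (use G that in blast)+
  then obtain P where P: "\<And>y. ?cont y \<Longrightarrow> P y x0 = y0 \<and> has_AC_deriv_on (P y) (\<lambda>x. G x (y x)) I"
    by metis
  define Z where "Z n = (P ^^ n) (\<lambda>x. y0)" for n
  have Z0: "Z 0 x = y0" and ZS: "Z (Suc n) = P (Z n)" for n x by (simp_all add: Z_def)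
  have Zcont: "?cont (Z n)" for n
  proof (induction n)
    case (Suc n)
    then show ?case using P[of "Z n"] has_AC_deriv_continuous_on unfolding ZS by blast
  qed (simp add: Z_def)
  have Zx0: "Z n x0 = y0" for n
    by (cases n) (use P Zcont in \<open>auto simp: Z0 ZS\<close>)
  have ZAC: "has_AC_deriv_on (Z (Suc n)) (\<lambda>x. G x (Z n x)) I" for n
    unfolding ZS using P Zcont by blast
  \<comment> \<open>The bound on \<open>G\<close> at a unit vector forces \<open>m\<close> to be
    nonnegative.\<close>
  have m0: "0 \<le> m x" for x
  proof -
    obtain e :: 'a where e: "norm e = 1" using vector_choose_size[of 1] by auto
    show ?thesis using order_trans[OF norm_ge_zero bound[of x e]] e by simp
  qed
  obtain K where K: "K x0 = 0" "has_AC_deriv_on K m I"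
    using has_AC_deriv_on_exists[OF I, of m 0] m by blast
  have mK: "has_AC_deriv_on (\<lambda>x. - K x) (\<lambda>x. - m x) I" by (rule has_AC_deriv_on_minus[OF K(2)])
  have Kmono: "K x \<le> K y" if "x \<le> y" "x \<in> I" "y \<in> I" for x y
  proof -
    have "norm (0 - (0::real)) \<le> K y - K x"
      by (rule has_AC_deriv_on_norm_le[OF has_AC_deriv_on_const K(2) that(1)])
        (use is_interval_Icc_subset[OF I(1) that(2,3)] m0 in auto)
    then show ?thesis by simp
  qed
  define C where "C = norm y0"
  define D where "D n x = (if n = 0 then y0 else Z n x - Z (n - 1) x)" for n x
  have D0: "D 0 x = y0" and DS: "D (Suc n) x = Z (Suc n) x - Z n x" for n x
    by (simp_all add: D_def)
  have DSf: "D (Suc n) = (\<lambda>x. Z (Suc n) x - Z n x)" for n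
    by (rule ext) (rule DS)
  have DAC: "has_AC_deriv_on (D (Suc n)) (\<lambda>x. G x (D n x)) I" for n
  proof (cases n)
    case 0
    then show ?thesis
      unfolding DSf using has_AC_deriv_on_diff[OF ZAC[of 0] has_AC_deriv_on_const, of y0] by (simp add: D0 Z0)
  next
    case (Suc k)
    then show ?thesis
      unfolding DSf using has_AC_deriv_on_diff[OF ZAC[of "Suc k"] ZAC[of k]] by (simp add: DS diff)
  qed
  have Z_sum: "Z n x = (\<Sum>k<Suc n. D k x)" for n x
    by (induction n) (simp_all add: D0 Z0 DS)
  have D_bound: "norm (D n x) \<le> C * \<bar>K x\<bar> ^ n / fact n" if "x \<in> I" for n x
    using that
  proof (induction n arbitrary: x)
    case 0
    then show ?case by (simp add: D0 C_def)
  next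
    case (Suc n)
    have le: "norm (G t (D n t)) \<le> m t * (C * \<bar>K t\<bar> ^ n / fact n)" if "t \<in> I" for t
      using bound[of t "D n t"] mult_left_mono[OF Suc.IH[OF that] m0[of t]] by linarith
    have Dx0: "D (Suc n) x0 = 0" by (simp add: DS Zx0)
    show ?case
    proof (cases "x0 \<le> x")
      case True
      have sub: "{x0..x} \<subseteq> I" using is_interval_Icc_subset I Suc.prems by blast
      have Kpos: "0 \<le> K t" if "t \<in> {x0..x}" for t using Kmono[of x0 t] K(1) that sub I(2) by auto
      have "norm (D (Suc n) x - D (Suc n) x0) \<le> C * K x ^ Suc n / fact (Suc n) - C * K x0 ^ Suc n / fact (Suc n)"
      proof (rule has_AC_deriv_on_norm_le[OF DAC has_AC_deriv_on_power_fact[OF K(2)] True sub])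
        fix t assume t: "t \<in> {x0..x}"
        then show "norm (G t (D n t)) \<le> m t * (C * K t ^ n / fact n)"
          using le[of t] sub Kpos[OF t] by auto
      qed
      then show ?thesis using Kpos[of x] True by (simp add: Dx0 K(1))
    next
      case False
      have sub: "{x..x0} \<subseteq> I" using is_interval_Icc_subset I Suc.prems by blast
      have Kneg: "K t \<le> 0" if "t \<in> {x..x0}" for t using Kmono[of t x0] K(1) that sub I(2) by auto
      \<comment> \<open>Left of \<open>x0\<close> the function \<open>K\<close> is nonpositive, so
        the majorant is built from powers of \<open>- K\<close>; the outer minus sign makes it
        nondecreasing again.\<close>
      have "norm (D (Suc n) x0 - D (Suc n) x)
          \<le> - (C * (- K x0) ^ Suc n / fact (Suc n)) - - (C * (- K x) ^ Suc n / fact (Suc n))"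
      proof (rule has_AC_deriv_on_norm_le[OF DAC has_AC_deriv_on_minus[OF has_AC_deriv_on_power_fact[OF mK]] _ sub])
        fix t assume t: "t \<in> {x..x0}"
        then show "norm (G t (D n t)) \<le> - (- m t * (C * (- K t) ^ n / fact n))"
          using le[of t] sub Kneg[OF t] by auto
      qed (use False in auto)
      then show ?thesis using Kneg[of x] False by (simp only: Dx0 K(1)) (simp add: abs_of_nonpos)
    qed
  qed
  have sum_exp: "summable (\<lambda>k. C * B ^ k / fact k)" for B :: real
    using summable_mult[OF summable_exp[of B], of C] by (simp add: field_simps)
  have Dsum: "summable (\<lambda>k. D k x)" if "x \<in> I" for x
    by (rule summable_comparison_test'[OF sum_exp, of 0]) (use D_bound[OF that] in auto)
  define Y where "Y x = (\<Sum>k. D k x)" for x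
  have Zlim: "(\<lambda>n. Z n x) \<longlonglongrightarrow> Y x" if "x \<in> I" for x
    unfolding Z_sum Y_def using LIMSEQ_Suc[OF summable_LIMSEQ[OF Dsum[OF that]]] .
  have "Y x0 = y0" using LIMSEQ_unique[OF Zlim[OF I(2)], of y0] Zx0 by simp
  moreover have "has_AC_deriv_on Y (\<lambda>x. G x (Y x)) I"
  proof (rule has_AC_deriv_onI)
    fix x y assume xy: "x \<le> y" "{x..y} \<subseteq> I"
    have "bounded (K ` {x..y})"
      by (intro compact_imp_bounded compact_continuous_image has_AC_deriv_continuous_on[OF K(2)] xy compact_Icc)
    then obtain B where B: "\<And>t. t \<in> {x..y} \<Longrightarrow> \<bar>K t\<bar> \<le> B"
      unfolding bounded_iff by (metis imageI real_norm_def)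
    \<comment> \<open>A bound for all iterates on \<open>{x..y}\<close> simultaneously, so that
      \<open>m t * R\<close> is an integrable majorant for passing to the limit in the integral
      equation.\<close>
    define R where "R = (\<Sum>k. C * B ^ k / fact k)"
    have C0: "0 \<le> C" by (simp add: C_def)
    have B0: "0 \<le> B" using B[of x] xy by auto
    have ZR: "norm (Z n t) \<le> R" if "t \<in> {x..y}" for n t
    proof -
      have "norm (Z n t) \<le> (\<Sum>k<Suc n. norm (D k t))" unfolding Z_sum by (rule norm_sum)
      also have "\<dots> \<le> (\<Sum>k<Suc n. C * B ^ k / fact k)"
      proof (rule sum_mono)
        fix k
        have "norm (D k t) \<le> C * \<bar>K t\<bar> ^ k / fact k" using D_bound xy that by blast
        also have "\<dots> \<le> C * B ^ k / fact k"
          using B[OF that] C0 by (intro divide_right_mono mult_left_mono power_mono) auto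
        finally show "norm (D k t) \<le> C * B ^ k / fact k" .
      qed
      also have "\<dots> \<le> R"
        unfolding R_def by (rule sum_le_suminf[OF sum_exp]) (use B0 C0 in auto)
      finally show ?thesis .
    qed
    have YR: "norm (Y t) \<le> R" if "t \<in> {x..y}" for t
      using Lim_norm_ubound[OF _ Zlim[of t], of R] ZR[OF that] xy that by auto
    have lim: "(\<lambda>n. G t (Z n t)) \<longlonglongrightarrow> G t (Y t)" if "t \<in> {x..y}" for t
    proof -
      have "(\<lambda>n. m t * norm (Z n t - Y t)) \<longlonglongrightarrow> m t * norm (Y t - Y t)"
        using Zlim[of t] that xy by (intro tendsto_intros) auto
      then have lim0: "(\<lambda>n. m t * norm (Z n t - Y t)) \<longlonglongrightarrow> 0" by simp
      have le: "norm (G t (Z n t) - G t (Y t)) \<le> m t * norm (Z n t - Y t)" for n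
        using bound[of t "Z n t - Y t"] by (simp add: diff)
      have "(\<lambda>n. G t (Z n t) - G t (Y t)) \<longlonglongrightarrow> 0"
        by (rule Lim_null_comparison[OF always_eventually lim0]) (rule allI, rule le)
      then show ?thesis by (rule LIM_zero_cancel)
    qed
    have GZ: "(\<lambda>t. G t (Z n t)) absolutely_integrable_on {x..y}" for n
      using G xy(2) Zcont by blast
    have h: "(\<lambda>t. m t * R) integrable_on {x..y}"
      using set_lebesgue_integral_eq_integral(1)[OF m[OF xy(2)]] by (rule integrable_on_mult_left)
    have le: "norm (G t z) \<le> m t * R" if "norm z \<le> R" for t z
      using bound[of t z] mult_left_mono[OF that m0[of t]] by linarith
    show "(\<lambda>t. G t (Y t)) absolutely_integrable_on {x..y}"
      by (rule dominated_convergence_absolutely_integrable[OF GZ h _ lim]) (use le YR in auto)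
    have "(\<lambda>n. integral {x..y} (\<lambda>t. G t (Z n t))) \<longlonglongrightarrow> integral {x..y} (\<lambda>t. G t (Y t))"
      by (rule dominated_convergence(2)[OF set_lebesgue_integral_eq_integral(1)[OF GZ] h _ lim])
        (use le ZR in auto)
    then have "(\<lambda>n. Z (Suc n) y - Z (Suc n) x) \<longlonglongrightarrow> integral {x..y} (\<lambda>t. G t (Y t))"
      unfolding has_AC_deriv_onD(3)[OF ZAC xy] .
    moreover have "(\<lambda>n. Z (Suc n) y - Z (Suc n) x) \<longlonglongrightarrow> Y y - Y x"
      using xy by (intro tendsto_diff LIMSEQ_Suc Zlim) auto
    ultimately show "Y y - Y x = integral {x..y} (\<lambda>t. G t (Y t))"
      by (rule LIMSEQ_unique[symmetric])
  qed
  ultimately show thesis by (rule that)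
qed

section \<open>Symmetric operators on subspaces of finite codimension\<close>

text \<open>Only a semi-inner product: elements will be representatives of square-integrable
  functions, and a nonzero function that vanishes almost everywhere has
  \<open>B x x = 0\<close>.\<close>

locale semi_inner_product =
  fixes V :: "'v::real_vector set" and B :: "'v \<Rightarrow> 'v \<Rightarrow> real"
  assumes subspace_V: "subspace V"
    and B_sym: "\<lbrakk>x \<in> V; y \<in> V\<rbrakk> \<Longrightarrow> B x y = B y x"
    and B_add: "\<lbrakk>x \<in> V; y \<in> V; z \<in> V\<rbrakk> \<Longrightarrow> B (x + y) z = B x z + B y z"
    and B_scale: "\<lbrakk>x \<in> V; z \<in> V\<rbrakk> \<Longrightarrow> B (c *\<^sub>R x) z = c * B x z"
    and B_nonneg: "x \<in> V \<Longrightarrow> 0 \<le> B x x"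
begin

lemma V_closed:
  "0 \<in> V" "x \<in> V \<Longrightarrow> y \<in> V \<Longrightarrow> x + y \<in> V" "x \<in> V \<Longrightarrow> c *\<^sub>R x \<in> V" "x \<in> V \<Longrightarrow> y \<in> V \<Longrightarrow> x - y \<in> V"
  using subspace_V by (auto simp: subspace_0 subspace_add subspace_scale subspace_diff)

lemma B_diff: "\<lbrakk>x \<in> V; y \<in> V; z \<in> V\<rbrakk> \<Longrightarrow> B (x - y) z = B x z - B y z"
  using B_add[of "x - y" y z] V_closed by simp

lemma B_right:
  "\<lbrakk>x \<in> V; y \<in> V; z \<in> V\<rbrakk> \<Longrightarrow> B z (x + y) = B z x + B z y"
  "\<lbrakk>x \<in> V; y \<in> V; z \<in> V\<rbrakk> \<Longrightarrow> B z (x - y) = B z x - B z y"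
  "\<lbrakk>x \<in> V; z \<in> V\<rbrakk> \<Longrightarrow> B z (c *\<^sub>R x) = c * B z x"
  using B_add B_diff B_scale B_sym V_closed by simp_all

definition snorm :: "'v \<Rightarrow> real" where "snorm x = sqrt (B x x)"

lemma snorm_nonneg: "x \<in> V \<Longrightarrow> 0 \<le> snorm x"
  using B_nonneg by (simp add: snorm_def)

lemma snorm_sq: "x \<in> V \<Longrightarrow> (snorm x)\<^sup>2 = B x x"
  using B_nonneg by (simp add: snorm_def)

lemma snorm_scale: "x \<in> V \<Longrightarrow> snorm (c *\<^sub>R x) = \<bar>c\<bar> * snorm x"
  by (simp add: snorm_def B_scale B_right V_closed real_sqrt_mult flip: mult.assoc power2_eq_square)

lemma Cauchy_Schwarz: assumes "x \<in> V" "y \<in> V" shows "\<bar>B x y\<bar> \<le> snorm x * snorm y"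
proof -
  have poly: "0 \<le> B x x + 2 * t * B x y + t\<^sup>2 * B y y" for t
  proof -
    have "0 \<le> B (x + t *\<^sub>R y) (x + t *\<^sub>R y)" using assms V_closed by (intro B_nonneg) auto
    also have "\<dots> = B x x + 2 * t * B x y + t\<^sup>2 * B y y"
      using assms V_closed by (simp add: B_add B_right B_scale B_sym[of y x] power2_eq_square algebra_simps)
    finally show ?thesis .
  qed
  have "(B x y)\<^sup>2 \<le> B x x * B y y"
  proof (cases "B y y = 0")
    case True
    have "B x y = 0"
    proof (rule ccontr)
      assume "B x y \<noteq> 0"
      \<comment> \<open>At this value of \<open>t\<close> the polynomial, linear because
        \<open>B y y = 0\<close>, equals -1.\<close>
      then have "2 * (- (B x x + 1) / (2 * B x y)) * B x y = - (B x x + 1)" by simp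
      then show False using poly[of "- (B x x + 1) / (2 * B x y)"] True by simp
    qed
    then show ?thesis using True by simp
  next
    case False
    then have pos: "B y y > 0" using B_nonneg[OF assms(2)] by simp
    have "0 \<le> B x x - (B x y)\<^sup>2 / B y y"
      using poly[of "- B x y / B y y"] pos by (simp add: power2_eq_square field_simps)
    then show ?thesis using pos by (simp add: field_simps)
  qed
  then have "sqrt ((B x y)\<^sup>2) \<le> sqrt (B x x * B y y)" by (rule real_sqrt_le_mono)
  then show ?thesis by (simp add: snorm_def real_sqrt_mult)
qed

lemma snorm_triangle: assumes "x \<in> V" "y \<in> V" shows "snorm (x + y) \<le> snorm x + snorm y"
proof (rule power2_le_imp_le)
  have "(snorm (x + y))\<^sup>2 = B x x + 2 * B x y + B y y"
    using assms V_closed by (simp add: snorm_sq B_add B_right B_sym[of y x])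
  also have "\<dots> \<le> B x x + 2 * (snorm x * snorm y) + B y y"
    using Cauchy_Schwarz[OF assms] by linarith
  also have "\<dots> = (snorm x + snorm y)\<^sup>2" using assms by (simp add: snorm_sq power2_sum)
  finally show "(snorm (x + y))\<^sup>2 \<le> (snorm x + snorm y)\<^sup>2" .
qed (use assms snorm_nonneg in simp)

lemma snorm_minus: "x \<in> V \<Longrightarrow> y \<in> V \<Longrightarrow> snorm (x - y) = snorm (y - x)"
  using snorm_scale[of "y - x" "-1"] V_closed by simp

lemma snorm_diff_triangle:
  assumes "x \<in> V" "y \<in> V" "z \<in> V" shows "snorm (x - z) \<le> snorm (x - y) + snorm (y - z)"
  using snorm_triangle[of "x - y" "y - z"] assms V_closed by simp

definition scl :: "'v set \<Rightarrow> 'v set"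
  where "scl X = {z \<in> V. \<forall>\<epsilon>>0. \<exists>x\<in>X. snorm (z - x) < \<epsilon>}"

lemma sclE:
  assumes "z \<in> scl X" "\<epsilon> > 0" obtains x where "x \<in> X" "snorm (z - x) < \<epsilon>"
  using assms by (auto simp: scl_def)

lemma subspace_scl: assumes X: "subspace X" "X \<subseteq> V" shows "subspace (scl X)"
  unfolding subspace_def
proof (intro conjI ballI allI)
  have "snorm 0 = 0" using snorm_scale[OF V_closed(1), of 0] by simp
  then show "0 \<in> scl X" unfolding scl_def using V_closed(1) subspace_0[OF X(1)] by force
next
  fix z w assume zw: "z \<in> scl X" "w \<in> scl X"
  then have V: "z \<in> V" "w \<in> V" by (auto simp: scl_def)
  show "z + w \<in> scl X"
    unfolding scl_def
  proof (intro CollectI conjI allI impI)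
    fix \<epsilon> :: real assume "\<epsilon> > 0"
    then obtain x y where xy: "x \<in> X" "y \<in> X" "snorm (z - x) < \<epsilon>/2" "snorm (w - y) < \<epsilon>/2"
      using zw by (metis sclE half_gt_zero)
    then have xyV: "x \<in> V" "y \<in> V" using X by auto
    have "snorm ((z - x) + (w - y)) \<le> snorm (z - x) + snorm (w - y)"
      using V xyV V_closed by (intro snorm_triangle) auto
    then have "snorm (z + w - (x + y)) < \<epsilon>" using xy by (simp add: algebra_simps)
    then show "\<exists>x\<in>X. snorm (z + w - x) < \<epsilon>" using xy subspace_add[OF X(1)] by blast
  qed (use V V_closed in auto)
next
  fix c :: real and z assume z: "z \<in> scl X"
  then have V: "z \<in> V" by (auto simp: scl_def)
  show "c *\<^sub>R z \<in> scl X"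
    unfolding scl_def
  proof (intro CollectI conjI allI impI)
    fix \<epsilon> :: real assume "\<epsilon> > 0"
    then have "\<epsilon> / (\<bar>c\<bar> + 1) > 0" by (simp add: add_pos_nonneg)
    then obtain x where x: "x \<in> X" "snorm (z - x) < \<epsilon> / (\<bar>c\<bar> + 1)"
      using z sclE by blast
    have xV: "x \<in> V" using x X by auto
    have "snorm (c *\<^sub>R z - c *\<^sub>R x) = \<bar>c\<bar> * snorm (z - x)"
      using snorm_scale[of "z - x" c] V xV V_closed by (simp add: scaleR_diff_right)
    also have "\<dots> \<le> (\<bar>c\<bar> + 1) * snorm (z - x)"
      using snorm_nonneg[of "z - x"] V xV V_closed by (intro mult_right_mono) auto
    also have "\<dots> < \<epsilon>" using x(2) by (simp add: field_simps pos_less_divide_eq add_pos_nonneg)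
    finally have "snorm (c *\<^sub>R z - c *\<^sub>R x) < \<epsilon>" .
    then show "\<exists>x\<in>X. snorm (c *\<^sub>R z - x) < \<epsilon>" using x subspace_scale[OF X(1)] by blast
  qed (use V V_closed in auto)
qed

text \<open>The functional is bounded on \<open>X\<close>, because otherwise its kernel would be dense in \<open>X\<close>;
  hence it extends to the closure of \<open>X\<close>.\<close>

lemma scl_kernel_codim:
  assumes X: "subspace X" "X \<subseteq> V"
    and add: "\<And>x y. \<lbrakk>x \<in> X; y \<in> X\<rbrakk> \<Longrightarrow> \<phi> (x + y) = \<phi> x + \<phi> y"
    and scale: "\<And>c x. x \<in> X \<Longrightarrow> \<phi> (c *\<^sub>R x) = c * \<phi> x"
    and Y: "Y = {x \<in> X. \<phi> x = (0::real)}"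
    and z0: "z0 \<in> scl X" "z0 \<notin> scl Y" and z: "z \<in> scl X"
  obtains \<alpha> where "z - \<alpha> *\<^sub>R z0 \<in> scl Y"
proof -
  have YX: "Y \<subseteq> X" "Y \<subseteq> V" using X by (auto simp: Y)
  have Xd: "x - y \<in> X" "c *\<^sub>R x \<in> X" if "x \<in> X" "y \<in> X" for x y c
    using that X by (auto simp: subspace_diff subspace_scale)
  have \<phi>d: "\<phi> (x - c *\<^sub>R y) = \<phi> x - c * \<phi> y" if "x \<in> X" "y \<in> X" for x y c
    using add[of x "(-c) *\<^sub>R y"] scale[of y "-c"] that Xd(2)[of y y "-c"] by simp
  have "subspace Y"
    unfolding subspace_def Y using X add scale scale[of 0 0]
    by (auto simp: subspace_0 subspace_add subspace_scale)
  then have clY: "subspace (scl Y)" using YX by (intro subspace_scl)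
  have V: "z0 \<in> V" "z \<in> V" using z0 z by (auto simp: scl_def)
  \<comment> \<open>The existence of \<open>z0\<close> is what rules out a dense kernel: it lies at
    positive distance from \<open>Y\<close>, and so does a nearby \<open>x0\<close> in
    \<open>X\<close>.\<close>
  obtain \<delta> where \<delta>: "\<delta> > 0" "\<And>y. y \<in> Y \<Longrightarrow> \<delta> \<le> snorm (z0 - y)"
    using z0(2) V by (force simp: scl_def not_less)
  obtain x0 where x0: "x0 \<in> X" "snorm (z0 - x0) < \<delta>/2"
    using z0(1) \<delta>(1) by (metis sclE half_gt_zero)
  have x0V: "x0 \<in> V" using x0 X by auto
  have far: "\<delta>/2 \<le> snorm (x0 - y)" if "y \<in> Y" for y
  proof -
    have "snorm (z0 - y) \<le> snorm (z0 - x0) + snorm (x0 - y)"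
      using V x0V YX that by (intro snorm_diff_triangle) auto
    then show ?thesis using \<delta>(2)[OF that] x0 by linarith
  qed
  have "x0 \<notin> Y"
  proof
    assume "x0 \<in> Y"
    then have "\<delta> \<le> snorm (z0 - x0)" by (rule \<delta>(2))
    then show False using x0 \<delta>(1) by linarith
  qed
  then have \<phi>x0: "\<phi> x0 \<noteq> 0" using x0 by (simp add: Y)
  define a where "a x = \<phi> x / \<phi> x0" for x
  have inY: "x - a x *\<^sub>R x0 \<in> Y" if "x \<in> X" for x
    using that x0 Xd \<phi>x0 by (simp add: Y \<phi>d a_def)
  have a_diff: "a (x - y) = a x - a y" if "x \<in> X" "y \<in> X" for x y
    using \<phi>d[OF that, of 1] by (simp add: a_def diff_divide_distrib)
  have a_bound: "\<bar>a x\<bar> \<le> (2/\<delta>) * snorm x" if "x \<in> X" for x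
  proof (cases "a x = 0")
    case True
    then show ?thesis using \<delta>(1) snorm_nonneg X that by auto
  next
    case False
    have xV: "x \<in> V" using that X by auto
    \<comment> \<open>This vector lies in the kernel, hence at distance at least
      \<open>\<delta>/2\<close> from \<open>x0\<close>; that is exactly a bound for the functional
      \<open>a\<close>.\<close>
    have "x0 - (1 / a x) *\<^sub>R x \<in> Y"
      using that x0 Xd False \<phi>x0 by (simp add: Y \<phi>d a_def)
    then have "\<delta>/2 \<le> snorm (x0 - (x0 - (1 / a x) *\<^sub>R x))" by (rule far)
    also have "\<dots> = \<bar>1 / a x\<bar> * snorm x" using snorm_scale[OF xV] by simp
    finally show ?thesis using False \<delta>(1) by (simp add: field_simps)
  qed
  have ext: "\<exists>\<beta>. w - \<beta> *\<^sub>R x0 \<in> scl Y" if w: "w \<in> scl X" for w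
  proof -
    have wV: "w \<in> V" using w by (simp add: scl_def)
    have "\<exists>x\<in>X. snorm (w - x) < inverse (real (Suc n))" for n
      using w by (simp add: scl_def)
    then obtain x where x: "\<And>n. x n \<in> X" "\<And>n. snorm (w - x n) < inverse (real (Suc n))" by metis
    have xV: "x n \<in> V" for n using x X by auto
    have "Cauchy (\<lambda>n. a (x n))"
    proof (rule metric_CauchyI)
      fix e :: real assume "e > 0"
      then obtain N where N: "inverse (real (Suc N)) < e * \<delta> / 4"
        using reals_Archimedean[of "e * \<delta> / 4"] \<delta>(1) by auto
      have near: "snorm (w - x n) < e * \<delta> / 4" if "n \<ge> N" for n
      proof -
        have "inverse (real (Suc n)) \<le> inverse (real (Suc N))" using that by (intro le_imp_inverse_le) auto
        then show ?thesis using x(2)[of n] N by linarith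
      qed
      have "dist (a (x m)) (a (x n)) < e" if "m \<ge> N" "n \<ge> N" for m n
      proof -
        have "dist (a (x m)) (a (x n)) = \<bar>a (x m - x n)\<bar>" using x by (simp add: a_diff dist_real_def)
        also have "\<dots> \<le> (2/\<delta>) * snorm (x m - x n)" using x Xd by (intro a_bound) auto
        also have "\<dots> \<le> (2/\<delta>) * (snorm (w - x m) + snorm (w - x n))"
          using snorm_diff_triangle[OF xV wV xV, of m n] snorm_minus[OF xV wV, of m] \<delta>(1)
          by (intro mult_left_mono) auto
        also have "\<dots> < (2/\<delta>) * (e * \<delta> / 4 + e * \<delta> / 4)"
          using near that \<delta>(1) by (intro mult_strict_left_mono add_strict_mono) auto
        also have "\<dots> = e" using \<delta>(1) by simp
        finally show ?thesis .
      qed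
      then show "\<exists>N. \<forall>m\<ge>N. \<forall>n\<ge>N. dist (a (x m)) (a (x n)) < e" by blast
    qed
    then obtain \<beta> where \<beta>: "(\<lambda>n. a (x n)) \<longlonglongrightarrow> \<beta>" using Cauchy_convergent_iff convergentD by blast
    have "w - \<beta> *\<^sub>R x0 \<in> scl Y"
      unfolding scl_def
    proof (intro CollectI conjI allI impI)
      fix \<epsilon> :: real assume "\<epsilon> > 0"
      have "(\<lambda>n. inverse (real (Suc n)) + \<bar>\<beta> - a (x n)\<bar> * snorm x0) \<longlonglongrightarrow> 0 + \<bar>\<beta> - \<beta>\<bar> * snorm x0"
        by (intro tendsto_intros LIMSEQ_inverse_real_of_nat \<beta>)
      then have "eventually (\<lambda>n. inverse (real (Suc n)) + \<bar>\<beta> - a (x n)\<bar> * snorm x0 < \<epsilon>) sequentially"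
        using \<open>\<epsilon> > 0\<close> by (intro order_tendstoD(2)[where y = "0 + \<bar>\<beta> - \<beta>\<bar> * snorm x0"]) auto
      then obtain n where n: "inverse (real (Suc n)) + \<bar>\<beta> - a (x n)\<bar> * snorm x0 < \<epsilon>"
        by (meson eventually_happens' sequentially_bot)
      define c where "c = a (x n) - \<beta>"
      have "(w - \<beta> *\<^sub>R x0) - (x n - a (x n) *\<^sub>R x0) = (w - x n) + c *\<^sub>R x0"
        by (simp add: c_def algebra_simps)
      then have "snorm ((w - \<beta> *\<^sub>R x0) - (x n - a (x n) *\<^sub>R x0)) = snorm ((w - x n) + c *\<^sub>R x0)"
        by (rule arg_cong)
      also have "\<dots> \<le> snorm (w - x n) + snorm (c *\<^sub>R x0)"
        using wV xV x0V V_closed by (intro snorm_triangle) auto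
      also have "\<dots> < \<epsilon>"
        using x(2)[of n] n snorm_scale[OF x0V, of c] by (simp add: c_def abs_minus_commute)
      finally show "\<exists>y\<in>Y. snorm (w - \<beta> *\<^sub>R x0 - y) < \<epsilon>" using inY[OF x(1)] by blast
    qed (use wV x0V V_closed in auto)
    then show ?thesis ..
  qed
  obtain \<beta>0 where \<beta>0: "z0 - \<beta>0 *\<^sub>R x0 \<in> scl Y" using ext[OF z0(1)] ..
  obtain \<beta> where \<beta>: "z - \<beta> *\<^sub>R x0 \<in> scl Y" using ext[OF z] ..
  have "\<beta>0 \<noteq> 0" using \<beta>0 z0(2) by auto
  \<comment> \<open>Modulo \<open>scl Y\<close>, both \<open>z\<close> and \<open>z0\<close> are
    multiples of \<open>x0\<close>; eliminating \<open>x0\<close> leaves \<open>z\<close> as a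
    multiple of \<open>z0\<close>.\<close>
  have "(z - \<beta> *\<^sub>R x0) - (\<beta> / \<beta>0) *\<^sub>R (z0 - \<beta>0 *\<^sub>R x0) \<in> scl Y"
    by (rule subspace_diff[OF clY \<beta> subspace_scale[OF clY \<beta>0]])
  moreover have "(z - \<beta> *\<^sub>R x0) - (\<beta> / \<beta>0) *\<^sub>R (z0 - \<beta>0 *\<^sub>R x0) = z - (\<beta> / \<beta>0) *\<^sub>R z0"
    using \<open>\<beta>0 \<noteq> 0\<close> by (simp add: algebra_simps)
  ultimately show thesis using that by simp
qed

section \<open>Lower bounds along finite codimension\<close>

definition form_bounded_below :: "('v \<times> 'v) set \<Rightarrow> bool"
  where "form_bounded_below T \<longleftrightarrow> (\<exists>\<gamma>. \<forall>(f, g)\<in>T. \<gamma> * B f f \<le> B f g)"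

definition symmetric_operator :: "('v \<times> 'v) set \<Rightarrow> bool"
  where "symmetric_operator S \<longleftrightarrow> subspace S \<and> S \<subseteq> V \<times> V \<and>
    (\<forall>(f, g)\<in>S. \<forall>(u, v)\<in>S. B f v = B g u)"

text \<open>A minimizing sequence \<open>x\<^sub>n\<close> in a fixed coset of \<open>T\<close>, with quadratic form values below
  \<open>- n \<parallel>x\<^sub>n\<parallel>\<^sup>2\<close>, would tend to zero; but the form is nonnegative at all differences
  \<open>x\<^sub>n - x\<^sub>0\<close>, and letting \<open>n\<close> tend to infinity makes it nonnegative at \<open>x\<^sub>0\<close>.\<close>

lemma form_bounded_below_codim_1:
  assumes S: "symmetric_operator S" and T: "T \<subseteq> S" "subspace T" "form_bounded_below T"
    and codim: "\<And>d0 d. \<lbrakk>d0 \<in> S; d0 \<notin> T; d \<in> S\<rbrakk> \<Longrightarrow> \<exists>\<alpha>. d - \<alpha> *\<^sub>R d0 \<in> T"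
  shows "form_bounded_below S"
proof (rule ccontr)
  assume unbounded: "\<not> form_bounded_below S"
  have subS: "subspace S" and SV: "S \<subseteq> V \<times> V"
    and sym: "\<And>f g u v. (f, g) \<in> S \<Longrightarrow> (u, v) \<in> S \<Longrightarrow> B f v = B g u"
    using S by (auto simp: symmetric_operator_def)
  obtain \<gamma>' where \<gamma>': "\<And>f g. (f, g) \<in> T \<Longrightarrow> \<gamma>' * B f f \<le> B f g"
    using T(3) by (auto simp: form_bounded_below_def)
  \<comment> \<open>Raising the form by \<open>\<bar>\<gamma>'\<bar>\<close> times the squared norm
    makes it nonnegative on \<open>T\<close>; \<open>b\<close> denotes the raised form.\<close>
  define \<gamma> where "\<gamma> = \<bar>\<gamma>'\<bar>"
  define b where "b e = B (fst e) (snd e) + \<gamma> * B (fst e) (fst e)" for e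
  have bT: "0 \<le> b e" if "e \<in> T" for e
  proof -
    have "fst e \<in> V" using that T(1) SV by auto
    then have "0 \<le> B (fst e) (fst e)" by (rule B_nonneg)
    then have "- \<gamma> * B (fst e) (fst e) \<le> \<gamma>' * B (fst e) (fst e)"
      by (intro mult_right_mono) (auto simp: \<gamma>_def)
    then show ?thesis using \<gamma>'[of "fst e" "snd e"] that by (simp add: b_def)
  qed
  have ex: "\<exists>e\<in>S. b e < - real n * B (fst e) (fst e)" for n
  proof -
    have "\<not> (\<forall>(f, g)\<in>S. (- (real n + \<gamma>)) * B f f \<le> B f g)"
      using unbounded unfolding form_bounded_below_def by blast
    then obtain f g where "(f, g) \<in> S" "\<not> (- (real n + \<gamma>)) * B f f \<le> B f g" by blast
    then show ?thesis by (intro bexI[of _ "(f, g)"]) (simp_all add: b_def algebra_simps)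
  qed
  then obtain w where w: "\<And>n. w n \<in> S" "\<And>n. b (w n) < - real n * B (fst (w n)) (fst (w n))" by metis
  have wT: "w n \<notin> T" for n
  proof
    assume "w n \<in> T"
    have "fst (w n) \<in> V" using w(1)[of n] SV by auto
    then have "0 \<le> real n * B (fst (w n)) (fst (w n))" using B_nonneg by simp
    then show False using w(2)[of n] bT[OF \<open>w n \<in> T\<close>] by linarith
  qed
  have "\<exists>e\<in>S. b e < - real n * B (fst e) (fst e) \<and> w 0 - e \<in> T" for n
  proof -
    \<comment> \<open>Both sides of the inequality for \<open>w n\<close> are homogeneous of degree
      two, so \<open>w n\<close> may be rescaled into the coset of \<open>w 0\<close> modulo
      \<open>T\<close>. The factor is nonzero as \<open>w 0\<close> is not in
      \<open>T\<close>.\<close>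
    obtain \<alpha> where \<alpha>: "w 0 - \<alpha> *\<^sub>R w n \<in> T" using codim w(1) wT by blast
    have "\<alpha> \<noteq> 0" using \<alpha> wT by auto
    have V: "fst (w n) \<in> V" "snd (w n) \<in> V" using w(1)[of n] SV by auto
    have "b (\<alpha> *\<^sub>R w n) = \<alpha>\<^sup>2 * b (w n)"
      using V V_closed by (simp add: b_def B_scale B_right power2_eq_square algebra_simps)
    also have "\<dots> < \<alpha>\<^sup>2 * (- real n * B (fst (w n)) (fst (w n)))"
      using w(2) \<open>\<alpha> \<noteq> 0\<close> by (intro mult_strict_left_mono) auto
    also have "\<dots> = - real n * B (fst (\<alpha> *\<^sub>R w n)) (fst (\<alpha> *\<^sub>R w n))"
      using V V_closed by (simp add: B_scale B_right power2_eq_square)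
    finally show ?thesis using \<alpha> w(1) subS by (meson subspace_scale)
  qed
  then obtain e where e: "\<And>n. e n \<in> S" "\<And>n. b (e n) < - real n * B (fst (e n)) (fst (e n))"
    "\<And>n. w 0 - e n \<in> T" by metis
  define x where "x n = fst (e n)" for n
  define y where "y n = snd (e n)" for n
  have V: "x n \<in> V" "y n \<in> V" for n using e(1)[of n] SV by (auto simp: x_def y_def)
  have xy: "(x n, y n) \<in> S" for n using e(1) by (simp add: x_def y_def)
  define L where "L = snorm (y 0 + \<gamma> *\<^sub>R x 0)"
  define b0 where "b0 = b (e 0)"
  have b0: "b0 < 0" using e(2)[of 0] by (simp add: b0_def)
  have L0: "0 \<le> L" unfolding L_def using V V_closed by (intro snorm_nonneg) auto
  \<comment> \<open>Nonnegativity of \<open>b\<close> at the difference \<open>e n - e 0\<close>: by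
    symmetry the mixed terms combine into a pairing of \<open>x n\<close> with a fixed vector of
    seminorm \<open>L\<close>.\<close>
  have key: "0 \<le> b (e n) + b0 + 2 * L * snorm (x n)" for n
  proof -
    have "(w 0 - e 0) - (w 0 - e n) \<in> T" by (rule subspace_diff[OF T(2) e(3) e(3)])
    then have "e n - e 0 \<in> T" by simp
    then have "0 \<le> b (e n - e 0)" by (rule bT)
    also have "\<dots> = B (x n - x 0) (y n - y 0) + \<gamma> * B (x n - x 0) (x n - x 0)"
      by (simp add: b_def x_def y_def)
    also have "\<dots> = b (e n) + b0 - 2 * B (x n) (y 0 + \<gamma> *\<^sub>R x 0)"
    proof -
      have "B (x n - x 0) (y n - y 0) = B (x n) (y n) - B (x n) (y 0) - (B (x 0) (y n) - B (x 0) (y 0))"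
        using V V_closed by (simp add: B_diff B_right)
      moreover have "B (x 0) (y n) = B (x n) (y 0)"
        using sym[OF xy[of n] xy[of 0]] B_sym[OF V(1)[of 0] V(2)[of n]] by simp
      moreover have "B (x n - x 0) (x n - x 0) = B (x n) (x n) - B (x n) (x 0) - (B (x n) (x 0) - B (x 0) (x 0))"
        using V V_closed B_sym[OF V(1)[of 0] V(1)[of n]] by (simp add: B_diff B_right)
      moreover have "B (x n) (y 0 + \<gamma> *\<^sub>R x 0) = B (x n) (y 0) + \<gamma> * B (x n) (x 0)"
        using V V_closed by (simp add: B_right)
      moreover have "b (e n) = B (x n) (y n) + \<gamma> * B (x n) (x n)" "b0 = B (x 0) (y 0) + \<gamma> * B (x 0) (x 0)"
        by (simp_all add: b_def b0_def x_def y_def)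
      ultimately show ?thesis by (simp only:) (simp add: algebra_simps)
    qed
    finally have "0 \<le> b (e n) + b0 - 2 * B (x n) (y 0 + \<gamma> *\<^sub>R x 0)" .
    moreover have "\<bar>B (x n) (y 0 + \<gamma> *\<^sub>R x 0)\<bar> \<le> snorm (x n) * L"
      unfolding L_def using V V_closed by (intro Cauchy_Schwarz) auto
    ultimately show ?thesis
      unfolding mult.assoc mult.commute[of "snorm (x n)" L] abs_le_iff by linarith
  qed
  \<comment> \<open>With \<open>t = snorm (x n)\<close>, \<open>key\<close> gives both
    \<open>n t^2 <= 2 L t\<close>, hence \<open>(n - 1) t^2 <= L^2\<close>, and
    \<open>- b0 <= 2 L t\<close>. Together \<open>(n - 1) b0^2 <= 4 L^4\<close>, which this choice
    of \<open>n\<close> violates.\<close>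
  obtain n :: nat where n: "1 + 4 * L\<^sup>2 * L\<^sup>2 / b0\<^sup>2 < real n" using reals_Archimedean2 by blast
  define t where "t = snorm (x n)"
  have t0: "0 \<le> t" unfolding t_def using V(1) by (rule snorm_nonneg)
  have nt: "b (e n) < - real n * t\<^sup>2"
    unfolding t_def using e(2)[of n] V by (simp add: snorm_sq x_def[symmetric])
  have "real n * t\<^sup>2 \<le> 2 * L * t" using key[of n] nt b0 by (simp add: t_def)
  moreover have "2 * L * t \<le> L\<^sup>2 + t\<^sup>2" using zero_le_power2[of "L - t"] by (simp add: power2_diff)
  ultimately have tL: "(real n - 1) * t\<^sup>2 \<le> L\<^sup>2" by (simp add: algebra_simps)
  have n1: "real n - 1 > 4 * L\<^sup>2 * L\<^sup>2 / b0\<^sup>2" "0 \<le> 4 * L\<^sup>2 * L\<^sup>2 / b0\<^sup>2" using n by auto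
  have "0 < - b0" "b (e n) \<le> 0" using b0 nt by (auto intro: order_trans[OF less_imp_le])
  then have "- b0 \<le> 2 * L * t" using key[of n] by (simp add: t_def)
  then have "(- b0)\<^sup>2 \<le> (2 * L * t)\<^sup>2" using b0 by (intro power_mono) auto
  then have "b0\<^sup>2 \<le> 4 * L\<^sup>2 * t\<^sup>2" by (simp add: power_mult_distrib)
  then have "(real n - 1) * b0\<^sup>2 \<le> (real n - 1) * (4 * L\<^sup>2 * t\<^sup>2)"
    by (rule mult_left_mono) (use n1 in linarith)
  also have "\<dots> = 4 * L\<^sup>2 * ((real n - 1) * t\<^sup>2)" by (simp add: algebra_simps)
  also have "\<dots> \<le> 4 * L\<^sup>2 * L\<^sup>2" using tL by (intro mult_left_mono) auto
  finally show False using n1(1) b0 by (simp add: pos_divide_less_eq)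
qed

definition shifted_preimage :: "real \<Rightarrow> ('v \<times> 'v) set \<Rightarrow> 'v set \<Rightarrow> ('v \<times> 'v) set"
  where "shifted_preimage l S X = {(f, g) \<in> S. g - l *\<^sub>R f \<in> scl X}"

lemma shifted_preimage_iff:
  "e \<in> shifted_preimage l S X \<longleftrightarrow> e \<in> S \<and> snd e - l *\<^sub>R fst e \<in> scl X"
  by (cases e) (auto simp: shifted_preimage_def)

lemma subspace_shifted_preimage:
  assumes "subspace S" "subspace X" "X \<subseteq> V"
  shows "subspace (shifted_preimage l S X)"
proof -
  have "linear (\<lambda>d :: 'v \<times> 'v. snd d - l *\<^sub>R fst d)" by (rule linearI) (simp_all add: algebra_simps)
  then have "subspace (S \<inter> (\<lambda>d. snd d - l *\<^sub>R fst d) -` scl X)"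
    using assms by (intro subspace_inter linear_subspace_vimage subspace_scl)
  moreover have "shifted_preimage l S X = S \<inter> (\<lambda>d. snd d - l *\<^sub>R fst d) -` scl X"
    by (auto simp: shifted_preimage_def)
  ultimately show ?thesis by simp
qed

text \<open>\<open>solve\<close> says that \<open>S - l\<close> is onto the common kernel of the
  functionals, with preimages on which it is at least 1. The bound is established on the preimage of
  the closure of that kernel and survives the release of one functional after another.\<close>

theorem symmetric_bounded_below:
  assumes S: "symmetric_operator S" and X: "subspace X" "X \<subseteq> V" "V \<subseteq> scl X"
    and lin: "\<And>\<phi> x y. \<lbrakk>\<phi> \<in> set \<Phi>; x \<in> X; y \<in> X\<rbrakk> \<Longrightarrow> \<phi> (x + y) = \<phi> x + \<phi> y"
      "\<And>\<phi> c x. \<lbrakk>\<phi> \<in> set \<Phi>; x \<in> X\<rbrakk> \<Longrightarrow> \<phi> (c *\<^sub>R x) = c * \<phi> x"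
    and solve: "\<And>v. \<lbrakk>v \<in> X; \<And>\<phi>. \<phi> \<in> set \<Phi> \<Longrightarrow> \<phi> v = (0::real)\<rbrakk>
      \<Longrightarrow> \<exists>h. (h, v + l *\<^sub>R h) \<in> S \<and> B h h \<le> B h v"
  shows "form_bounded_below S"
proof -
  have subS: "subspace S" and SV: "S \<subseteq> V \<times> V"
    and sym: "\<And>f g u v. (f, g) \<in> S \<Longrightarrow> (u, v) \<in> S \<Longrightarrow> B f v = B g u"
    using S by (auto simp: symmetric_operator_def)
  define K where "K \<Psi> = {x \<in> X. \<forall>\<phi>\<in>set \<Psi>. \<phi> x = 0}" for \<Psi> :: "('v \<Rightarrow> real) list"
  have KX: "K \<Psi> \<subseteq> V" for \<Psi> using X by (auto simp: K_def)
  have subK: "subspace (K \<Psi>)" if "set \<Psi> \<subseteq> set \<Phi>" for \<Psi>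
  proof -
    have "\<phi> 0 = 0" if "\<phi> \<in> set \<Psi>" for \<phi>
      using lin(2)[of \<phi> 0 0] that \<open>set \<Psi> \<subseteq> set \<Phi>\<close> subspace_0[OF X(1)] by auto
    moreover have "\<phi> (x + y) = \<phi> x + \<phi> y" if "\<phi> \<in> set \<Psi>" "x \<in> X" "y \<in> X" for \<phi> x y
      using that lin(1) \<open>set \<Psi> \<subseteq> set \<Phi>\<close> by blast
    moreover have "\<phi> (c *\<^sub>R x) = c * \<phi> x" if "\<phi> \<in> set \<Psi>" "x \<in> X" for \<phi> x c
      using that lin(2) \<open>set \<Psi> \<subseteq> set \<Phi>\<close> by blast
    ultimately have \<Psi>: "\<phi> 0 = 0" "\<lbrakk>x \<in> X; y \<in> X; \<phi> x = 0; \<phi> y = 0\<rbrakk> \<Longrightarrow> \<phi> (x + y) = 0"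
      "\<lbrakk>x \<in> X; \<phi> x = 0\<rbrakk> \<Longrightarrow> \<phi> (c *\<^sub>R x) = 0" if "\<phi> \<in> set \<Psi>" for \<phi> x y c
      using that by (metis add_0 mult_zero_right)+
    show ?thesis
      unfolding K_def
      by (rule subspaceI) (use \<Psi> X(1) in \<open>blast intro: subspace_0 subspace_add subspace_scale\<close>)+
  qed
  have base: "form_bounded_below (shifted_preimage l S (K \<Phi>))"
    unfolding form_bounded_below_def
  proof (intro exI[of _ l] ballI, clarify)
    fix f g assume fg: "(f, g) \<in> shifted_preimage l S (K \<Phi>)"
    define z where "z = g - l *\<^sub>R f"
    have fgS: "(f, g) \<in> S" and z: "z \<in> scl (K \<Phi>)" using fg by (auto simp: shifted_preimage_def z_def)
    have V: "f \<in> V" "g \<in> V" "z \<in> V" using fgS SV z by (auto simp: scl_def)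
    \<comment> \<open>Let \<open>v\<close> approximate \<open>z = (S - l) f\<close> and let
      \<open>(S - l) h = v\<close>. Symmetry moves the operator across:
      \<open>B f v = B z h\<close>, which is \<open>B h v\<close> up to \<open>B (z - v) h\<close>.
      Here \<open>B h v\<close> is nonnegative, and \<open>B h h \<le> B h v\<close> gives
      \<open>snorm h \<le> snorm v\<close>, so the error stays of order
      \<open>\<epsilon>\<close>.\<close>
    have "- (snorm f + (snorm z + 1)) * \<epsilon> \<le> B f z" if "0 < \<epsilon>" "\<epsilon> \<le> 1" for \<epsilon>
    proof -
      obtain v where v: "v \<in> K \<Phi>" "snorm (z - v) < \<epsilon>" using z \<open>0 < \<epsilon>\<close> by (rule sclE)
      then obtain h where h: "(h, v + l *\<^sub>R h) \<in> S" "B h h \<le> B h v"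
        using solve[of v] by (auto simp: K_def)
      have "v \<in> V" "h \<in> V" using v(1) h(1) SV KX by blast+
      then have V': "v \<in> V" "h \<in> V" "z - v \<in> V" using V V_closed by auto
      have "snorm v \<le> snorm z + 1"
        using snorm_diff_triangle[of v z 0] snorm_minus[of v z] V V' V_closed v(2) \<open>\<epsilon> \<le> 1\<close> by simp
      moreover have "snorm h \<le> snorm v"
      proof (cases "snorm h = 0")
        case False
        have "snorm h * snorm h \<le> snorm h * snorm v"
          using h(2) Cauchy_Schwarz[of h v] V' by (simp flip: power2_eq_square add: snorm_sq)
        then show ?thesis using False snorm_nonneg[OF V'(2)] by simp
      qed (use snorm_nonneg V' in simp)
      ultimately have "snorm h \<le> snorm z + 1" by linarith
      then have e1: "snorm (z - v) * snorm h \<le> \<epsilon> * (snorm z + 1)"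
        using v(2) snorm_nonneg V' \<open>0 < \<epsilon>\<close> by (intro mult_mono) auto
      have e2: "snorm f * snorm (z - v) \<le> snorm f * \<epsilon>"
        using v(2) snorm_nonneg[OF V(1)] by (intro mult_left_mono) auto
      have "B f (v + l *\<^sub>R h) = B g h" by (rule sym[OF fgS h(1)])
      then have "B f v = B z h" using V V' V_closed by (simp add: z_def B_right B_diff B_scale)
      moreover have "B z h = B h v + B (z - v) h"
        using V V' B_sym[of h v] by (simp add: B_diff)
      moreover have "0 \<le> B h v" using B_nonneg[OF V'(2)] h(2) by linarith
      moreover have "\<bar>B (z - v) h\<bar> \<le> snorm (z - v) * snorm h" "\<bar>B f (z - v)\<bar> \<le> snorm f * snorm (z - v)"
        using V V' by (auto intro: Cauchy_Schwarz)
      moreover have "B f z = B f v + B f (z - v)" using V V' by (simp add: B_right)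
      ultimately show ?thesis using e1 e2 by (simp add: algebra_simps abs_le_iff)
    qed
    then have lim: "- (snorm f + (snorm z + 1)) * inverse (real (Suc n)) \<le> B f z" for n
      by (simp add: inverse_le_1_iff)
    have "(\<lambda>n. - (snorm f + (snorm z + 1)) * inverse (real (Suc n))) \<longlonglongrightarrow> - (snorm f + (snorm z + 1)) * 0"
      by (intro tendsto_intros LIMSEQ_inverse_real_of_nat)
    then have "- (snorm f + (snorm z + 1)) * 0 \<le> B f z"
      by (rule LIMSEQ_le_const2) (use lim in auto)
    then have "0 \<le> B f z" by simp
    then show "l * B f f \<le> B f g" using V V_closed by (simp add: z_def B_right)
  qed
  have "form_bounded_below (shifted_preimage l S (K []))"
  proof -
    \<comment> \<open>Releasing one functional enlarges the closure, and with it the preimage under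
      \<open>S - l\<close>, by at most one dimension.\<close>
    have "form_bounded_below (shifted_preimage l S (K (drop n \<Phi>)))" for n
    proof (induction n)
      case (Suc n)
      show ?case
      proof (cases "n < length \<Phi>")
        case False
        then show ?thesis using Suc by simp
      next
        case True
        define \<phi> where "\<phi> = \<Phi> ! n"
        have dr: "drop n \<Phi> = \<phi> # drop (Suc n) \<Phi>" using True by (simp add: \<phi>_def Cons_nth_drop_Suc)
        have \<phi>: "\<phi> \<in> set \<Phi>" using True by (simp add: \<phi>_def)
        let ?X = "K (drop (Suc n) \<Phi>)" and ?Y = "K (drop n \<Phi>)"
        have Y: "?Y = {x \<in> ?X. \<phi> x = 0}" by (auto simp: K_def dr)
        have sub: "subspace ?X" "subspace ?Y" by (auto intro!: subK dest: in_set_dropD)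
        have XX: "?X \<subseteq> X" by (auto simp: K_def)
        have "scl ?Y \<subseteq> scl ?X" unfolding Y scl_def by blast
        show ?thesis
        proof (rule form_bounded_below_codim_1)
          show "symmetric_operator (shifted_preimage l S ?X)"
            using S subspace_shifted_preimage[OF subS sub(1) KX]
            unfolding symmetric_operator_def by (auto simp: shifted_preimage_def)
          show "shifted_preimage l S ?Y \<subseteq> shifted_preimage l S ?X"
            using \<open>scl ?Y \<subseteq> scl ?X\<close> by (auto simp: shifted_preimage_def)
          show "subspace (shifted_preimage l S ?Y)"
            by (rule subspace_shifted_preimage[OF subS sub(2) KX])
          show "form_bounded_below (shifted_preimage l S ?Y)" by (rule Suc)
        next
          fix d0 d assume d0: "d0 \<in> shifted_preimage l S ?X" "d0 \<notin> shifted_preimage l S ?Y"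
            and d: "d \<in> shifted_preimage l S ?X"
          define z0 where "z0 = snd d0 - l *\<^sub>R fst d0"
          define z where "z = snd d - l *\<^sub>R fst d"
          have z0: "z0 \<in> scl ?X" "z0 \<notin> scl ?Y" "z \<in> scl ?X" "d0 \<in> S" "d \<in> S"
            using d0 d by (auto simp: shifted_preimage_def z0_def z_def)
          obtain \<alpha> where "z - \<alpha> *\<^sub>R z0 \<in> scl ?Y"
          proof (rule scl_kernel_codim[OF sub(1) KX _ _ Y z0(1-3)])
            show "\<phi> (x + y) = \<phi> x + \<phi> y" if "x \<in> ?X" "y \<in> ?X" for x y
              using lin(1)[OF \<phi>] that XX by blast
            show "\<phi> (c *\<^sub>R x) = c * \<phi> x" if "x \<in> ?X" for x c
              using lin(2)[OF \<phi>] that XX by blast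
          qed
          moreover have "z - \<alpha> *\<^sub>R z0 = snd (d - \<alpha> *\<^sub>R d0) - l *\<^sub>R fst (d - \<alpha> *\<^sub>R d0)"
            by (simp add: z_def z0_def algebra_simps)
          moreover have "d - \<alpha> *\<^sub>R d0 \<in> S" using z0(4,5) subS by (intro subspace_diff subspace_scale)
          ultimately show "\<exists>\<alpha>. d - \<alpha> *\<^sub>R d0 \<in> shifted_preimage l S ?Y"
            unfolding shifted_preimage_iff by metis
        qed
      qed
    qed (simp add: base)
    from this[of "length \<Phi>"] show ?thesis by simp
  qed
  \<comment> \<open>With all functionals released the target is the closure of \<open>X\<close>,
    which is all of \<open>V\<close>.\<close>
  moreover have "shifted_preimage l S (K []) = S"
  proof -
    have "K [] = X" by (simp add: K_def)
    moreover have "snd e - l *\<^sub>R fst e \<in> scl X" if "e \<in> S" for e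
    proof -
      have "fst e \<in> V" "snd e \<in> V" using subsetD[OF SV that] by (simp_all add: mem_Times_iff)
      then show ?thesis by (intro subsetD[OF X(3)] V_closed)
    qed
    ultimately show ?thesis by (auto simp: shifted_preimage_iff)
  qed
  ultimately show ?thesis by simp
qed

end

section \<open>Lower bounds for the quadratic form\<close>

lemma integral_le_AE:
  fixes f g :: "real \<Rightarrow> real"
  assumes "f integrable_on S" "g integrable_on S" "AE x in lebesgue. x \<in> S \<longrightarrow> f x \<le> g x"
  shows "integral S f \<le> integral S g"
proof -
  obtain N where N: "negligible N" "\<And>x. x \<in> S \<Longrightarrow> x \<notin> N \<Longrightarrow> f x \<le> g x"
    using assms(3) unfolding eventually_ae_filter_negligible by blast
  define k where "k x = (if x \<in> N then g x else f x)" for x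
  have "k integrable_on S" by (rule integrable_spike[OF assms(1) N(1)]) (auto simp: k_def)
  then have "integral S k \<le> integral S g"
    by (rule integral_le[OF _ assms(2)]) (use N in \<open>auto simp: k_def\<close>)
  moreover have "integral S k = integral S f" by (rule integral_spike[OF N(1)]) (auto simp: k_def)
  ultimately show ?thesis by simp
qed

lemma absolutely_integrable_max_0:
  "f absolutely_integrable_on S \<Longrightarrow> S \<in> sets lebesgue \<Longrightarrow> (\<lambda>x. max 0 (f x :: real)) absolutely_integrable_on (S :: real set)"
  by (rule absolutely_integrable_max_1) auto

lemma integral_positive:
  fixes f :: "real \<Rightarrow> real"
  assumes f: "f absolutely_integrable_on {c..d}" and "c < d" and pos: "\<And>x. x \<in> {c..d} \<Longrightarrow> 0 < f x"
  shows "0 < integral {c..d} f"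
proof -
  have int: "integrable lebesgue (\<lambda>x. indicat_real {c..d} x *\<^sub>R f x)"
    using f by (simp add: set_integrable_def)
  have nonneg: "0 \<le> indicat_real {c..d} x *\<^sub>R f x" for x
    using pos[of x] by (auto simp: indicator_def)
  have eq: "integral {c..d} f = integral\<^sup>L lebesgue (\<lambda>x. indicat_real {c..d} x *\<^sub>R f x)"
    using set_lebesgue_integral_eq_integral(2)[OF f] by (simp add: set_lebesgue_integral_def)
  have "integral {c..d} f \<noteq> 0"
  proof
    assume "integral {c..d} f = 0"
    then have "AE x in lebesgue. indicat_real {c..d} x *\<^sub>R f x = 0"
      using integral_nonneg_eq_0_iff_AE[OF int] nonneg eq by simp
    then have "AE x in lebesgue. x \<notin> {c..d}"
      by eventually_elim (use pos in \<open>force simp: indicator_def\<close>)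
    then obtain N where "negligible N" "{x. \<not> x \<notin> {c..d}} \<subseteq> N"
      unfolding eventually_ae_filter_negligible by blast
    moreover have "{x. \<not> x \<notin> {c..d}} = {c..d}" by auto
    ultimately have "negligible {c..d}" by (metis negligible_subset)
    then show False using \<open>c < d\<close> by (simp add: negligible_interval(1)[of c d, unfolded box_real])
  qed
  moreover have "0 \<le> integral {c..d} f"
    unfolding eq by (rule integral_nonneg_AE) (use nonneg in simp)
  ultimately show ?thesis by linarith
qed

locale sturm_liouville_pos = sturm_liouville +
  assumes p_pos: "AE x in lebesgue_on (einterval a b). p x > 0"

context sturm_liouville
begin

abbreviation "I \<equiv> einterval a b"

lemma open_I: "open I" by simp

lemma interval_I: "is_interval I"
  unfolding is_interval_1
proof (intro ballI allI impI)
  fix u w x assume "u \<in> I" "w \<in> I" "u \<le> x \<and> x \<le> w"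
  then have "a < ereal u" "ereal u \<le> ereal x" "ereal x \<le> ereal w" "ereal w < b"
    by (simp_all add: einterval_iff)
  then show "x \<in> I" unfolding einterval_iff by (metis order.strict_trans1 order.strict_trans2)
qed

lemma lebesgue_I: "I \<in> sets lebesgue" by (simp add: borel_open)

lemma AE_I_iff: "(AE x in lebesgue_on I. P x) \<longleftrightarrow> (AE x in lebesgue. x \<in> I \<longrightarrow> P x)"
  using lebesgue_I by (intro AE_restrict_space_iff) simp

lemma coefficients_integrable:
  assumes "{x..y} \<subseteq> I"
  shows "(\<lambda>t. inverse (p t)) absolutely_integrable_on {x..y}" "q absolutely_integrable_on {x..y}"
    "r absolutely_integrable_on {x..y}" "s absolutely_integrable_on {x..y}"
  using locally_integrable assms compact_Icc unfolding locally_integrable_on_def by blast+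

lemma Icc_subset_I: "x \<in> I \<Longrightarrow> y \<in> I \<Longrightarrow> {x..y} \<subseteq> I"
  by (rule is_interval_Icc_subset[OF interval_I])

text \<open>A positive function \<open>u\<close> enters the estimate of the quadratic form only through
  the logarithmic quasi-derivative \<open>v = u\<^sup>[\<^sup>1\<^sup>] / u\<close>; a Riccati inequality for \<open>v\<close> suffices.\<close>

definition riccati_sub :: "real \<Rightarrow> (real \<Rightarrow> real) \<Rightarrow> real \<Rightarrow> real \<Rightarrow> bool"
  where "riccati_sub l v c d \<longleftrightarrow> (\<exists>\<phi>. has_AC_deriv_on v \<phi> {c..d} \<and>
    (AE t in lebesgue. t \<in> {c..d} \<longrightarrow> \<phi> t \<le> q t + 2 * s t * v t - (v t)\<^sup>2 / p t - l * r t))"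

text \<open>\<open>h1\<close> plays the quasi-derivative: the relation
  \<open>h1 = p (h' + s h)\<close> is solved for \<open>h'\<close>. Continuity of \<open>h1\<close>
  already makes the quadratic form integrable.\<close>

definition form_pair :: "(real \<Rightarrow> real) \<Rightarrow> (real \<Rightarrow> real) \<Rightarrow> real \<Rightarrow> real \<Rightarrow> bool"
  where "form_pair h h1 x y \<longleftrightarrow>
    has_AC_deriv_on h (\<lambda>t. h1 t / p t - s t * h t) {x..y} \<and> continuous_on {x..y} h1"

lemma form_pair_subset: "form_pair h h1 x y \<Longrightarrow> x \<le> x' \<Longrightarrow> y' \<le> y \<Longrightarrow> form_pair h h1 x' y'"
  unfolding form_pair_def by (auto elim!: has_AC_deriv_on_subset continuous_on_subset)

lemma form_integrable:
  assumes h: "form_pair h h1 x y" and sub: "{x..y} \<subseteq> I"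
  shows "(\<lambda>t. (h1 t)\<^sup>2 / p t + q t * (h t)\<^sup>2) absolutely_integrable_on {x..y}" (is ?P)
    and "(\<lambda>t. r t * (h t)\<^sup>2) absolutely_integrable_on {x..y}" (is ?R)
proof -
  have c: "continuous_on {x..y} h1" "continuous_on {x..y} h"
    using h has_AC_deriv_continuous_on unfolding form_pair_def by blast+
  have "(\<lambda>t. (h1 t)\<^sup>2 * inverse (p t)) absolutely_integrable_on {x..y}"
    "(\<lambda>t. (h t)\<^sup>2 * q t) absolutely_integrable_on {x..y}"
    "(\<lambda>t. (h t)\<^sup>2 * r t) absolutely_integrable_on {x..y}"
    using c coefficients_integrable[OF sub]
    by (auto intro!: absolutely_integrable_continuous_mult continuous_intros)
  then show ?P ?R by (auto simp: divide_inverse mult.commute intro: set_integral_add)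
qed

end

context sturm_liouville_pos
begin

lemma riccati_bound:
  assumes v: "riccati_sub l v x y" and h: "form_pair h h1 x y" and xy: "x \<le> y" "{x..y} \<subseteq> I"
  shows "l * integral {x..y} (\<lambda>t. r t * (h t)\<^sup>2) + (h y)\<^sup>2 * v y - (h x)\<^sup>2 * v x
    \<le> integral {x..y} (\<lambda>t. (h1 t)\<^sup>2 / p t + q t * (h t)\<^sup>2)"
proof -
  obtain \<phi> where \<phi>: "has_AC_deriv_on v \<phi> {x..y}"
    and le: "AE t in lebesgue. t \<in> {x..y} \<longrightarrow> \<phi> t \<le> q t + 2 * s t * v t - (v t)\<^sup>2 / p t - l * r t"
    using v unfolding riccati_sub_def by blast
  let ?h' = "\<lambda>t. h1 t / p t - s t * h t"
  have h': "has_AC_deriv_on h ?h' {x..y}" using h by (simp add: form_pair_def)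
  \<comment> \<open>The derivative of \<open>h^2 v\<close>. After the Riccati inequality is inserted
    the terms with \<open>s\<close> cancel, and what separates it from the form density minus
    \<open>l r h^2\<close> is at least \<open>(h1 - v h)^2 / p\<close>, nonnegative because
    \<open>p > 0\<close>.\<close>
  let ?D = "\<lambda>t. (h t * h t) * \<phi> t + (h t * ?h' t + ?h' t * h t) * v t"
  have D: "has_AC_deriv_on (\<lambda>t. (h t * h t) * v t) ?D {x..y}"
    by (intro has_AC_deriv_on_mult h' \<phi>)
  note fi = form_integrable[OF h xy(2)]
  have fi': "(\<lambda>t. (h1 t)\<^sup>2 / p t + q t * (h t)\<^sup>2) integrable_on {x..y}"
      "(\<lambda>t. l * (r t * (h t)\<^sup>2)) integrable_on {x..y}"
    using fi[THEN set_lebesgue_integral_eq_integral(1)] by (auto intro: integrable_on_mult_right)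
  have pos: "AE t in lebesgue. t \<in> {x..y} \<longrightarrow> p t > 0"
    using p_pos[unfolded AE_I_iff] xy(2) by (auto elim!: eventually_mono)
  have "integral {x..y} ?D \<le> integral {x..y} (\<lambda>t. ((h1 t)\<^sup>2 / p t + q t * (h t)\<^sup>2) - l * (r t * (h t)\<^sup>2))"
  proof (rule integral_le_AE)
    show "?D integrable_on {x..y}" using has_AC_deriv_onD(2)[OF D xy(1)] by simp
    show "(\<lambda>t. ((h1 t)\<^sup>2 / p t + q t * (h t)\<^sup>2) - l * (r t * (h t)\<^sup>2)) integrable_on {x..y}"
      using fi' by (rule integrable_diff)
    show "AE t in lebesgue. t \<in> {x..y} \<longrightarrow> ?D t \<le> ((h1 t)\<^sup>2 / p t + q t * (h t)\<^sup>2) - l * (r t * (h t)\<^sup>2)"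
      using le pos
    proof eventually_elim
      case (elim t)
      show ?case
      proof
        assume t: "t \<in> {x..y}"
        have "(h t)\<^sup>2 * \<phi> t \<le> (h t)\<^sup>2 * (q t + 2 * s t * v t - (v t)\<^sup>2 / p t - l * r t)"
          using elim t by (intro mult_left_mono) auto
        moreover have "0 \<le> (h1 t - v t * h t)\<^sup>2 / p t" using elim t by (intro divide_nonneg_pos) auto
        moreover have "(h1 t - v t * h t)\<^sup>2 / p t
            = (h1 t)\<^sup>2 / p t - 2 * (h t * (h1 t / p t) * v t) + (h t)\<^sup>2 * ((v t)\<^sup>2 / p t)"
          by (simp add: power2_eq_square field_simps add_divide_distrib diff_divide_distrib)
        ultimately show "?D t \<le> ((h1 t)\<^sup>2 / p t + q t * (h t)\<^sup>2) - l * (r t * (h t)\<^sup>2)"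
          by (simp add: power2_eq_square algebra_simps)
      qed
    qed
  qed
  also have "\<dots> = integral {x..y} (\<lambda>t. (h1 t)\<^sup>2 / p t + q t * (h t)\<^sup>2) - l * integral {x..y} (\<lambda>t. r t * (h t)\<^sup>2)"
    using fi' by (simp add: Henstock_Kurzweil_Integration.integral_diff)
  finally show ?thesis
    using has_AC_deriv_onD(3)[OF D xy(1)] by (simp add: power2_eq_square)
qed

text \<open>On a compact interval, \<open>v' = - (\<Phi> - n r)\<^sup>+ + \<eta> r\<close> with \<open>\<Phi> = |q| + 2 |s| M + M\<^sup>2 / p\<close> satisfies
  the Riccati inequality as long as \<open>|v| \<le> M\<close>. The first term is small in the mean for large \<open>n\<close>
  since \<open>r > 0\<close>, and \<open>\<eta>\<close> is chosen to reach the required value at the right end point.\<close>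

lemma riccati_connect:
  assumes cd: "c < d" "{c..d} \<subseteq> I"
  obtains l v where "riccati_sub l v c d" "v c = \<kappa>1" "\<kappa>2 \<le> v d"
proof -
  \<comment> \<open>On \<open>{c..d}\<close> this alters \<open>r\<close> only on a null set;
    positivity at every point makes \<open>\<Psi> n t\<close> vanish for large \<open>n\<close> at
    each \<open>t\<close>.\<close>
  define r' where "r' t = (if 0 < r t then r t else 1)" for t
  note int = coefficients_integrable[OF cd(2)]
  have AEr: "AE t in lebesgue. t \<in> {c..d} \<longrightarrow> 0 < r t"
    using r_pos[unfolded AE_I_iff] cd(2) by (auto elim!: eventually_mono)
  then obtain N where N: "negligible N" "\<And>t. t \<in> {c..d} \<Longrightarrow> t \<notin> N \<Longrightarrow> 0 < r t"
    unfolding eventually_ae_filter_negligible by blast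
  have r': "r' absolutely_integrable_on {c..d}"
    by (rule absolutely_integrable_spike[OF int(3) N(1)]) (use N(2) in \<open>auto simp: r'_def\<close>)
  have r'_pos: "0 < r' t" for t by (simp add: r'_def)
  define R where "R = integral {c..d} r'"
  have R: "0 < R" unfolding R_def by (rule integral_positive[OF r' cd(1)]) (rule r'_pos)
  \<comment> \<open>A priori bound for \<open>v = \<kappa>1 - v1 + \<eta> v2\<close>:
    \<open>v1\<close> stays in \<open>[0, 1]\<close> and \<open>\<eta> v2\<close> in
    \<open>[0, \<bar>\<kappa>2 - \<kappa>1\<bar> + 1]\<close>. It is independent of
    \<open>n\<close>, so \<open>\<Phi>\<close> can be fixed before \<open>n\<close> is
    chosen.\<close>
  define M where "M = \<bar>\<kappa>1\<bar> + \<bar>\<kappa>2 - \<kappa>1\<bar> + 2"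
  define \<Phi> where "\<Phi> t = \<bar>q t\<bar> + 2 * M * \<bar>s t\<bar> + M\<^sup>2 * inverse (p t)" for t
  have \<Phi>: "\<Phi> absolutely_integrable_on {c..d}"
    unfolding \<Phi>_def using int
    by (intro set_integral_add(1) set_integrable_mult_right set_integrable_abs) auto
  define \<Psi> where "\<Psi> n t = max 0 (\<Phi> t - real n * r' t)" for n t
  have \<Psi>: "\<Psi> n absolutely_integrable_on {c..d}" for n
    unfolding \<Psi>_def using \<Phi> r'
    by (intro absolutely_integrable_max_0 set_integral_diff(1) set_integrable_mult_right) auto
  note HK = set_lebesgue_integral_eq_integral(1)
  have "(\<lambda>n. integral {c..d} (\<Psi> n)) \<longlonglongrightarrow> integral {c..d} (\<lambda>t. 0)"
  proof (rule dominated_convergence(2)[OF HK[OF \<Psi>]])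
    show "(\<lambda>t. \<bar>\<Phi> t\<bar>) integrable_on {c..d}" using \<Phi> by (intro HK set_integrable_abs)
    show "norm (\<Psi> n t) \<le> \<bar>\<Phi> t\<bar>" for n t
    proof -
      have "0 \<le> real n * r' t" using r'_pos[of t] by simp
      then show ?thesis by (simp add: \<Psi>_def)
    qed
    fix t
    have "eventually (\<lambda>n. \<Psi> n t = 0) sequentially"
      using eventually_ge_at_top[of "nat \<lceil>\<Phi> t / r' t\<rceil>"]
    proof eventually_elim
      case (elim n)
      then have "\<Phi> t / r' t \<le> real n" by linarith
      then show ?case using r'_pos[of t] by (simp add: \<Psi>_def pos_divide_le_eq)
    qed
    then show "(\<lambda>n. \<Psi> n t) \<longlonglongrightarrow> 0" by (rule tendsto_eventually)
  qed
  then have "eventually (\<lambda>n. integral {c..d} (\<Psi> n) < 1) sequentially"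
    by (intro order_tendstoD(2)[where y = "integral {c..d} (\<lambda>t. 0)"]) auto
  then obtain n where n: "integral {c..d} (\<Psi> n) < 1" by (meson eventually_happens' sequentially_bot)
  \<comment> \<open>The extra 1 pays for the possible loss of \<open>v1 d\<close>, so that
    \<open>v d\<close> still reaches \<open>\<kappa>2\<close>.\<close>
  define \<eta> where "\<eta> = (\<bar>\<kappa>2 - \<kappa>1\<bar> + 1) / R"
  have \<eta>: "0 < \<eta>" "\<eta> * R = \<bar>\<kappa>2 - \<kappa>1\<bar> + 1"
    using R by (simp_all add: \<eta>_def add_nonneg_pos)
  have sub_int: "f absolutely_integrable_on {x..y}"
    if "f absolutely_integrable_on {c..d}" "{x..y} \<subseteq> {c..d}" for f :: "real \<Rightarrow> real" and x y
    by (rule set_integrable_subset[OF that(1) _ that(2)]) simp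
  obtain v1 where v1: "v1 c = 0" "has_AC_deriv_on v1 (\<Psi> n) {c..d}"
    by (rule has_AC_deriv_on_exists[of "{c..d}" c "\<Psi> n" 0])
      (use cd \<Psi> sub_int in \<open>auto simp: is_interval_cc\<close>)
  obtain v2 where v2: "v2 c = 0" "has_AC_deriv_on v2 r' {c..d}"
    by (rule has_AC_deriv_on_exists[of "{c..d}" c r' 0])
      (use cd r' sub_int in \<open>auto simp: is_interval_cc\<close>)
  define v where "v t = \<kappa>1 - v1 t + \<eta> * v2 t" for t
  have v: "has_AC_deriv_on v (\<lambda>t. 0 - \<Psi> n t + \<eta> * r' t) {c..d}"
    unfolding v_def
    by (intro has_AC_deriv_on_add has_AC_deriv_on_diff has_AC_deriv_on_const v1 v2
        has_AC_deriv_on_linear[OF bounded_linear_mult_right])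
  have ends: "0 \<le> f t - f c" "f t - f c \<le> integral {c..d} g"
    if "has_AC_deriv_on f g {c..d}" "\<And>t. 0 \<le> g t" "t \<in> {c..d}" for f g :: "real \<Rightarrow> real" and t
  proof -
    have sub: "{c..t} \<subseteq> {c..d}" "c \<le> t" using that(3) by auto
    note 1 = has_AC_deriv_onD[OF that(1) sub(2,1)] and 2 = has_AC_deriv_onD[OF that(1) less_imp_le[OF cd(1)] subset_refl]
    show "0 \<le> f t - f c" using 1 that(2) by (metis Henstock_Kurzweil_Integration.integral_nonneg)
    have "integral {c..t} g \<le> integral {c..d} g"
      by (rule integral_subset_le[OF sub(1) 1(2) 2(2)]) (simp add: that(2))
    then show "f t - f c \<le> integral {c..d} g" using 1(3) by simp
  qed
  have \<Psi>0: "0 \<le> \<Psi> n t" for t by (simp add: \<Psi>_def)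
  have v1b: "0 \<le> v1 t" "v1 t \<le> 1" if "t \<in> {c..d}" for t
    using ends[OF v1(2) \<Psi>0 that] n v1(1) by auto
  have v2b: "0 \<le> v2 t" "v2 t \<le> R" if "t \<in> {c..d}" for t
    using ends[OF v2(2) less_imp_le[OF r'_pos] that] v2(1) by (auto simp: R_def)
  have vM: "\<bar>v t\<bar> \<le> M" if t: "t \<in> {c..d}" for t
  proof -
    have "0 \<le> \<eta> * v2 t" "\<eta> * v2 t \<le> \<eta> * R" using v2b[OF t] \<eta>(1) by (auto intro: mult_left_mono)
    then show ?thesis using v1b[OF t] \<eta>(2) by (simp add: v_def M_def)
  qed
  have "v2 d = R" using has_AC_deriv_onD(3)[OF v2(2) less_imp_le[OF cd(1)] subset_refl] v2(1) by (simp add: R_def)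
  then have vd: "\<kappa>2 \<le> v d" using v1b[of d] cd(1) \<eta>(2) by (simp add: v_def)
  have AEp: "AE t in lebesgue. t \<in> {c..d} \<longrightarrow> 0 < p t"
    using p_pos[unfolded AE_I_iff] cd(2) by (auto elim!: eventually_mono)
  have "riccati_sub (- (real n + \<eta>)) v c d"
    unfolding riccati_sub_def
  proof (rule exI, rule conjI)
    show "has_AC_deriv_on v (\<lambda>t. 0 - \<Psi> n t + \<eta> * r' t) {c..d}" by (rule v)
    show "AE t in lebesgue. t \<in> {c..d} \<longrightarrow>
      0 - \<Psi> n t + \<eta> * r' t \<le> q t + 2 * s t * v t - (v t)\<^sup>2 / p t - - (real n + \<eta>) * r t"
      using AEp AEr
    proof eventually_elim
      case (elim t)
      show ?case
      proof
        assume t: "t \<in> {c..d}"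
        have r'r: "r' t = r t" using elim t by (simp add: r'_def)
        have "\<bar>s t * v t\<bar> \<le> M * \<bar>s t\<bar>"
          using mult_right_mono[OF vM[OF t], of "\<bar>s t\<bar>"] by (simp add: abs_mult mult.commute)
        then have "- (2 * M * \<bar>s t\<bar>) \<le> 2 * s t * v t" by (simp add: abs_le_iff)
        moreover have "(v t)\<^sup>2 \<le> M\<^sup>2" using power_mono[OF vM[OF t], of 2] by simp
        then have "(v t)\<^sup>2 / p t \<le> M\<^sup>2 * inverse (p t)"
          using elim t by (simp add: divide_inverse mult_right_mono)
        moreover have "- \<bar>q t\<bar> \<le> q t" by simp
        ultimately have "- \<Phi> t \<le> q t + 2 * s t * v t - (v t)\<^sup>2 / p t" by (simp add: \<Phi>_def)
        moreover have "- \<Psi> n t \<le> - \<Phi> t + real n * r t" by (simp add: \<Psi>_def r'r)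
        ultimately show "0 - \<Psi> n t + \<eta> * r' t \<le> q t + 2 * s t * v t - (v t)\<^sup>2 / p t - - (real n + \<eta>) * r t"
          by (simp add: r'r algebra_simps)
      qed
    qed
  qed
  moreover have "v c = \<kappa>1" by (simp add: v_def v1 v2)
  ultimately show thesis using vd by (rule that)
qed

text \<open>Adding the bounds over \<open>{x..c}\<close>, \<open>{c..d}\<close> and
  \<open>{d..y}\<close>, the boundary terms vanish at \<open>x\<close> and \<open>y\<close>, cancel
  at \<open>c\<close> because the Riccati functions agree there, and have the right sign at
  \<open>d\<close> because the middle one ends at or above \<open>vb d\<close>.\<close>

lemma form_lower_bound:
  assumes c: "c < d" "{c..d} \<subseteq> I"
    and left: "\<And>x. x \<in> I \<Longrightarrow> riccati_sub la va x c"
    and right: "\<And>y. y \<in> I \<Longrightarrow> riccati_sub lb vb d y"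
  obtains \<gamma> where "\<And>h h1 x y. \<lbrakk>x \<in> I; y \<in> I; x \<le> c; d \<le> y; form_pair h h1 x y; h x = 0; h y = 0\<rbrakk> \<Longrightarrow>
    \<gamma> * integral {x..y} (\<lambda>t. r t * (h t)\<^sup>2) \<le> integral {x..y} (\<lambda>t. (h1 t)\<^sup>2 / p t + q t * (h t)\<^sup>2)"
proof -
  obtain lm vm where vm: "riccati_sub lm vm c d" "vm c = va c" "vb d \<le> vm d"
    by (rule riccati_connect[OF c])
  \<comment> \<open>The weighted integral of \<open>h^2\<close> is nonnegative on each piece, so
    each of the three parameters may be lowered to the minimum.\<close>
  define \<gamma> where "\<gamma> = Min {la, lb, lm}"
  show thesis
  proof (rule that)
    fix h h1 x y assume xy: "x \<in> I" "y \<in> I" "x \<le> c" "d \<le> y" and h: "form_pair h h1 x y" "h x = 0" "h y = 0"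
    let ?Q = "\<lambda>t. (h1 t)\<^sup>2 / p t + q t * (h t)\<^sup>2" and ?R = "\<lambda>t. r t * (h t)\<^sup>2"
    have sub: "{x..y} \<subseteq> I" by (rule Icc_subset_I[OF xy(1,2)])
    have subs: "{x..c} \<subseteq> {x..y}" "{c..d} \<subseteq> {x..y}" "{d..y} \<subseteq> {x..y}" using xy c(1) by auto
    have hs: "form_pair h h1 x c" "form_pair h h1 c d" "form_pair h h1 d y"
      using form_pair_subset[OF h(1)] xy c(1) by auto
    have split: "integral {x..y} f = integral {x..c} f + integral {c..d} f + integral {d..y} f"
      if "f absolutely_integrable_on {x..y}" for f :: "real \<Rightarrow> real"
    proof -
      have f: "f integrable_on {x..y}" using that by (rule set_lebesgue_integral_eq_integral(1))
      then have "f integrable_on {x..d}" by (rule integrable_on_subinterval) (use xy in auto)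
      then have "integral {x..c} f + integral {c..d} f = integral {x..d} f"
        using xy c(1) by (intro Henstock_Kurzweil_Integration.integral_combine) auto
      moreover have "integral {x..d} f + integral {d..y} f = integral {x..y} f"
        using xy c(1) f by (intro Henstock_Kurzweil_Integration.integral_combine) auto
      ultimately show ?thesis by simp
    qed
    have nonneg: "\<gamma> * integral {x'..y'} ?R \<le> l * integral {x'..y'} ?R"
      if "\<gamma> \<le> l" "{x'..y'} \<subseteq> {x..y}" "form_pair h h1 x' y'" for l x' y'
    proof -
      have "integral {x'..y'} (\<lambda>t. 0) \<le> integral {x'..y'} ?R"
      proof (rule integral_le_AE)
        show "?R integrable_on {x'..y'}"
          using form_integrable(2)[OF that(3)] that(2) sub set_lebesgue_integral_eq_integral(1) by blast
        show "AE t in lebesgue. t \<in> {x'..y'} \<longrightarrow> 0 \<le> ?R t"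
          using r_pos[unfolded AE_I_iff]
        proof eventually_elim
          case (elim t)
          have "t \<in> I" if "t \<in> {x'..y'}" using that \<open>{x'..y'} \<subseteq> {x..y}\<close> sub by blast
          then show ?case using elim by (auto intro: less_imp_le)
        qed
      qed auto
      then show ?thesis using that(1) by (intro mult_right_mono) simp_all
    qed
    have "la * integral {x..c} ?R + (h c)\<^sup>2 * va c - (h x)\<^sup>2 * va x \<le> integral {x..c} ?Q"
      by (rule riccati_bound[OF left[OF xy(1)] hs(1) xy(3)]) (use subs sub in blast)
    moreover have "lm * integral {c..d} ?R + (h d)\<^sup>2 * vm d - (h c)\<^sup>2 * vm c \<le> integral {c..d} ?Q"
      by (rule riccati_bound[OF vm(1) hs(2) less_imp_le[OF c(1)] c(2)])
    moreover have "lb * integral {d..y} ?R + (h y)\<^sup>2 * vb y - (h d)\<^sup>2 * vb d \<le> integral {d..y} ?Q"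
      by (rule riccati_bound[OF right[OF xy(2)] hs(3) xy(4)]) (use subs sub in blast)
    moreover have "(h d)\<^sup>2 * vb d \<le> (h d)\<^sup>2 * vm d" using vm(3) by (intro mult_left_mono) auto
    moreover have "\<gamma> * integral {x..c} ?R \<le> la * integral {x..c} ?R"
      "\<gamma> * integral {c..d} ?R \<le> lm * integral {c..d} ?R" "\<gamma> * integral {d..y} ?R \<le> lb * integral {d..y} ?R"
      by (rule nonneg; use subs hs in \<open>simp add: \<gamma>_def\<close>)+
    ultimately show "\<gamma> * integral {x..y} ?R \<le> integral {x..y} ?Q"
      using h(2,3) vm(2) split[OF form_integrable(1)[OF h(1) sub]] split[OF form_integrable(2)[OF h(1) sub]]
      by (simp add: algebra_simps)
  qed
qed

end

section \<open>Solutions and the operator \<open>T\<^sub>0\<close>\<close>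

lemma continuous_AE_zero_imp_zero:
  fixes k :: "real \<Rightarrow> 'a::real_normed_vector"
  assumes "open J" "continuous_on J k" "AE x in lebesgue. x \<in> J \<longrightarrow> k x = 0" "x \<in> J"
  shows "k x = 0"
proof (rule ccontr)
  assume "k x \<noteq> 0"
  have "open (J \<inter> k -` (- {0}))" using assms(1,2) by (intro continuous_open_preimage) auto
  moreover have "x \<in> J \<inter> k -` (- {0})" using \<open>k x \<noteq> 0\<close> assms(4) by simp
  ultimately have "\<not> negligible (J \<inter> k -` (- {0}))" using open_not_negligible by blast
  moreover obtain N where "negligible N" "{x. \<not> (x \<in> J \<longrightarrow> k x = 0)} \<subseteq> N"
    using assms(3) unfolding eventually_ae_filter_negligible by blast
  ultimately show False using negligible_subset[of N "J \<inter> k -` (- {0})"] by auto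
qed

lemma has_AC_deriv_cnj: "has_AC_deriv_on f \<phi> J \<Longrightarrow> has_AC_deriv_on (\<lambda>x. cnj (f x)) (\<lambda>x. cnj (\<phi> x)) J"
  by (rule has_AC_deriv_on_linear[OF bounded_linear_cnj])

lemma absolutely_integrable_linear':
  fixes L :: "'a::euclidean_space \<Rightarrow> 'b::euclidean_space"
  assumes "bounded_linear L" "f absolutely_integrable_on S"
  shows "(\<lambda>x. L (f x)) absolutely_integrable_on S"
  using absolutely_integrable_linear[OF assms(2,1)] by (simp add: o_def)

lemma absolutely_integrable_Complex:
  assumes "f absolutely_integrable_on S" "g absolutely_integrable_on S"
  shows "(\<lambda>x. Complex (f x) (g x)) absolutely_integrable_on S"
proof -
  have "(\<lambda>x. complex_of_real (f x) + \<i> * complex_of_real (g x)) absolutely_integrable_on S"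
    using assms by (intro set_integral_add(1) absolutely_integrable_linear'[OF bounded_linear_mult_right]
        absolutely_integrable_linear'[OF bounded_linear_of_real])
  then show ?thesis by (simp add: Complex_eq)
qed

context sturm_liouville
begin

lemma p_nz: "AE x in lebesgue. x \<in> I \<longrightarrow> p x \<noteq> 0" and r_nz: "AE x in lebesgue. x \<in> I \<longrightarrow> 0 < r x"
  using p_nonzero r_pos by (simp_all add: AE_I_iff)

lemma SL_is_quasi_deriv_unique:
  assumes "SL_is_quasi_deriv a b p s f g1" "SL_is_quasi_deriv a b p s f g2" "x \<in> I"
  shows "g1 x = g2 x"
proof -
  have AC: "g1 \<in> AC_loc I" "g2 \<in> AC_loc I" using assms by (auto simp: SL_is_quasi_deriv_def)
  have "continuous_on I (\<lambda>x. g1 x - g2 x)"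
    by (intro continuous_on_diff has_AC_deriv_continuous_on_open[OF AC_loc_has_deriv open_I] AC)
  moreover have "AE x in lebesgue. x \<in> I \<longrightarrow> g1 x - g2 x = 0"
    using assms(1,2) unfolding SL_is_quasi_deriv_def AE_I_iff by (auto elim: AE_mp)
  ultimately have "g1 x - g2 x = 0"
    using continuous_AE_zero_imp_zero[OF open_I] assms(3) by blast
  then show ?thesis by simp
qed

text \<open>The choice made in \<open>SL_quasi_deriv\<close> is immaterial: two quasi-derivatives
  agree almost everywhere, hence by continuity on all of \<open>I\<close>. A first-order system in
  integral form therefore determines \<open>SL_tau\<close> almost everywhere.\<close>

lemma SL_domainI:
  fixes f g :: "real \<Rightarrow> complex"
  assumes f: "has_AC_deriv_on f (\<lambda>x. g x / of_real (p x) - of_real (s x) * f x) I"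
    and g: "has_AC_deriv_on g \<gamma> I"
  shows "f \<in> SL_domain a b p s"
    and "\<And>x. x \<in> I \<Longrightarrow> SL_quasi_deriv a b p s f x = g x"
    and "AE x in lebesgue. x \<in> I \<longrightarrow> SL_tau a b p q r s f x
      = (- \<gamma> x + of_real (s x) * g x + of_real (q x) * f x) / of_real (r x)"
proof -
  have "AE x in lebesgue. x \<in> I \<longrightarrow> g x = of_real (p x) * (vector_derivative f (at x) + of_real (s x) * f x)"
    using has_AC_deriv_AE[OF open_I f] p_nz
    by eventually_elim (auto simp: vector_derivative_at)
  then have qd: "SL_is_quasi_deriv a b p s f g"
    using has_AC_deriv_imp_AC_loc[OF g] by (simp add: SL_is_quasi_deriv_def AE_I_iff)
  then show "f \<in> SL_domain a b p s"
    using has_AC_deriv_imp_AC_loc[OF f] by (auto simp: SL_domain_def)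
  have "SL_is_quasi_deriv a b p s f (SL_quasi_deriv a b p s f)"
    unfolding SL_quasi_deriv_def by (rule someI[of "SL_is_quasi_deriv a b p s f", OF qd])
  then show eq: "SL_quasi_deriv a b p s f x = g x" if "x \<in> I" for x
    using SL_is_quasi_deriv_unique qd that by blast
  show "AE x in lebesgue. x \<in> I \<longrightarrow> SL_tau a b p q r s f x
      = (- \<gamma> x + of_real (s x) * g x + of_real (q x) * f x) / of_real (r x)"
    using has_AC_deriv_AE[OF open_I g]
  proof eventually_elim
    case (elim x)
    show ?case
    proof
      assume x: "x \<in> I"
      then have "(SL_quasi_deriv a b p s f has_vector_derivative \<gamma> x) (at x)"
        using elim eq by (auto intro: has_vector_derivative_transform_within_open[OF _ open_I])
      then show "SL_tau a b p q r s f x = (- \<gamma> x + of_real (s x) * g x + of_real (q x) * f x) / of_real (r x)"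
        using eq[OF x] by (simp add: SL_tau_def vector_derivative_at)
    qed
  qed
qed

text \<open>Converse passage: the defining formulas are solved for the derivatives of
  \<open>f\<close> and of its quasi-derivative, dividing by \<open>p\<close> and multiplying by
  \<open>r\<close> off a null set.\<close>

lemma SL_domainD:
  assumes "f \<in> SL_domain a b p s"
  defines "g \<equiv> SL_quasi_deriv a b p s f"
  shows "has_AC_deriv_on f (\<lambda>x. g x / of_real (p x) - of_real (s x) * f x) I"
    and "has_AC_deriv_on g (\<lambda>x. of_real (s x) * g x + of_real (q x) * f x - of_real (r x) * SL_tau a b p q r s f x) I"
proof -
  have f: "f \<in> AC_loc I" and "SL_is_quasi_deriv a b p s f g"
    using assms someI_ex[of "SL_is_quasi_deriv a b p s f"] unfolding SL_domain_def SL_quasi_deriv_def by auto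
  then have g: "g \<in> AC_loc I"
    and qd: "AE x in lebesgue. x \<in> I \<longrightarrow> g x = of_real (p x) * (vector_derivative f (at x) + of_real (s x) * f x)"
    by (simp_all add: SL_is_quasi_deriv_def AE_I_iff)
  show "has_AC_deriv_on f (\<lambda>x. g x / of_real (p x) - of_real (s x) * f x) I"
  proof (rule has_AC_deriv_on_cong_AE[OF AC_loc_has_deriv[OF f]])
    show "AE x in lebesgue. x \<in> I \<longrightarrow> vector_derivative f (at x) = g x / of_real (p x) - of_real (s x) * f x"
      using qd p_nz by eventually_elim (simp add: field_simps)
  qed simp
  show "has_AC_deriv_on g (\<lambda>x. of_real (s x) * g x + of_real (q x) * f x - of_real (r x) * SL_tau a b p q r s f x) I"
  proof (rule has_AC_deriv_on_cong_AE[OF AC_loc_has_deriv[OF g]])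
    show "AE x in lebesgue. x \<in> I \<longrightarrow> vector_derivative g (at x)
        = of_real (s x) * g x + of_real (q x) * f x - of_real (r x) * SL_tau a b p q r s f x"
      using r_nz
    proof eventually_elim
      case (elim x)
      then show ?case by (auto simp: SL_tau_def g_def)
    qed
  qed simp
qed

text \<open>The first-order form of the equation \<open>SL_tau u = l u\<close>, with
  \<open>u1\<close> as quasi-derivative of \<open>u\<close>.\<close>

definition solution_pair :: "real \<Rightarrow> (real \<Rightarrow> real) \<Rightarrow> (real \<Rightarrow> real) \<Rightarrow> bool"
  where "solution_pair l u u1 \<longleftrightarrow> has_AC_deriv_on u (\<lambda>x. u1 x / p x - s x * u x) I \<and>
    has_AC_deriv_on u1 (\<lambda>x. s x * u1 x + (q x - l * r x) * u x) I"

text \<open>The system is a single real-linear equation for \<open>u + \<i> u\<^sup>[\<^sup>1\<^sup>]\<close>.\<close>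

lemma solution_pair_exists:
  assumes "x0 \<in> I"
  obtains u u1 where "solution_pair l u u1" "u x0 = \<alpha>" "u1 x0 = \<beta>"
proof -
  define G where "G x z = Complex (Im z / p x - s x * Re z) (s x * Im z + (q x - l * r x) * Re z)" for x z
  define m where "m x = \<bar>inverse (p x)\<bar> + 2 * \<bar>s x\<bar> + \<bar>q x - l * r x\<bar>" for x
  note int = coefficients_integrable
  have ql: "(\<lambda>x. q x - l * r x) absolutely_integrable_on {c..d}" if "{c..d} \<subseteq> I" for c d
    using int[OF that] by (intro set_integral_diff(1) set_integrable_mult_right) auto
  obtain Y where Y: "Y x0 = Complex \<alpha> \<beta>" "has_AC_deriv_on Y (\<lambda>x. G x (Y x)) I"
  proof (rule Caratheodory_linear_ODE[OF interval_I assms, of G m "Complex \<alpha> \<beta>"])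
    show "G x (y - z) = G x y - G x z" for x y z
      by (simp add: G_def complex_eq_iff diff_divide_distrib algebra_simps)
    show "norm (G x z) \<le> m x * norm z" for x z
    proof -
      have "norm (G x z) \<le> \<bar>Im z / p x - s x * Re z\<bar> + \<bar>s x * Im z + (q x - l * r x) * Re z\<bar>"
        using cmod_le[of "G x z"] by (simp add: G_def)
      also have "\<dots> \<le> (\<bar>inverse (p x)\<bar> * \<bar>Im z\<bar> + \<bar>s x\<bar> * \<bar>Re z\<bar>) + (\<bar>s x\<bar> * \<bar>Im z\<bar> + \<bar>q x - l * r x\<bar> * \<bar>Re z\<bar>)"
        unfolding abs_mult[symmetric]
        by (intro add_mono order_trans[OF abs_triangle_ineq4] order_trans[OF abs_triangle_ineq])
          (simp_all add: divide_inverse mult.commute)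
      also have "\<dots> \<le> (\<bar>inverse (p x)\<bar> * norm z + \<bar>s x\<bar> * norm z) + (\<bar>s x\<bar> * norm z + \<bar>q x - l * r x\<bar> * norm z)"
        by (intro add_mono mult_left_mono abs_Re_le_cmod abs_Im_le_cmod abs_ge_zero)
      also have "\<dots> = m x * norm z" by (simp add: m_def algebra_simps)
      finally show ?thesis .
    qed
    show "m absolutely_integrable_on {c..d}" if "{c..d} \<subseteq> I" for c d
      unfolding m_def using int[OF that] ql[OF that]
      by (intro set_integral_add(1) set_integrable_mult_right set_integrable_abs) auto
    show "(\<lambda>x. G x (y x)) absolutely_integrable_on {c..d}"
      if sub: "{c..d} \<subseteq> I" and y: "continuous_on {c..d} y" for c d y
    proof -
      have "(\<lambda>x. Im (y x) * inverse (p x) - Re (y x) * s x) absolutely_integrable_on {c..d}"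
        "(\<lambda>x. Im (y x) * s x + Re (y x) * (q x - l * r x)) absolutely_integrable_on {c..d}"
        using int[OF sub] ql[OF sub] y
        by (intro set_integral_diff(1) set_integral_add(1) absolutely_integrable_continuous_mult
            continuous_intros; simp)+
      from absolutely_integrable_Complex[OF this] show ?thesis
        by (simp add: G_def divide_inverse mult.commute)
    qed
  qed
  have "solution_pair l (\<lambda>x. Re (Y x)) (\<lambda>x. Im (Y x))"
    using has_AC_deriv_on_linear[OF bounded_linear_Re Y(2)] has_AC_deriv_on_linear[OF bounded_linear_Im Y(2)]
    by (simp add: solution_pair_def G_def)
  then show thesis using Y(1) that[of "\<lambda>x. Re (Y x)" "\<lambda>x. Im (Y x)"] by simp
qed

lemma solution_pair_SL:
  assumes "solution_pair l u u1" "x0 \<in> I" "u x0 \<noteq> 0"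
  shows "SL_nontrivial_real_solution a b p q r s l (\<lambda>x. of_real (u x))"
proof -
  have "has_AC_deriv_on (\<lambda>x. complex_of_real (u x)) (\<lambda>x. of_real (u1 x / p x - s x * u x)) I"
    by (rule has_AC_deriv_on_linear[OF bounded_linear_of_real]) (use assms(1) in \<open>simp add: solution_pair_def\<close>)
  then have f: "has_AC_deriv_on (\<lambda>x. complex_of_real (u x)) (\<lambda>x. of_real (u1 x) / of_real (p x) - of_real (s x) * of_real (u x)) I"
    by simp
  have g: "has_AC_deriv_on (\<lambda>x. complex_of_real (u1 x)) (\<lambda>x. of_real (s x * u1 x + (q x - l * r x) * u x)) I"
    by (rule has_AC_deriv_on_linear[OF bounded_linear_of_real]) (use assms(1) in \<open>simp add: solution_pair_def\<close>)
  note SL = SL_domainI[OF f g]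
  have "AE x in lebesgue. x \<in> I \<longrightarrow> SL_tau a b p q r s (\<lambda>x. of_real (u x)) x - of_real l * of_real (u x) = 0"
    using SL(3) r_nz
    by eventually_elim (auto simp: field_simps)
  then show ?thesis
    using SL(1) assms(2,3) by (auto simp: SL_nontrivial_real_solution_def AE_I_iff)
qed

lemma I_extend:
  assumes "x \<in> I" obtains y z where "y \<in> I" "y < x" "z \<in> I" "x < z"
proof -
  obtain e where e: "e > 0" "cball x e \<subseteq> I" using open_I assms open_contains_cball by metis
  then have "x - e \<in> I" "x + e \<in> I" by (auto simp: subset_iff dist_real_def)
  then show thesis using e(1) that[of "x - e" "x + e"] by simp
qed

text \<open>The quotient rule: the logarithmic quasi-derivative of a solution satisfies the Riccati
  relation with equality.\<close>

lemma riccati_solution: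
  assumes u: "solution_pair l u u1" and sub: "{x..y} \<subseteq> I" and nz: "\<And>t. t \<in> {x..y} \<Longrightarrow> u t \<noteq> 0"
  shows "riccati_sub l (\<lambda>t. u1 t * inverse (u t)) x y"
proof -
  have AC: "has_AC_deriv_on u (\<lambda>x. u1 x / p x - s x * u x) {x..y}"
    "has_AC_deriv_on u1 (\<lambda>x. s x * u1 x + (q x - l * r x) * u x) {x..y}"
    using u has_AC_deriv_on_subset[OF _ sub] by (auto simp: solution_pair_def)
  show ?thesis
    unfolding riccati_sub_def
  proof (rule exI, rule conjI[OF has_AC_deriv_on_mult[OF AC(2) has_AC_deriv_on_inverse[OF AC(1) nz]]])
    show "AE t in lebesgue. t \<in> {x..y} \<longrightarrow>
        u1 t * - ((u1 t / p t - s t * u t) / (u t)\<^sup>2) + (s t * u1 t + (q t - l * r t) * u t) * inverse (u t)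
        \<le> q t + 2 * s t * (u1 t * inverse (u t)) - (u1 t * inverse (u t))\<^sup>2 / p t - l * r t"
    proof (rule AE_I2, rule impI, rule eq_refl)
      fix t assume "t \<in> {x..y}"
      then have "u t \<noteq> 0" by (rule nz)
      \<comment> \<open>\<open>P\<close> stands for the reciprocal of \<open>p t\<close>, which may
        be 0 at exceptional points; the identity only requires \<open>u t\<close> to be
        nonzero.\<close>
      then have "u1 t * - ((u1 t * P - s t * u t) / (u t)\<^sup>2) + (s t * u1 t + (q t - l * r t) * u t) * inverse (u t)
        = q t + 2 * s t * (u1 t * inverse (u t)) - (u1 t * inverse (u t))\<^sup>2 * P - l * r t" for P
        by (simp add: field_simps power2_eq_square)
      from this[of "inverse (p t)"] show
        "u1 t * - ((u1 t / p t - s t * u t) / (u t)\<^sup>2) + (s t * u1 t + (q t - l * r t) * u t) * inverse (u t)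
        = q t + 2 * s t * (u1 t * inverse (u t)) - (u1 t * inverse (u t))\<^sup>2 / p t - l * r t"
        by (simp only: divide_inverse)
    qed
  qed
qed

lemma I_nonempty: obtains x0 where "x0 \<in> I"
  using einterval_nonempty[OF interval] by blast

section \<open>Riccati functions near the end points\<close>

text \<open>Non-oscillation applies to every nontrivial real solution, so any one will do: it has
  finitely many zeros below some point, and none below the smallest of them.\<close>

lemma nonoscillatory_left_riccati:
  assumes "\<not> SL_oscillatory_left a b p q r s l"
  obtains c v where "c \<in> I" "\<And>x y. \<lbrakk>x \<in> I; y \<in> I; y \<le> c\<rbrakk> \<Longrightarrow> riccati_sub l v x y"
proof -
  obtain x0 where x0: "x0 \<in> I" by (rule I_nonempty)
  obtain u u1 where u: "solution_pair l u u1" "u x0 = 1" "u1 x0 = 0"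
    by (rule solution_pair_exists[OF x0])
  have "SL_nontrivial_real_solution a b p q r s l (\<lambda>x. of_real (u x))"
    by (rule solution_pair_SL[OF u(1) x0]) (simp add: u(2))
  then obtain c where c: "c \<in> I" "finite {x \<in> I. x < c \<and> u x = 0}"
    using assms unfolding SL_oscillatory_left_def by auto
  \<comment> \<open>Inserting \<open>c\<close> keeps the minimum meaningful when there are no zeros
    to the left of \<open>c\<close>.\<close>
  define m where "m = Min (insert c {x \<in> I. x < c \<and> u x = 0})"
  have "m \<in> insert c {x \<in> I. x < c \<and> u x = 0}" unfolding m_def using c(2) by (intro Min_in) auto
  then have "m \<in> I" using c(1) by auto
  then obtain c' where c': "c' \<in> I" "c' < m" by (rule I_extend)
  have "u t \<noteq> 0" if "t \<in> I" "t \<le> c'" for t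
  proof
    assume "u t = 0"
    have "m \<le> c" unfolding m_def using c(2) by (intro Min_le) auto
    then have "t \<in> {x \<in> I. x < c \<and> u x = 0}" using that c' \<open>u t = 0\<close> by auto
    then have "m \<le> t" unfolding m_def using c(2) by (intro Min_le) auto
    then show False using that c' by simp
  qed
  then have "riccati_sub l (\<lambda>t. u1 t * inverse (u t)) x y" if "x \<in> I" "y \<in> I" "y \<le> c'" for x y
    using that Icc_subset_I[OF that(1,2)] by (intro riccati_solution[OF u(1)]) auto
  then show thesis using c'(1) by (intro that) auto
qed

lemma nonoscillatory_right_riccati:
  assumes "\<not> SL_oscillatory_right a b p q r s l"
  obtains c v where "c \<in> I" "\<And>x y. \<lbrakk>x \<in> I; y \<in> I; c \<le> x\<rbrakk> \<Longrightarrow> riccati_sub l v x y"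
proof -
  obtain x0 where x0: "x0 \<in> I" by (rule I_nonempty)
  obtain u u1 where u: "solution_pair l u u1" "u x0 = 1" "u1 x0 = 0"
    by (rule solution_pair_exists[OF x0])
  have "SL_nontrivial_real_solution a b p q r s l (\<lambda>x. of_real (u x))"
    by (rule solution_pair_SL[OF u(1) x0]) (simp add: u(2))
  then obtain c where c: "c \<in> I" "finite {x \<in> I. c < x \<and> u x = 0}"
    using assms unfolding SL_oscillatory_right_def by auto
  define m where "m = Max (insert c {x \<in> I. c < x \<and> u x = 0})"
  have "m \<in> insert c {x \<in> I. c < x \<and> u x = 0}" unfolding m_def using c(2) by (intro Max_in) auto
  then have "m \<in> I" using c(1) by auto
  then obtain c' where c': "c' \<in> I" "m < c'" by (rule I_extend)
  have "u t \<noteq> 0" if "t \<in> I" "c' \<le> t" for t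
  proof
    assume "u t = 0"
    have "c \<le> m" unfolding m_def using c(2) by (intro Max_ge) auto
    then have "t \<in> {x \<in> I. c < x \<and> u x = 0}" using that c' \<open>u t = 0\<close> by auto
    then have "t \<le> m" unfolding m_def using c(2) by (intro Max_ge) auto
    then show False using that c' by simp
  qed
  then have "riccati_sub l (\<lambda>t. u1 t * inverse (u t)) x y" if "x \<in> I" "y \<in> I" "c' \<le> x" for x y
    using that Icc_subset_I[OF that(1,2)] by (intro riccati_solution[OF u(1)]) auto
  then show thesis using c'(1) by (intro that) auto
qed

section \<open>Integration against the weight\<close>

abbreviation "SLM \<equiv> SL_measure a b r"

lemma sets_SLM: "sets SLM = sets (lebesgue_on I)"
  by (simp add: SL_measure_def)

lemma AE_SLM_iff: "(AE x in SLM. P x) \<longleftrightarrow> (AE x in lebesgue. x \<in> I \<longrightarrow> P x)"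
proof -
  have "(AE x in SLM. P x) \<longleftrightarrow> (AE x in lebesgue_on I. 0 < ennreal (r x) \<longrightarrow> P x)"
    unfolding SL_measure_def using measurable(3) by (intro AE_density) auto
  also have "\<dots> \<longleftrightarrow> (AE x in lebesgue. x \<in> I \<longrightarrow> P x)"
    unfolding AE_I_iff
  proof
    assume "AE x in lebesgue. x \<in> I \<longrightarrow> 0 < ennreal (r x) \<longrightarrow> P x"
    with r_nz show "AE x in lebesgue. x \<in> I \<longrightarrow> P x" by eventually_elim simp
  qed (auto elim!: eventually_mono)
  finally show ?thesis .
qed

text \<open>Turns a Bochner integral with weight into a plain integral over a compact interval.
  \<open>G\<close> absorbs the weight and has to match only almost everywhere.\<close>

lemma SLM_integral:
  fixes F :: "real \<Rightarrow> 'a::euclidean_space"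
  assumes F: "F \<in> borel_measurable SLM" and sub: "{x..y} \<subseteq> I"
    and G: "G absolutely_integrable_on {x..y}"
    and eq: "AE t in lebesgue. t \<in> {x..y} \<longrightarrow> r t *\<^sub>R F t = G t"
    and zero: "AE t in lebesgue. t \<in> I - {x..y} \<longrightarrow> F t = 0"
  shows "integrable SLM F" "integral\<^sup>L SLM F = integral {x..y} G"
proof -
  have mF: "F \<in> borel_measurable (lebesgue_on I)"
    using F by (simp add: measurable_cong_sets[OF sets_SLM refl])
  then have m1: "(\<lambda>t. indicat_real I t *\<^sub>R (r t *\<^sub>R F t)) \<in> borel_measurable lebesgue"
    using measurable(3) lebesgue_I borel_measurable_restrict_space_iff[of I lebesgue "\<lambda>t. r t *\<^sub>R F t"]
    by (simp add: borel_measurable_scaleR)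
  have m2: "(\<lambda>t. indicat_real {x..y} t *\<^sub>R G t) \<in> borel_measurable lebesgue"
    using G by (auto simp: set_integrable_def)
  have ae: "AE t in lebesgue. indicat_real I t *\<^sub>R (r t *\<^sub>R F t) = indicat_real {x..y} t *\<^sub>R G t"
    using eq zero
  proof eventually_elim
    case (elim t)
    then show ?case using sub by (auto simp: indicator_def subset_iff)
  qed
  have nn: "AE x in lebesgue_on I. 0 \<le> r x" using r_pos by eventually_elim simp
  have lI: "I \<inter> space lebesgue \<in> sets lebesgue" using lebesgue_I by simp
  have "integrable SLM F \<longleftrightarrow> integrable lebesgue (\<lambda>t. indicat_real I t *\<^sub>R (r t *\<^sub>R F t))"
    unfolding SL_measure_def integrable_density[OF mF measurable(3) nn] by (rule integrable_restrict_space[OF lI])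
  also have "\<dots> \<longleftrightarrow> integrable lebesgue (\<lambda>t. indicat_real {x..y} t *\<^sub>R G t)"
    by (rule integrable_cong_AE[OF m1 m2 ae])
  finally show "integrable SLM F" using G by (simp add: set_integrable_def)
  have "integral\<^sup>L SLM F = integral\<^sup>L lebesgue (\<lambda>t. indicat_real I t *\<^sub>R (r t *\<^sub>R F t))"
    unfolding SL_measure_def integral_density[OF mF measurable(3) nn] by (rule integral_restrict_space[OF lI])
  also have "\<dots> = integral\<^sup>L lebesgue (\<lambda>t. indicat_real {x..y} t *\<^sub>R G t)"
    by (rule integral_cong_AE[OF m1 m2 ae])
  also have "\<dots> = integral {x..y} G"
    using set_lebesgue_integral_eq_integral(2)[OF G] by (simp add: set_lebesgue_integral_def)
  finally show "integral\<^sup>L SLM F = integral {x..y} G" .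
qed

lemma compact_support_Icc:
  assumes "compact K" "K \<subseteq> I" "c \<in> I" "d \<in> I"
  obtains x y where "x \<in> I" "y \<in> I" "x < c" "d < y" "K \<subseteq> {x<..<y}"
proof -
  \<comment> \<open>Adding \<open>c\<close> and \<open>d\<close> to the support forces the enclosing
    interval to extend strictly beyond both, as \<open>form_lower_bound\<close> needs.\<close>
  let ?K = "insert c (insert d K)"
  have K: "compact ?K" "?K \<noteq> {}" using assms(1) by auto
  obtain m where m: "m \<in> ?K" "\<And>t. t \<in> ?K \<Longrightarrow> m \<le> t" using compact_attains_inf[OF K] by blast
  obtain M where M: "M \<in> ?K" "\<And>t. t \<in> ?K \<Longrightarrow> t \<le> M" using compact_attains_sup[OF K] by blast
  have "m \<in> I" "M \<in> I" using m(1) M(1) assms by auto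
  then obtain x y where "x \<in> I" "x < m" "y \<in> I" "M < y" by (metis I_extend)
  moreover have "x < t" "t < y" if "t \<in> ?K" for t using m(2)[OF that] M(2)[OF that] \<open>x < m\<close> \<open>M < y\<close> by auto
  ultimately show thesis by (intro that[of x y]) auto
qed

end

lemma integral_of_real:
  assumes "f integrable_on S"
  shows "integral S (\<lambda>x. complex_of_real (f x)) = complex_of_real (integral S f)"
proof -
  have "bounded_linear complex_of_real" by (rule bounded_linear_of_real)
  from integral_linear[OF assms this] show ?thesis by (simp add: o_def)
qed

lemma borel_measurable_cnj [measurable (raw)]:
  "f \<in> borel_measurable M \<Longrightarrow> (\<lambda>x. cnj (f x)) \<in> borel_measurable M"
  by (rule borel_measurable_continuous_on[OF continuous_on_cnj[OF continuous_on_id]])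

lemma L2_D:
  assumes "f \<in> L2 M" shows "f \<in> borel_measurable M" "integrable M (\<lambda>x. (cmod (f x))\<^sup>2)"
  using assms by (simp_all add: L2_def)

lemma L2_add:
  assumes f: "f \<in> L2 M" and g: "g \<in> L2 M" shows "(\<lambda>x. f x + g x) \<in> L2 M"
proof -
  note [measurable] = L2_D(1)[OF f] L2_D(1)[OF g]
  have "integrable M (\<lambda>x. 2 * ((cmod (f x))\<^sup>2 + (cmod (g x))\<^sup>2))"
    using L2_D(2)[OF f] L2_D(2)[OF g] by simp
  then have "integrable M (\<lambda>x. (cmod (f x + g x))\<^sup>2)"
  proof (rule Bochner_Integration.integrable_bound)
    show "AE x in M. norm ((cmod (f x + g x))\<^sup>2) \<le> norm (2 * ((cmod (f x))\<^sup>2 + (cmod (g x))\<^sup>2))"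
    proof (rule AE_I2)
      fix x
      have "(cmod (f x + g x))\<^sup>2 \<le> (cmod (f x) + cmod (g x))\<^sup>2"
        by (intro power_mono norm_triangle_ineq norm_ge_zero)
      also have "\<dots> \<le> 2 * ((cmod (f x))\<^sup>2 + (cmod (g x))\<^sup>2)"
        using zero_le_power2[of "cmod (f x) - cmod (g x)"] by (simp add: power2_diff power2_sum)
      finally show "norm ((cmod (f x + g x))\<^sup>2) \<le> norm (2 * ((cmod (f x))\<^sup>2 + (cmod (g x))\<^sup>2))" by simp
    qed
  qed measurable
  then show ?thesis by (simp add: L2_def)
qed

lemma L2_scale: "f \<in> L2 M \<Longrightarrow> (\<lambda>x. c * f x) \<in> L2 M"
  by (auto simp: L2_def norm_mult power_mult_distrib)

lemma L2_inner_integrable: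
  assumes f: "f \<in> L2 M" and g: "g \<in> L2 M" shows "integrable M (\<lambda>x. cnj (f x) * g x)"
proof -
  note [measurable] = L2_D(1)[OF f] L2_D(1)[OF g]
  have "integrable M (\<lambda>x. (cmod (f x))\<^sup>2 + (cmod (g x))\<^sup>2)"
    using L2_D(2)[OF f] L2_D(2)[OF g] by simp
  then show ?thesis
  proof (rule Bochner_Integration.integrable_bound)
    show "AE x in M. norm (cnj (f x) * g x) \<le> norm ((cmod (f x))\<^sup>2 + (cmod (g x))\<^sup>2)"
    proof (rule AE_I2)
      fix x
      have "2 * (cmod (f x) * cmod (g x)) \<le> (cmod (f x))\<^sup>2 + (cmod (g x))\<^sup>2"
        using zero_le_power2[of "cmod (f x) - cmod (g x)"] by (simp add: power2_diff)
      moreover have "0 \<le> cmod (f x) * cmod (g x)" by simp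
      ultimately have "cmod (f x) * cmod (g x) \<le> (cmod (f x))\<^sup>2 + (cmod (g x))\<^sup>2" by linarith
      then show "norm (cnj (f x) * g x) \<le> norm ((cmod (f x))\<^sup>2 + (cmod (g x))\<^sup>2)"
        by (simp add: norm_mult)
    qed
  qed measurable
qed

lemma L2_inner_commute: "L2_inner M g f = cnj (L2_inner M f g)"
  using Bochner_Integration.integral_cnj[of M "\<lambda>x. cnj (f x) * g x"] by (simp add: L2_inner_def mult.commute)

section \<open>Quadratic form and variation of constants for \<open>T_0\<close>\<close>

context sturm_liouville
begin

text \<open>For the continuous representative \<open>h\<close>, vanishing almost everywhere off
  \<open>K\<close> becomes vanishing everywhere there. Then the derivative of \<open>h\<close> is 0
  off \<open>K\<close>, and its quasi-derivative vanishes as well.\<close>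

lemma T_0_element:
  assumes fg: "(f, g) \<in> T_0 a b p q r s" and cd: "c \<in> I" "d \<in> I"
  obtains h h1 x y where "x \<in> I" "y \<in> I" "x < c" "d < y"
    "has_AC_deriv_on h (\<lambda>t. h1 t / of_real (p t) - of_real (s t) * h t) I"
    "has_AC_deriv_on h1 (\<lambda>t. of_real (s t) * h1 t + of_real (q t) * h t - of_real (r t) * SL_tau a b p q r s h t) I"
    "\<forall>t\<in>I - {x<..<y}. h t = 0 \<and> h1 t = 0"
    "AE t in SLM. f t = h t" "AE t in SLM. g t = SL_tau a b p q r s h t"
proof -
  obtain h K where h: "h \<in> SL_domain a b p s" "AE t in SLM. f t = h t" "AE t in SLM. g t = SL_tau a b p q r s h t"
    and K: "compact K" "K \<subseteq> I" "AE t in SLM. t \<notin> K \<longrightarrow> f t = 0"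
    using fg unfolding T_0_def T_max_def by blast
  define h1 where "h1 = SL_quasi_deriv a b p s h"
  note AC = SL_domainD[OF h(1), folded h1_def]
  obtain x y where xy: "x \<in> I" "y \<in> I" "x < c" "d < y" "K \<subseteq> {x<..<y}"
    by (rule compact_support_Icc[OF K(1,2) cd])
  have J: "open (I - K)" using K(1) by (intro open_Diff compact_imp_closed) auto
  have "continuous_on (I - K) h" "continuous_on (I - K) h1"
    using has_AC_deriv_continuous_on_open[OF AC(1) open_I] has_AC_deriv_continuous_on_open[OF AC(2) open_I]
    by (auto intro: continuous_on_subset)
  note cont = this
  have "AE t in lebesgue. t \<in> I - K \<longrightarrow> h t = 0"
    using h(2)[unfolded AE_SLM_iff] K(3)[unfolded AE_SLM_iff] by eventually_elim auto
  then have h0: "h t = 0" if "t \<in> I - K" for t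
    using continuous_AE_zero_imp_zero[OF J cont(1)] that by blast
  have "AE t in lebesgue. t \<in> I - K \<longrightarrow> h1 t = 0"
    using has_AC_deriv_AE[OF open_I AC(1)] p_nz
  proof eventually_elim
    case (elim t)
    show ?case
    proof
      assume t: "t \<in> I - K"
      have "((\<lambda>t. 0) has_vector_derivative (0::complex)) (at t)" by simp
      then have "(h has_vector_derivative 0) (at t)"
        by (rule has_vector_derivative_transform_within_open[OF _ J t]) (simp add: h0)
      moreover have "(h has_vector_derivative h1 t / of_real (p t) - of_real (s t) * h t) (at t)"
        using elim t by blast
      ultimately have "h1 t / of_real (p t) - of_real (s t) * h t = 0" by (metis vector_derivative_at)
      then show "h1 t = 0" using elim t h0[OF t] by auto
    qed
  qed
  then have "h1 t = 0" if "t \<in> I - K" for t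
    using continuous_AE_zero_imp_zero[OF J cont(2)] that by blast
  then show thesis using xy h0 AC h(2,3) by (intro that[of x y h h1]) auto
qed

lemma form_pair_parts:
  assumes h: "has_AC_deriv_on h (\<lambda>t. h1 t / of_real (p t) - of_real (s t) * h t) I"
    and h1: "continuous_on I h1" and sub: "{x..y} \<subseteq> I"
  shows "form_pair (\<lambda>t. Re (h t)) (\<lambda>t. Re (h1 t)) x y" "form_pair (\<lambda>t. Im (h t)) (\<lambda>t. Im (h1 t)) x y"
proof -
  have h': "has_AC_deriv_on h (\<lambda>t. h1 t / of_real (p t) - of_real (s t) * h t) {x..y}"
    by (rule has_AC_deriv_on_subset[OF h sub])
  have c: "continuous_on {x..y} h1" using h1 sub by (rule continuous_on_subset)
  show "form_pair (\<lambda>t. Re (h t)) (\<lambda>t. Re (h1 t)) x y" "form_pair (\<lambda>t. Im (h t)) (\<lambda>t. Im (h1 t)) x y"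
    using has_AC_deriv_on_linear[OF bounded_linear_Re h'] has_AC_deriv_on_linear[OF bounded_linear_Im h'] c
    by (auto simp: form_pair_def intro!: continuous_intros)
qed

text \<open>Integration by parts: the derivative of \<open>cnj h * h1\<close> is the form density
  minus \<open>r * cnj h * SL_tau h\<close>, the terms with \<open>s\<close> cancelling, and its
  integral is 0 since \<open>h\<close> and \<open>h1\<close> vanish at both ends.\<close>

lemma T_0_form:
  assumes fg: "(f, g) \<in> T_0 a b p q r s" and cd: "c \<in> I" "d \<in> I"
  obtains h h1 x y where "x \<in> I" "y \<in> I" "x < c" "d < y"
    "form_pair (\<lambda>t. Re (h t)) (\<lambda>t. Re (h1 t)) x y" "form_pair (\<lambda>t. Im (h t)) (\<lambda>t. Im (h1 t)) x y"
    "h x = 0" "h y = 0"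
    "L2_inner SLM f g = of_real (integral {x..y} (\<lambda>t. (cmod (h1 t))\<^sup>2 / p t + q t * (cmod (h t))\<^sup>2))"
    "L2_inner SLM f f = of_real (integral {x..y} (\<lambda>t. r t * (cmod (h t))\<^sup>2))"
proof -
  have L2: "f \<in> L2 SLM" "g \<in> L2 SLM" using fg by (auto simp: T_0_def T_max_def)
  note [measurable] = L2_D(1)[OF L2(1)] L2_D(1)[OF L2(2)]
  obtain h h1 x y where xy: "x \<in> I" "y \<in> I" "x < c" "d < y"
    and AC: "has_AC_deriv_on h (\<lambda>t. h1 t / of_real (p t) - of_real (s t) * h t) I"
    "has_AC_deriv_on h1 (\<lambda>t. of_real (s t) * h1 t + of_real (q t) * h t - of_real (r t) * SL_tau a b p q r s h t) I"
    and zero: "\<forall>t\<in>I - {x<..<y}. h t = 0 \<and> h1 t = 0"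
    and AE: "AE t in SLM. f t = h t" "AE t in SLM. g t = SL_tau a b p q r s h t"
    by (rule T_0_element[OF fg cd])
  let ?\<tau> = "SL_tau a b p q r s h"
  let ?\<gamma> = "\<lambda>t. of_real (s t) * h1 t + of_real (q t) * h t - of_real (r t) * ?\<tau> t"
  have sub: "{x..y} \<subseteq> I" by (rule Icc_subset_I[OF xy(1,2)])
  have cont: "continuous_on I h1" by (rule has_AC_deriv_continuous_on_open[OF AC(2) open_I])
  note fp = form_pair_parts[OF AC(1) cont sub]
  have norms: "(cmod z)\<^sup>2 = (Re z)\<^sup>2 + (Im z)\<^sup>2" for z by (simp add: cmod_power2)
  define F where "F t = (cmod (h1 t))\<^sup>2 / p t + q t * (cmod (h t))\<^sup>2" for t
  have F: "F absolutely_integrable_on {x..y}"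
    using set_integral_add(1)[OF form_integrable(1)[OF fp(1) sub] form_integrable(1)[OF fp(2) sub]]
    by (simp add: F_def[abs_def] norms add_divide_distrib algebra_simps)
  have R: "(\<lambda>t. r t * (cmod (h t))\<^sup>2) absolutely_integrable_on {x..y}"
    using set_integral_add(1)[OF form_integrable(2)[OF fp(1) sub] form_integrable(2)[OF fp(2) sub]]
    by (simp add: norms algebra_simps)
  note HK = set_lebesgue_integral_eq_integral(1)
  let ?D = "\<lambda>t. cnj (h t) * ?\<gamma> t + cnj (h1 t / of_real (p t) - of_real (s t) * h t) * h1 t"
  have D: "has_AC_deriv_on (\<lambda>t. cnj (h t) * h1 t) ?D {x..y}"
    by (rule has_AC_deriv_on_subset[OF has_AC_deriv_on_mult[OF has_AC_deriv_cnj[OF AC(1)] AC(2)] sub])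
  have D0: "?D absolutely_integrable_on {x..y} \<and> integral {x..y} ?D = 0"
  proof (cases "x \<le> y")
    case True
    then show ?thesis using has_AC_deriv_onD[OF D True subset_refl] zero xy by simp
  qed simp
  have Fc: "(\<lambda>t. complex_of_real (F t)) absolutely_integrable_on {x..y}"
    by (rule absolutely_integrable_linear'[OF bounded_linear_of_real F])
  \<comment> \<open>This is the weighted product of \<open>cnj h\<close> and
    \<open>SL_tau h\<close>; written as a difference it is visibly integrable.\<close>
  define G where "G t = complex_of_real (F t) - ?D t" for t
  have G: "G absolutely_integrable_on {x..y}"
    unfolding G_def using Fc D0 by (intro set_integral_diff(1)) auto
  have G_eq: "G t = of_real (r t) * (cnj (h t) * ?\<tau> t)" for t
    unfolding G_def F_def of_real_add of_real_mult of_real_divide complex_norm_square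
    by (simp add: divide_inverse algebra_simps)
  have "L2_inner SLM f g = integral {x..y} G"
    unfolding L2_inner_def
  proof (rule SLM_integral(2)[OF _ sub G])
    show "AE t in lebesgue. t \<in> {x..y} \<longrightarrow> r t *\<^sub>R (cnj (f t) * g t) = G t"
      using AE[unfolded AE_SLM_iff]
    proof eventually_elim
      case (elim t)
      then show ?case using sub by (auto simp: G_eq scaleR_conv_of_real)
    qed
    show "AE t in lebesgue. t \<in> I - {x..y} \<longrightarrow> cnj (f t) * g t = 0"
      using AE(1)[unfolded AE_SLM_iff] by eventually_elim (use zero in auto)
  qed measurable
  also have "\<dots> = integral {x..y} (\<lambda>t. complex_of_real (F t)) - integral {x..y} ?D"
    unfolding G_def using HK[OF Fc] HK[of "{x..y}" ?D] D0
    by (intro Henstock_Kurzweil_Integration.integral_diff) auto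
  also have "\<dots> = of_real (integral {x..y} F)" using D0 integral_of_real[OF HK[OF F]] by simp
  finally have inner: "L2_inner SLM f g = of_real (integral {x..y} F)" .
  have Rc: "(\<lambda>t. complex_of_real (r t * (cmod (h t))\<^sup>2)) absolutely_integrable_on {x..y}"
    by (rule absolutely_integrable_linear'[OF bounded_linear_of_real R])
  have "L2_inner SLM f f = integral {x..y} (\<lambda>t. complex_of_real (r t * (cmod (h t))\<^sup>2))"
    unfolding L2_inner_def
  proof (rule SLM_integral(2)[OF _ sub Rc])
    show "AE t in lebesgue. t \<in> {x..y} \<longrightarrow> r t *\<^sub>R (cnj (f t) * f t) = complex_of_real (r t * (cmod (h t))\<^sup>2)"
      using AE(1)[unfolded AE_SLM_iff]
    proof eventually_elim
      case (elim t)
      have "cnj z * z = complex_of_real ((cmod z)\<^sup>2)" for z unfolding complex_norm_square by simp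
      then show ?case using elim sub by (auto simp: scaleR_conv_of_real)
    qed
    show "AE t in lebesgue. t \<in> I - {x..y} \<longrightarrow> cnj (f t) * f t = 0"
      using AE(1)[unfolded AE_SLM_iff] by eventually_elim (use zero in auto)
  qed measurable
  also have "\<dots> = of_real (integral {x..y} (\<lambda>t. r t * (cmod (h t))\<^sup>2))"
    using HK[OF R] by (rule integral_of_real)
  finally have "L2_inner SLM f f = of_real (integral {x..y} (\<lambda>t. r t * (cmod (h t))\<^sup>2))" .
  moreover have "h x = 0" "h y = 0" using zero xy by auto
  ultimately show thesis
    using xy fp inner unfolding F_def by (intro that[of x y h h1])
qed

lemma wronskian_constant:
  assumes u: "solution_pair l u u1" and w: "solution_pair l w w1" and "x \<in> I" "y \<in> I"
  shows "u x * w1 x - w x * u1 x = u y * w1 y - w y * u1 y"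
proof -
  have W: "has_AC_deriv_on (\<lambda>t. u t * w1 t - w t * u1 t) (\<lambda>t. 0) I"
  proof (rule has_AC_deriv_on_cong_AE)
    show "has_AC_deriv_on (\<lambda>t. u t * w1 t - w t * u1 t)
      (\<lambda>t. (u t * (s t * w1 t + (q t - l * r t) * w t) + (u1 t / p t - s t * u t) * w1 t)
        - (w t * (s t * u1 t + (q t - l * r t) * u t) + (w1 t / p t - s t * w t) * u1 t)) I"
      using u w unfolding solution_pair_def by (intro has_AC_deriv_on_diff has_AC_deriv_on_mult) auto
  qed (auto simp: algebra_simps)
  have *: "u x * w1 x - w x * u1 x = u y * w1 y - w y * u1 y" if "x \<le> y" "x \<in> I" "y \<in> I" for x y
    using has_AC_deriv_onD(3)[OF W that(1) Icc_subset_I[OF that(2,3)]] by simp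
  show ?thesis
  proof (cases x y rule: linorder_le_cases)
    case le
    then show ?thesis using assms(3,4) by (rule *)
  next
    case ge
    then show ?thesis using *[OF ge assms(4,3)] by simp
  qed
qed

text \<open>The bound \<open>cmod z \<le> 1 + (cmod z)^2\<close> and the local integrability of
  \<open>r\<close> turn square-integrability into integrability on compact intervals.\<close>

lemma L2_locally_integrable:
  assumes v: "v \<in> L2 SLM" and sub: "{x..y} \<subseteq> I"
  shows "(\<lambda>t. of_real (r t) * v t) absolutely_integrable_on {x..y}"
proof -
  note [measurable] = L2_D(1)[OF v]
  have Isets: "{x..y} \<in> sets SLM"
    unfolding sets_SLM using lebesgue_I sub by (auto simp: sets_restrict_space_iff)
  have ind: "integrable SLM (indicat_real {x..y})"
    by (rule SLM_integral(1)[OF _ sub coefficients_integrable(3)[OF sub]]) (use Isets in auto)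
  have "integrable SLM (\<lambda>t. indicat_real {x..y} t + (cmod (v t))\<^sup>2)"
    using ind L2_D(2)[OF v] by simp
  then have "integrable SLM (\<lambda>t. indicat_real {x..y} t *\<^sub>R v t)"
  proof (rule Bochner_Integration.integrable_bound)
    show "AE t in SLM. norm (indicat_real {x..y} t *\<^sub>R v t) \<le> norm (indicat_real {x..y} t + (cmod (v t))\<^sup>2)"
    proof (rule AE_I2)
      fix t
      have "2 * cmod (v t) \<le> 1 + (cmod (v t))\<^sup>2"
        using zero_le_power2[of "1 - cmod (v t)"] by (simp add: power2_diff)
      then have "cmod (v t) \<le> 1 + (cmod (v t))\<^sup>2" using norm_ge_zero[of "v t"] by linarith
      then show "norm (indicat_real {x..y} t *\<^sub>R v t) \<le> norm (indicat_real {x..y} t + (cmod (v t))\<^sup>2)"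
        by (auto simp: indicator_def)
    qed
  qed (use Isets in measurable)
  moreover have "(\<lambda>t. indicat_real {x..y} t *\<^sub>R v t) \<in> borel_measurable (lebesgue_on I)"
    using Isets L2_D(1)[OF v] unfolding sets_SLM measurable_cong_sets[OF sets_SLM refl]
    by (intro borel_measurable_scaleR borel_measurable_indicator)
  ultimately have "integrable (lebesgue_on I) (\<lambda>t. r t *\<^sub>R (indicat_real {x..y} t *\<^sub>R v t))"
    unfolding SL_measure_def using measurable(3) r_pos
    by (subst (asm) integrable_density) (auto elim!: eventually_mono)
  then have "integrable lebesgue (\<lambda>t. indicat_real I t *\<^sub>R (r t *\<^sub>R (indicat_real {x..y} t *\<^sub>R v t)))"
    by (subst (asm) integrable_restrict_space) (use lebesgue_I in auto)
  moreover have "indicat_real I t *\<^sub>R (r t *\<^sub>R (indicat_real {x..y} t *\<^sub>R v t))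
      = indicat_real {x..y} t *\<^sub>R (of_real (r t) * v t)" for t
    using sub by (auto simp: indicator_def scaleR_conv_of_real)
  ultimately show ?thesis by (simp add: set_integrable_def)
qed

lemma continuous_compact_support_L2:
  assumes h: "continuous_on I h" and sub: "{x..y} \<subseteq> I" and zero: "\<And>t. t \<in> I \<Longrightarrow> t \<notin> {x..y} \<Longrightarrow> h t = 0"
  shows "h \<in> L2 SLM"
proof -
  have m: "h \<in> borel_measurable SLM"
    unfolding measurable_cong_sets[OF sets_SLM refl]
    by (rule continuous_imp_measurable_on_sets_lebesgue[OF h lebesgue_I])
  have int: "(\<lambda>t. (cmod (h t))\<^sup>2 * r t) absolutely_integrable_on {x..y}"
    by (rule absolutely_integrable_continuous_mult[OF _ coefficients_integrable(3)[OF sub]])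
      (intro continuous_intros continuous_on_subset[OF h sub])
  have "integrable SLM (\<lambda>t. (cmod (h t))\<^sup>2)"
    by (rule SLM_integral(1)[OF _ sub int]) (use m zero in \<open>auto simp: mult.commute\<close>)
  then show ?thesis using m by (simp add: L2_def)
qed

text \<open>Variation of constants: the two orthogonality conditions make the solution vanish to
  the right of the support of \<open>v\<close> as well.\<close>

lemma T_0_solve:
  assumes u: "solution_pair l u u1" and w: "solution_pair l w w1"
    and W: "\<And>t. t \<in> I \<Longrightarrow> u t * w1 t - w t * u1 t = 1"
    and xy: "x \<in> I" "y \<in> I" "x \<le> y" and v: "v \<in> L2 SLM" "\<And>t. t \<in> I \<Longrightarrow> t \<notin> {x<..<y} \<Longrightarrow> v t = 0"
    and orth: "integral {x..y} (\<lambda>t. of_real (u t) * (of_real (r t) * v t)) = 0"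
      "integral {x..y} (\<lambda>t. of_real (w t) * (of_real (r t) * v t)) = 0"
  obtains h where "(h, \<lambda>t. v t + of_real l * h t) \<in> T_0 a b p q r s"
proof -
  have sub: "{x..y} \<subseteq> I" by (rule Icc_subset_I[OF xy(1,2)])
  have AC_of_real: "has_AC_deriv_on (\<lambda>t. complex_of_real (f t)) (\<lambda>t. of_real (\<phi> t)) I"
    if "has_AC_deriv_on f \<phi> I" for f \<phi>
    by (rule has_AC_deriv_on_linear[OF bounded_linear_of_real that])
  note ACs = u[unfolded solution_pair_def, THEN conjunct1, THEN AC_of_real]
    u[unfolded solution_pair_def, THEN conjunct2, THEN AC_of_real]
    w[unfolded solution_pair_def, THEN conjunct1, THEN AC_of_real]
    w[unfolded solution_pair_def, THEN conjunct2, THEN AC_of_real]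
  have ex: "\<exists>A. has_AC_deriv_on A (\<lambda>t. of_real (z t) * (of_real (r t) * v t)) I \<and>
      (\<forall>t\<in>I. t \<notin> {x<..<y} \<longrightarrow> A t = 0)"
    if z: "has_AC_deriv_on (\<lambda>t. complex_of_real (z t)) z' I"
      and orth: "integral {x..y} (\<lambda>t. of_real (z t) * (of_real (r t) * v t)) = 0" for z z'
  proof -
    let ?\<phi> = "\<lambda>t. complex_of_real (z t) * (of_real (r t) * v t)"
    obtain A where A: "A x = 0" "has_AC_deriv_on A ?\<phi> I"
    proof (rule has_AC_deriv_on_exists[OF interval_I xy(1), of ?\<phi> 0])
      fix c d assume "c \<le> d" "{c..d} \<subseteq> I"
      then show "?\<phi> absolutely_integrable_on {c..d}"
        by (intro absolutely_integrable_continuous_mult has_AC_deriv_continuous_on[OF z]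
            L2_locally_integrable[OF v(1)])
    qed
    \<comment> \<open>To the left of \<open>x\<close> this is the initial value of \<open>A\<close>;
      to the right of \<open>y\<close> it is the orthogonality condition.\<close>
    have "A t = 0" if t: "t \<in> I" "t \<notin> {x<..<y}" for t
    proof -
      consider "t \<le> x" | "y \<le> t" using t by force
      then show ?thesis
      proof cases
        case 1
        have "integral {t..x} ?\<phi> = integral {t..x} (\<lambda>t. 0)"
          by (rule integral_cong) (use v(2) Icc_subset_I[OF t(1) xy(1)] in auto)
        then show ?thesis
          using has_AC_deriv_onD(3)[OF A(2) 1 Icc_subset_I[OF t(1) xy(1)]] A(1) by simp
      next
        case 2
        have "integral {y..t} ?\<phi> = integral {y..t} (\<lambda>t. 0)"
          by (rule integral_cong) (use v(2) Icc_subset_I[OF xy(2) t(1)] in auto)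
        then show ?thesis
          using has_AC_deriv_onD(3)[OF A(2) 2 Icc_subset_I[OF xy(2) t(1)]]
            has_AC_deriv_onD(3)[OF A(2) xy(3) sub] A(1) orth by simp
      qed
    qed
    then show ?thesis using A(2) by blast
  qed
  obtain A where A: "has_AC_deriv_on A (\<lambda>t. of_real (w t) * (of_real (r t) * v t)) I"
    "\<And>t. t \<in> I \<Longrightarrow> t \<notin> {x<..<y} \<Longrightarrow> A t = 0"
    using ex[OF ACs(3) orth(2)] by blast
  obtain B where B: "has_AC_deriv_on B (\<lambda>t. of_real (u t) * (of_real (r t) * v t)) I"
    "\<And>t. t \<in> I \<Longrightarrow> t \<notin> {x<..<y} \<Longrightarrow> B t = 0"
    using ex[OF ACs(1) orth(1)] by blast
  \<comment> \<open>Variation of constants with \<open>A' = w r v\<close> and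
    \<open>B' = u r v\<close>. In the derivative of \<open>h\<close> these contributions cancel, so
    \<open>h1\<close> is its quasi-derivative; in that of \<open>h1\<close> they leave
    \<open>- r v\<close> because the Wronskian is 1.\<close>
  define h where "h t = of_real (u t) * A t - of_real (w t) * B t" for t
  define h1 where "h1 t = of_real (u1 t) * A t - of_real (w1 t) * B t" for t
  define \<gamma> where "\<gamma> t = of_real (s t) * h1 t + of_real (q t - l * r t) * h t - of_real (r t) * v t" for t
  have h: "has_AC_deriv_on h (\<lambda>t. h1 t / of_real (p t) - of_real (s t) * h t) I"
  proof (rule has_AC_deriv_on_cong_AE)
    show "has_AC_deriv_on (\<lambda>t. of_real (u t) * A t - of_real (w t) * B t)
      (\<lambda>t. (of_real (u t) * (of_real (w t) * (of_real (r t) * v t)) + of_real (u1 t / p t - s t * u t) * A t)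
       - (of_real (w t) * (of_real (u t) * (of_real (r t) * v t)) + of_real (w1 t / p t - s t * w t) * B t)) I"
      by (intro has_AC_deriv_on_diff has_AC_deriv_on_mult ACs A B)
  qed (auto simp: h_def h1_def diff_divide_distrib algebra_simps)
  have h1: "has_AC_deriv_on h1 \<gamma> I"
  proof (rule has_AC_deriv_on_cong_AE)
    show "has_AC_deriv_on (\<lambda>t. of_real (u1 t) * A t - of_real (w1 t) * B t)
      (\<lambda>t. (of_real (u1 t) * (of_real (w t) * (of_real (r t) * v t))
          + of_real (s t * u1 t + (q t - l * r t) * u t) * A t)
       - (of_real (w1 t) * (of_real (u t) * (of_real (r t) * v t))
          + of_real (s t * w1 t + (q t - l * r t) * w t) * B t)) I"
      by (intro has_AC_deriv_on_diff has_AC_deriv_on_mult ACs A B)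
    show "AE t in lebesgue. t \<in> I \<longrightarrow> (of_real (u1 t) * (of_real (w t) * (of_real (r t) * v t))
          + of_real (s t * u1 t + (q t - l * r t) * u t) * A t)
       - (of_real (w1 t) * (of_real (u t) * (of_real (r t) * v t))
          + of_real (s t * w1 t + (q t - l * r t) * w t) * B t) = \<gamma> t"
    proof (rule AE_I2, rule impI)
      fix t assume t: "t \<in> I"
      have "of_real (w1 t) * (of_real (u t) * (of_real (r t) * v t)) - of_real (u1 t) * (of_real (w t) * (of_real (r t) * v t))
        = of_real (u t * w1 t - w t * u1 t) * (of_real (r t) * v t)"
        by (simp add: algebra_simps)
      also have "\<dots> = of_real (r t) * v t" using W[OF t] by simp
      finally show "(of_real (u1 t) * (of_real (w t) * (of_real (r t) * v t))
          + of_real (s t * u1 t + (q t - l * r t) * u t) * A t)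
       - (of_real (w1 t) * (of_real (u t) * (of_real (r t) * v t))
          + of_real (s t * w1 t + (q t - l * r t) * w t) * B t) = \<gamma> t"
        by (simp add: \<gamma>_def h_def h1_def algebra_simps)
    qed
  qed (simp add: h1_def)
  note SL = SL_domainI[OF h h1]
  have h0: "h t = 0" if "t \<in> I" "t \<notin> {x<..<y}" for t using A(2) B(2) that by (simp add: h_def)
  have hL2: "h \<in> L2 SLM"
    by (rule continuous_compact_support_L2[OF has_AC_deriv_continuous_on_open[OF h open_I] sub])
      (use h0 in auto)
  then have gL2: "(\<lambda>t. v t + of_real l * h t) \<in> L2 SLM" using v(1) by (intro L2_add L2_scale)
  have "AE t in lebesgue. t \<in> I \<longrightarrow> v t + of_real l * h t = SL_tau a b p q r s h t"
    using SL(3) r_nz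
  proof eventually_elim
    case (elim t)
    show ?case
    proof
      assume t: "t \<in> I"
      then have "SL_tau a b p q r s h t = (of_real (r t) * (v t + of_real l * h t)) / of_real (r t)"
        using elim by (simp add: \<gamma>_def algebra_simps)
      then show "v t + of_real l * h t = SL_tau a b p q r s h t" using elim t by auto
    qed
  qed
  then have "(h, \<lambda>t. v t + of_real l * h t) \<in> T_max a b p q r s"
    using SL(1) hL2 gL2 unfolding T_max_def AE_SLM_iff by (auto intro!: bexI[of _ h])
  moreover have "AE t in SLM. t \<notin> {x..y} \<longrightarrow> h t = 0"
    unfolding AE_SLM_iff using h0 by (auto intro!: AE_I2)
  ultimately have "(h, \<lambda>t. v t + of_real l * h t) \<in> T_0 a b p q r s"
    using sub compact_Icc unfolding T_0_def by blast
  then show thesis by (rule that)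
qed

end

context sturm_liouville_pos
begin

lemma T_0_lower_bound:
  assumes "\<not> SL_oscillatory_left a b p q r s la" "\<not> SL_oscillatory_right a b p q r s lb"
  obtains \<gamma> where "\<And>f g. (f, g) \<in> T_0 a b p q r s \<Longrightarrow>
    L2_inner SLM f g \<in> \<real> \<and> \<gamma> * Re (L2_inner SLM f f) \<le> Re (L2_inner SLM f g)"
proof -
  obtain c va where c: "c \<in> I" "\<And>x y. \<lbrakk>x \<in> I; y \<in> I; y \<le> c\<rbrakk> \<Longrightarrow> riccati_sub la va x y"
    using nonoscillatory_left_riccati[OF assms(1)] by metis
  obtain d' vb where d': "d' \<in> I" "\<And>x y. \<lbrakk>x \<in> I; y \<in> I; d' \<le> x\<rbrakk> \<Longrightarrow> riccati_sub lb vb x y"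
    using nonoscillatory_right_riccati[OF assms(2)] by metis
  have "max c d' \<in> I" using c(1) d'(1) by (simp add: max_def)
  \<comment> \<open>Beyond \<open>c\<close>, so that the middle interval is nondegenerate, and
    beyond \<open>d'\<close>, so that the right-hand Riccati function is available from
    \<open>d\<close> on.\<close>
  then obtain d where d: "d \<in> I" "max c d' < d" by (rule I_extend)
  have cd: "c < d" "{c..d} \<subseteq> I" using d Icc_subset_I[OF c(1) d(1)] by auto
  obtain \<gamma> where \<gamma>: "\<And>h h1 x y. \<lbrakk>x \<in> I; y \<in> I; x \<le> c; d \<le> y; form_pair h h1 x y; h x = 0; h y = 0\<rbrakk> \<Longrightarrow>
    \<gamma> * integral {x..y} (\<lambda>t. r t * (h t)\<^sup>2) \<le> integral {x..y} (\<lambda>t. (h1 t)\<^sup>2 / p t + q t * (h t)\<^sup>2)"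
    by (rule form_lower_bound[OF cd, of la va lb vb]) (use c d d' in auto)
  show thesis
  proof (rule that[of \<gamma>])
    fix f g assume fg: "(f, g) \<in> T_0 a b p q r s"
    obtain h h1 x y where xy: "x \<in> I" "y \<in> I" "x < c" "d < y"
      and fp: "form_pair (\<lambda>t. Re (h t)) (\<lambda>t. Re (h1 t)) x y" "form_pair (\<lambda>t. Im (h t)) (\<lambda>t. Im (h1 t)) x y"
      and h0: "h x = 0" "h y = 0"
      and inner: "L2_inner SLM f g = of_real (integral {x..y} (\<lambda>t. (cmod (h1 t))\<^sup>2 / p t + q t * (cmod (h t))\<^sup>2))"
        "L2_inner SLM f f = of_real (integral {x..y} (\<lambda>t. r t * (cmod (h t))\<^sup>2))"
      by (rule T_0_form[OF fg c(1) d(1)])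
    have sub: "{x..y} \<subseteq> I" by (rule Icc_subset_I[OF xy(1,2)])
    note fi = form_integrable[OF fp(1) sub, THEN set_lebesgue_integral_eq_integral(1)]
      form_integrable[OF fp(2) sub, THEN set_lebesgue_integral_eq_integral(1)]
    have norms: "(cmod z)\<^sup>2 = (Re z)\<^sup>2 + (Im z)\<^sup>2" for z by (simp add: cmod_power2)
    \<comment> \<open>The coefficients are real, so the form splits into its values at the real and
      the imaginary part of \<open>h\<close>, and the real bound applies to each.\<close>
    have "integral {x..y} (\<lambda>t. (cmod (h1 t))\<^sup>2 / p t + q t * (cmod (h t))\<^sup>2)
      = integral {x..y} (\<lambda>t. ((Re (h1 t))\<^sup>2 / p t + q t * (Re (h t))\<^sup>2) + ((Im (h1 t))\<^sup>2 / p t + q t * (Im (h t))\<^sup>2))"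
      by (rule integral_cong) (simp add: norms add_divide_distrib algebra_simps)
    also have "\<dots> = integral {x..y} (\<lambda>t. (Re (h1 t))\<^sup>2 / p t + q t * (Re (h t))\<^sup>2)
        + integral {x..y} (\<lambda>t. (Im (h1 t))\<^sup>2 / p t + q t * (Im (h t))\<^sup>2)"
      using fi by (intro Henstock_Kurzweil_Integration.integral_add)
    also have "\<dots> \<ge> \<gamma> * integral {x..y} (\<lambda>t. r t * (Re (h t))\<^sup>2) + \<gamma> * integral {x..y} (\<lambda>t. r t * (Im (h t))\<^sup>2)"
      using xy fp h0 by (intro add_mono \<gamma>) auto
    also have "\<gamma> * integral {x..y} (\<lambda>t. r t * (Re (h t))\<^sup>2) + \<gamma> * integral {x..y} (\<lambda>t. r t * (Im (h t))\<^sup>2)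
        = \<gamma> * integral {x..y} (\<lambda>t. r t * (Re (h t))\<^sup>2 + r t * (Im (h t))\<^sup>2)"
      using fi by (simp add: Henstock_Kurzweil_Integration.integral_add distrib_left)
    also have "integral {x..y} (\<lambda>t. r t * (Re (h t))\<^sup>2 + r t * (Im (h t))\<^sup>2)
        = integral {x..y} (\<lambda>t. r t * (cmod (h t))\<^sup>2)"
      by (rule integral_cong) (simp add: norms distrib_left)
    finally show "L2_inner SLM f g \<in> \<real> \<and> \<gamma> * Re (L2_inner SLM f f) \<le> Re (L2_inner SLM f g)"
      unfolding inner by simp
  qed
qed

end

section \<open>Self-adjoint extensions\<close>

text \<open>Pointwise operations make the representatives themselves a real vector space, so that
  square-integrable functions and operator graphs are subspaces in the sense of the abstract
  locale.\<close>

instantiation "fun" :: (type, real_vector) real_vector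
begin

definition scaleR_fun :: "real \<Rightarrow> ('a \<Rightarrow> 'b) \<Rightarrow> 'a \<Rightarrow> 'b"
  where "scaleR_fun c f = (\<lambda>x. c *\<^sub>R f x)"

instance
  by standard (auto simp: scaleR_fun_def plus_fun_def fun_eq_iff scaleR_add_right scaleR_add_left)

end

lemma L2_inner_add_left:
  assumes "f \<in> L2 M" "g \<in> L2 M" "k \<in> L2 M"
  shows "L2_inner M (\<lambda>x. f x + g x) k = L2_inner M f k + L2_inner M g k"
  using L2_inner_integrable[OF assms(1,3)] L2_inner_integrable[OF assms(2,3)]
  by (simp add: L2_inner_def distrib_right)

lemma L2_inner_add_right:
  assumes "f \<in> L2 M" "g \<in> L2 M" "k \<in> L2 M"
  shows "L2_inner M k (\<lambda>x. f x + g x) = L2_inner M k f + L2_inner M k g"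
  using L2_inner_integrable[OF assms(3,1)] L2_inner_integrable[OF assms(3,2)]
  by (simp add: L2_inner_def distrib_left)

lemma L2_inner_scale_right: "L2_inner M k (\<lambda>x. c * f x) = c * L2_inner M k f"
  unfolding L2_inner_def using integral_mult_right_zero[of M c "\<lambda>x. cnj (k x) * f x"]
  by (simp add: mult.left_commute)

lemma L2_inner_self: "L2_inner M f f = complex_of_real (LINT x|M. (cmod (f x))\<^sup>2)"
proof -
  have "cnj z * z = complex_of_real ((cmod z)\<^sup>2)" for z unfolding complex_norm_square by simp
  then show ?thesis unfolding L2_inner_def by (simp only: integral_complex_of_real)
qed

lemma zero_in_L2: "(\<lambda>x. 0) \<in> L2 M" by (simp add: L2_def)

lemma scaleR_fun_complex: "c *\<^sub>R f = (\<lambda>x. complex_of_real c * f x)"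
  by (simp add: scaleR_fun_def scaleR_conv_of_real)

lemma subspace_L2: "subspace (L2 M)"
  unfolding subspace_def scaleR_fun_complex plus_fun_def zero_fun_def
  by (intro conjI ballI allI zero_in_L2 L2_add L2_scale)

text \<open>Taking real parts turns the complex space into a real one; the lower bound is a
  statement about real parts.\<close>

lemma semi_inner_product_L2: "semi_inner_product (L2 M) (\<lambda>f g. Re (L2_inner M f g))"
proof
  fix f g k :: "'a \<Rightarrow> complex" and c :: real
  show "Re (L2_inner M f g) = Re (L2_inner M g f)" by (subst L2_inner_commute) simp
  show "0 \<le> Re (L2_inner M f f)" by (simp add: L2_inner_self)
  show "Re (L2_inner M (c *\<^sub>R f) k) = c * Re (L2_inner M f k)"
    by (subst (1 2) L2_inner_commute) (simp add: scaleR_fun_complex L2_inner_scale_right)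
  assume "f \<in> L2 M" "g \<in> L2 M" "k \<in> L2 M"
  then show "Re (L2_inner M (f + g) k) = Re (L2_inner M f k) + Re (L2_inner M g k)"
    unfolding plus_fun_def by (simp add: L2_inner_add_left)
qed (rule subspace_L2)

context sturm_liouville
begin

section \<open>Compactly supported square-integrable functions\<close>

text \<open>Vanishing is required pointwise and off an open interval whose ends lie in
  \<open>I\<close>, the form in which \<open>T_0_solve\<close> takes its right-hand side.\<close>

definition L2_compact_support :: "(real \<Rightarrow> complex) set"
  where "L2_compact_support = {v \<in> L2 SLM. \<exists>x\<in>I. \<exists>y\<in>I. x \<le> y \<and> (\<forall>t\<in>I - {x<..<y}. v t = 0)}"

lemma subspace_L2_compact_support: "subspace L2_compact_support"
  unfolding subspace_def
proof (intro conjI ballI allI)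
  obtain x0 where "x0 \<in> I" by (rule I_nonempty)
  then show "0 \<in> L2_compact_support"
    using zero_in_L2 by (auto simp: L2_compact_support_def zero_fun_def)
next
  fix v w assume vw: "v \<in> L2_compact_support" "w \<in> L2_compact_support"
  then obtain x y x' y' where xy: "x \<in> I" "y \<in> I" "x \<le> y" "\<forall>t\<in>I - {x<..<y}. v t = 0"
    "x' \<in> I" "y' \<in> I" "\<forall>t\<in>I - {x'<..<y'}. w t = 0"
    unfolding L2_compact_support_def by blast
  have "v + w \<in> L2 SLM"
    using vw subspace_add[OF subspace_L2] by (auto simp: L2_compact_support_def)
  moreover have "\<forall>t\<in>I - {min x x'<..<max y y'}. (v + w) t = 0"
  proof
    fix t assume "t \<in> I - {min x x'<..<max y y'}"
    then have "t \<in> I - {x<..<y}" "t \<in> I - {x'<..<y'}" by auto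
    then have "v t = 0" "w t = 0" using xy(4,7) by blast+
    then show "(v + w) t = 0" by (simp add: plus_fun_def)
  qed
  moreover have "min x x' \<in> I" "max y y' \<in> I" "min x x' \<le> max y y'"
  proof -
    show "min x x' \<in> I" using xy(1,5) unfolding min_def by presburger
    show "max y y' \<in> I" using xy(2,6) unfolding max_def by presburger
    have "min x x' \<le> x" "y \<le> max y y'" by simp_all
    then show "min x x' \<le> max y y'" using xy(3) by linarith
  qed
  ultimately show "v + w \<in> L2_compact_support"
    unfolding L2_compact_support_def
    by (intro CollectI conjI bexI[of _ "min x x'"] bexI[of _ "max y y'"])
next
  fix c :: real and v assume "v \<in> L2_compact_support"
  then show "c *\<^sub>R v \<in> L2_compact_support"
    using subspace_scale[OF subspace_L2, of v SLM c] by (force simp: L2_compact_support_def scaleR_fun_def)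
qed

text \<open>Truncation to compact intervals exhausting \<open>I\<close>, with dominated
  convergence.\<close>

lemma L2_compact_support_dense:
  assumes v: "v \<in> L2 SLM" and "\<epsilon> > 0"
  obtains w where "w \<in> L2_compact_support" "sqrt (Re (L2_inner SLM (v - w) (v - w))) < \<epsilon>"
proof -
  obtain U L :: "nat \<Rightarrow> real" where UL: "I = (\<Union>i. {L i..U i})" "incseq U" "decseq L"
    "\<And>i. L i < U i" "\<And>i. a < L i" "\<And>i. U i < b" "L \<longlonglongrightarrow> a" "U \<longlonglongrightarrow> b"
    by (rule einterval_Icc_approximation[OF interval]) (rule that)
  note [measurable] = L2_D(1)[OF v]
  define w where "w n t = (if t \<in> {L n..U n} then v t else 0)" for n t
  have LU: "L n \<in> I" "U n \<in> I" for n
  proof -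
    have "L n \<in> {L n..U n}" "U n \<in> {L n..U n}" using UL(4)[of n] by simp_all
    then show "L n \<in> I" "U n \<in> I" unfolding UL(1) by blast+
  qed
  have "{L n..U n} \<in> sets SLM" for n
    unfolding sets_SLM using lebesgue_I Icc_subset_I[OF LU] by (auto simp: sets_restrict_space_iff)
  note [measurable] = this
  have wm: "w n \<in> borel_measurable SLM" for n unfolding w_def by measurable
  have wcs: "w n \<in> L2_compact_support" for n
  proof -
    \<comment> \<open>The truncation may be nonzero at the ends \<open>L n\<close> and
      \<open>U n\<close>, so the open interval has to be slightly larger.\<close>
    obtain x where x: "x \<in> I" "x < L n" using LU by (metis I_extend)
    obtain y where y: "y \<in> I" "U n < y" using LU by (metis I_extend)
    have "integrable SLM (\<lambda>t. (cmod (w n t))\<^sup>2)"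
    proof (rule Bochner_Integration.integrable_bound[OF L2_D(2)[OF v]])
      show "(\<lambda>t. (cmod (w n t))\<^sup>2) \<in> borel_measurable SLM" using wm by measurable
    qed (auto simp: w_def)
    then have "w n \<in> L2 SLM" using wm by (simp add: L2_def)
    moreover have "w n t = 0" if "t \<notin> {x<..<y}" for t using that x y by (auto simp: w_def)
    ultimately show ?thesis
      unfolding L2_compact_support_def using x y UL(4)[of n] by (intro CollectI conjI bexI[of _ x] bexI[of _ y]) auto
  qed
  have "(\<lambda>n. LINT t|SLM. (cmod (v t - w n t))\<^sup>2) \<longlonglongrightarrow> (LINT t|SLM. 0)"
  proof (rule integral_dominated_convergence[OF _ _ L2_D(2)[OF v]])
    show "AE t in SLM. (\<lambda>n. (cmod (v t - w n t))\<^sup>2) \<longlonglongrightarrow> 0"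
      unfolding AE_SLM_iff
    proof (rule AE_I2, rule impI)
      fix t assume "t \<in> I"
      then obtain i where i: "t \<in> {L i..U i}" using UL(1) by auto
      have "eventually (\<lambda>n. (cmod (v t - w n t))\<^sup>2 = 0) sequentially"
        using eventually_ge_at_top[of i]
      proof eventually_elim
        case (elim n)
        then have "t \<in> {L n..U n}" using i decseqD[OF UL(3) elim] incseqD[OF UL(2) elim] by auto
        then show ?case by (simp add: w_def)
      qed
      then show "(\<lambda>n. (cmod (v t - w n t))\<^sup>2) \<longlonglongrightarrow> 0" by (rule tendsto_eventually)
    qed
    show "AE t in SLM. norm ((cmod (v t - w n t))\<^sup>2) \<le> (cmod (v t))\<^sup>2" for n
      by (rule AE_I2) (auto simp: w_def)
  qed (use wm in measurable)
  then have "(\<lambda>n. sqrt (LINT t|SLM. (cmod (v t - w n t))\<^sup>2)) \<longlonglongrightarrow> sqrt 0"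
    by (intro tendsto_real_sqrt) simp
  then have "eventually (\<lambda>n. sqrt (LINT t|SLM. (cmod (v t - w n t))\<^sup>2) < \<epsilon>) sequentially"
    using \<open>\<epsilon> > 0\<close> by (intro order_tendstoD(2)[where y = "sqrt 0"]) auto
  then obtain n where "sqrt (LINT t|SLM. (cmod (v t - w n t))\<^sup>2) < \<epsilon>"
    by (meson eventually_happens' sequentially_bot)
  then show thesis using wcs by (intro that[of "w n"]) (simp_all add: L2_inner_self)
qed

lemma T_0_subset_T_min: "T_0 a b p q r s \<subseteq> T_min a b p q r s"
proof
  fix e assume e: "e \<in> T_0 a b p q r s"
  obtain f g where fg: "e = (f, g)" by (cases e)
  have "f \<in> L2 SLM" "g \<in> L2 SLM" using e by (auto simp: fg T_0_def T_max_def)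
  moreover have "(\<lambda>n::nat. L2_norm SLM (\<lambda>x. k x - k x)) \<longlonglongrightarrow> 0" for k :: "real \<Rightarrow> complex"
    by (simp add: L2_norm_def)
  ultimately show "e \<in> T_min a b p q r s"
    using e unfolding T_min_def L2_closure_def fg
    by (intro CollectI case_prodI conjI exI[of _ "\<lambda>n. f"] exI[of _ "\<lambda>n. g"] allI)
qed

text \<open>\<open>u\<close> may fail to be square-integrable near the end points of
  \<open>I\<close>; the compact support of \<open>v\<close> is what makes the pairing
  finite.\<close>

lemma L2_compact_support_integral:
  assumes v: "v \<in> L2 SLM" and xy: "x \<in> I" "y \<in> I" "\<forall>t\<in>I - {x<..<y}. v t = 0"
    and u: "continuous_on I u"
  shows "integrable SLM (\<lambda>t. of_real (u t) * v t)"
    "(LINT t|SLM. of_real (u t) * v t) = integral {x..y} (\<lambda>t. of_real (u t) * (of_real (r t) * v t))"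
proof -
  have sub: "{x..y} \<subseteq> I" by (rule Icc_subset_I[OF xy(1,2)])
  have "(\<lambda>t. complex_of_real (u t)) \<in> borel_measurable SLM"
    unfolding measurable_cong_sets[OF sets_SLM refl]
    by (rule continuous_imp_measurable_on_sets_lebesgue[OF _ lebesgue_I]) (intro continuous_intros u)
  then have m: "(\<lambda>t. of_real (u t) * v t) \<in> borel_measurable SLM"
    using L2_D(1)[OF v] by measurable
  have G: "(\<lambda>t. of_real (u t) * (of_real (r t) * v t)) absolutely_integrable_on {x..y}"
    by (intro absolutely_integrable_continuous_mult L2_locally_integrable[OF v sub] continuous_intros
        continuous_on_subset[OF u sub])
  have eq: "AE t in lebesgue. t \<in> {x..y} \<longrightarrow> r t *\<^sub>R (of_real (u t) * v t) = of_real (u t) * (of_real (r t) * v t)"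
    by (auto simp: scaleR_conv_of_real)
  have zero: "AE t in lebesgue. t \<in> I - {x..y} \<longrightarrow> of_real (u t) * v t = 0"
    using xy(3) by (auto intro!: AE_I2)
  show "integrable SLM (\<lambda>t. of_real (u t) * v t)"
    "(LINT t|SLM. of_real (u t) * v t) = integral {x..y} (\<lambda>t. of_real (u t) * (of_real (r t) * v t))"
    by (rule SLM_integral[OF m sub G eq zero])+
qed

section \<open>The abstract bound applied to self-adjoint extensions\<close>

lemma L2_symmetric_operator:
  assumes "L2_self_adjoint SLM S"
  shows "semi_inner_product.symmetric_operator (L2 SLM) (\<lambda>f g. Re (L2_inner SLM f g)) S"
  unfolding semi_inner_product.symmetric_operator_def[OF semi_inner_product_L2]
proof (intro conjI)
  have op: "L2_operator SLM S" and adj: "L2_adjoint SLM S = S"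
    using assms by (auto simp: L2_self_adjoint_def)
  show "S \<subseteq> L2 SLM \<times> L2 SLM" using op by (simp add: L2_operator_def)
  show "subspace S"
    unfolding subspace_def
  proof (intro conjI ballI allI)
    show "0 \<in> S" using op by (simp add: L2_operator_def zero_prod_def zero_fun_def)
    have "\<forall>f g f' g'. (f, g) \<in> S \<and> (f', g') \<in> S \<longrightarrow> (\<lambda>x. f x + f' x, \<lambda>x. g x + g' x) \<in> S"
      using op unfolding L2_operator_def by (elim conjE)
    then have add: "(\<lambda>x. f x + f' x, \<lambda>x. g x + g' x) \<in> S" if "(f, g) \<in> S" "(f', g') \<in> S" for f g f' g'
      using that by simp
    show "d + e \<in> S" if "d \<in> S" "e \<in> S" for d e
      using add[of "fst d" "snd d" "fst e" "snd e"] that by (simp add: plus_prod_def plus_fun_def)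
    have "\<forall>f g z. (f, g) \<in> S \<longrightarrow> (\<lambda>x. z * f x, \<lambda>x. z * g x) \<in> S"
      using op unfolding L2_operator_def by (elim conjE)
    then have scale: "(\<lambda>x. z * f x, \<lambda>x. z * g x) \<in> S" if "(f, g) \<in> S" for f g z
      using that by simp
    show "c *\<^sub>R d \<in> S" if "d \<in> S" for c d
      using scale[of "fst d" "snd d" "of_real c"] that by (simp add: scaleR_prod_def scaleR_fun_complex)
  qed
  show "\<forall>(f, g)\<in>S. \<forall>(u, v)\<in>S. Re (L2_inner SLM f v) = Re (L2_inner SLM g u)"
  proof (clarify)
    fix f g u v assume "(f, g) \<in> S" "(u, v) \<in> S"
    then have "(f, g) \<in> L2_adjoint SLM S" using adj by simp
    then have "L2_inner SLM f v = L2_inner SLM g u"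
      using \<open>(u, v) \<in> S\<close> by (auto simp: L2_adjoint_def)
    then show "Re (L2_inner SLM f v) = Re (L2_inner SLM g u)" by simp
  qed
qed

lemma self_adjoint_extension_bounded_below:
  assumes T0: "\<And>f g. (f, g) \<in> T_0 a b p q r s \<Longrightarrow> \<gamma> * Re (L2_inner SLM f f) \<le> Re (L2_inner SLM f g)"
    and S: "L2_self_adjoint SLM S" "T_0 a b p q r s \<subseteq> S"
  shows "L2_bounded_below SLM S"
proof -
  \<comment> \<open>With this distance to \<open>\<gamma>\<close> the operator
    \<open>T_0 - l\<close> is at least 1, that is, the squared norm of \<open>h\<close> is bounded
    by the real part of its pairing with \<open>v = (T_0 - l) h\<close>.\<close>
  define l where "l = \<gamma> - 1"
  obtain x0 where x0: "x0 \<in> I" by (rule I_nonempty)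
  \<comment> \<open>Together with the initial values of \<open>w\<close> this makes the Wronskian 1
    at \<open>x0\<close>, hence on all of \<open>I\<close>, as \<open>T_0_solve\<close>
    requires.\<close>
  obtain u u1 where u: "solution_pair l u u1" "u x0 = 1" "u1 x0 = 0"
    by (rule solution_pair_exists[OF x0])
  obtain w w1 where w: "solution_pair l w w1" "w x0 = 0" "w1 x0 = 1"
    by (rule solution_pair_exists[OF x0])
  have W: "u t * w1 t - w t * u1 t = 1" if "t \<in> I" for t
    using wronskian_constant[OF u(1) w(1) that x0] u w by simp
  have cont: "continuous_on I u" "continuous_on I w"
    using u(1) w(1) has_AC_deriv_continuous_on_open[OF _ open_I] unfolding solution_pair_def by blast+
  interpret L2: semi_inner_product "L2 SLM" "\<lambda>f g. Re (L2_inner SLM f g)"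
    by (rule semi_inner_product_L2)
  define \<psi> where "\<psi> z v = (LINT t|SLM. complex_of_real (z t) * v t)" for z v
  have \<psi>_add: "\<psi> z (v + v') = \<psi> z v + \<psi> z v'"
    if "continuous_on I z" "v \<in> L2_compact_support" "v' \<in> L2_compact_support" for z v v'
  proof -
    have "integrable SLM (\<lambda>t. of_real (z t) * v t)" "integrable SLM (\<lambda>t. of_real (z t) * v' t)"
      using that L2_compact_support_integral(1) unfolding L2_compact_support_def by blast+
    then show ?thesis by (simp add: \<psi>_def plus_fun_def distrib_left)
  qed
  have \<psi>_scale: "\<psi> z (c *\<^sub>R v) = c *\<^sub>R \<psi> z v" for z c v
    by (simp add: \<psi>_def scaleR_fun_def)
  \<comment> \<open>Orthogonality to \<open>u\<close> and to \<open>w\<close> amounts to four real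
    linear conditions on compactly supported functions.\<close>
  have "L2.form_bounded_below S"
  proof (rule L2.symmetric_bounded_below[where X = L2_compact_support and l = l
        and \<Phi> = "[\<lambda>v. Re (\<psi> u v), \<lambda>v. Im (\<psi> u v), \<lambda>v. Re (\<psi> w v), \<lambda>v. Im (\<psi> w v)]"])
    show "L2.symmetric_operator S" by (rule L2_symmetric_operator[OF S(1)])
    show "subspace L2_compact_support" by (rule subspace_L2_compact_support)
    show "L2_compact_support \<subseteq> L2 SLM" by (auto simp: L2_compact_support_def)
    show "L2 SLM \<subseteq> L2.scl L2_compact_support"
      unfolding L2.scl_def L2.snorm_def using L2_compact_support_dense by blast
  next
    fix \<phi> x y assume "\<phi> \<in> set [\<lambda>v. Re (\<psi> u v), \<lambda>v. Im (\<psi> u v), \<lambda>v. Re (\<psi> w v), \<lambda>v. Im (\<psi> w v)]"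
      "x \<in> L2_compact_support" "y \<in> L2_compact_support"
    then show "\<phi> (x + y) = \<phi> x + \<phi> y" using \<psi>_add cont by auto
  next
    fix \<phi> c x assume "\<phi> \<in> set [\<lambda>v. Re (\<psi> u v), \<lambda>v. Im (\<psi> u v), \<lambda>v. Re (\<psi> w v), \<lambda>v. Im (\<psi> w v)]"
      "x \<in> L2_compact_support"
    then show "\<phi> (c *\<^sub>R x) = c * \<phi> x" using \<psi>_scale by auto
  next
    fix v assume v: "v \<in> L2_compact_support"
      and zero: "\<And>\<phi>. \<phi> \<in> set [\<lambda>v. Re (\<psi> u v), \<lambda>v. Im (\<psi> u v), \<lambda>v. Re (\<psi> w v), \<lambda>v. Im (\<psi> w v)] \<Longrightarrow> \<phi> v = 0"
    have "Re (\<psi> u v) = 0" "Im (\<psi> u v) = 0" "Re (\<psi> w v) = 0" "Im (\<psi> w v) = 0"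
      by (rule zero; simp)+
    then have orth: "\<psi> u v = 0" "\<psi> w v = 0" by (simp_all add: complex_eq_iff)
    obtain x y where xy: "x \<in> I" "y \<in> I" "x \<le> y" "\<forall>t\<in>I - {x<..<y}. v t = 0" and vL2: "v \<in> L2 SLM"
      using v by (auto simp: L2_compact_support_def)
    obtain h where h: "(h, \<lambda>t. v t + of_real l * h t) \<in> T_0 a b p q r s"
    proof (rule T_0_solve[OF u(1) w(1) W xy(1-3) vL2])
      show "integral {x..y} (\<lambda>t. of_real (u t) * (of_real (r t) * v t)) = 0"
        "integral {x..y} (\<lambda>t. of_real (w t) * (of_real (r t) * v t)) = 0"
        using orth L2_compact_support_integral(2)[OF vL2 xy(1,2,4)] cont unfolding \<psi>_def by auto
    qed (use xy(4) in auto)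
    have hL2: "h \<in> L2 SLM" using h by (auto simp: T_0_def T_max_def)
    have "L2_inner SLM h (\<lambda>t. v t + of_real l * h t) = L2_inner SLM h v + of_real l * L2_inner SLM h h"
      using vL2 hL2 by (simp add: L2_inner_add_right L2_scale L2_inner_scale_right)
    then have "\<gamma> * Re (L2_inner SLM h h) \<le> Re (L2_inner SLM h v) + l * Re (L2_inner SLM h h)"
      using T0[OF h] by simp
    then have "Re (L2_inner SLM h h) \<le> Re (L2_inner SLM h v)" by (simp add: l_def algebra_simps)
    moreover have "(h, v + l *\<^sub>R h) \<in> S"
      using h S(2) by (auto simp: plus_fun_def scaleR_fun_complex)
    ultimately show "\<exists>h. (h, v + l *\<^sub>R h) \<in> S \<and> Re (L2_inner SLM h h) \<le> Re (L2_inner SLM h v)" by blast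
  qed
  then obtain \<gamma>' where \<gamma>': "\<And>f g. (f, g) \<in> S \<Longrightarrow> \<gamma>' * Re (L2_inner SLM f f) \<le> Re (L2_inner SLM f g)"
    unfolding L2.form_bounded_below_def by blast
  \<comment> \<open>The abstract bound only concerns real parts; that the pairing is real follows
    from self-adjointness and conjugate symmetry.\<close>
  have real: "L2_inner SLM f g \<in> \<real>" if fg: "(f, g) \<in> S" for f g
  proof -
    have "(f, g) \<in> L2_adjoint SLM S" using fg S(1) by (simp add: L2_self_adjoint_def)
    then have "L2_inner SLM f g = L2_inner SLM g f" using fg by (auto simp: L2_adjoint_def)
    also have "\<dots> = cnj (L2_inner SLM f g)" by (rule L2_inner_commute)
    finally show ?thesis by (simp add: complex_is_Real_iff complex_eq_iff)
  qed
  show ?thesis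
    unfolding L2_bounded_below_def using real \<gamma>' by (intro exI[of _ \<gamma>']) auto
qed

end

theorem theorem11p9:
  fixes a b :: ereal and p q r s :: "real \<Rightarrow> real"
  assumes "sturm_liouville a b p q r s"
    and "AE x in lebesgue_on (einterval a b). p x > 0"
    and "\<exists>l\<^sub>a. \<not> SL_oscillatory_left a b p q r s l\<^sub>a"
    and "\<exists>l\<^sub>b. \<not> SL_oscillatory_right a b p q r s l\<^sub>b"
  shows "L2_bounded_below (SL_measure a b r) (T_0 a b p q r s)
    \<and> (\<forall>S. L2_self_adjoint (SL_measure a b r) S \<and> T_min a b p q r s \<subseteq> S
          \<longrightarrow> L2_bounded_below (SL_measure a b r) S)"
proof -
  interpret sturm_liouville_pos a b p q r s
    using assms(1,2) by (simp add: sturm_liouville_pos_def sturm_liouville_pos_axioms_def)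
  obtain \<gamma> where \<gamma>: "\<And>f g. (f, g) \<in> T_0 a b p q r s \<Longrightarrow>
      L2_inner SLM f g \<in> \<real> \<and> \<gamma> * Re (L2_inner SLM f f) \<le> Re (L2_inner SLM f g)"
    using assms(3,4) T_0_lower_bound by metis
  show ?thesis
  proof (intro conjI allI impI)
    show "L2_bounded_below (SL_measure a b r) (T_0 a b p q r s)"
      unfolding L2_bounded_below_def using \<gamma> by (intro exI[of _ \<gamma>]) auto
  next
    fix S assume S: "L2_self_adjoint (SL_measure a b r) S \<and> T_min a b p q r s \<subseteq> S"
    show "L2_bounded_below (SL_measure a b r) S"
      by (rule self_adjoint_extension_bounded_below[of \<gamma>]) (use \<gamma> S T_0_subset_T_min in auto)
  qed
qed

end
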